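(* Let $(W,T)$ be a (finite real) abstract reflection group and let $c$ be a Coxeter element of $(W,T)$. The inclusion $T\hookrightarrow P_c$ between generating sets induces an isomorphism of monoids $$\langle\, T \mid \text{dual braid relations with respect to } (W,T,c)\,\rangle_{\text{monoid}}\;\simeq\;\mathbf{M}(P_c).$$
   Context: An abstract (finite real) reflection group is a pair $(W,T)$ where $W$ is a finite group, $T\subset W$ generates $W$, and there is a faithful representation $\rho:W\hookrightarrow \mathrm{GL}(V_{\mathbb R})$, $V_{\mathbb R}$ a finite-dimensional real vector space, such that for all $w\in W$: $\operatorname{codim}\ker(\rho(w)-\mathrm{Id})=1 \Leftrightarrow w\in T$. For $w\in W$, $l_T(w)$ is the minimal length of an expression of $w$ as a product of elements of $T$. Write $w\prec_T w'$ if $l_T(w)+l_T(w^{-1}w')=l_T(w')$. A chromatic pair is an ordered pair $(L,R)$ of disjoint subsets of $T$ such that $\langle L\rangle$ and $\langle R\rangle$ are abelian and $(W,L\cup R)$ is a Coxeter system. Put $s_L=\prod_{s\in L}s$, $s_R=\prod_{s\in R}s$, $c_{L,R}=s_Ls_R$. The Coxeter elements of $(W,T)$ are the elements $c_{L,R}$, $(L,R)$ a chromatic pair. $P_c:=\{w\in W\mid w\prec_T c\}$, with the partial product: $ww'$ is defined for $w,w'\in P_c$ exactly when the product $ww'$ in $W$ lies in $P_c$ and $l_T(ww')=l_T(w)+l_T(w')$, and then it is the product in $W$. The dual braid monoid $\mathbf M(P_c)$ is the monoid with generating set $P_c$ and relations $p\cdot q=r$ for all $p,q,r\in P_c$ such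 that $pq$ is defined in $P_c$ and equals $r$. (One has $T\subset P_c$.) The dual braid relations with respect to $(W,T,c)$ are the relations $s\,t=(sts^{-1})\,s$ between words of length 2 on the alphabet $T$, where $s,t\in T$ are such that $st\prec_T c$.
   Formalization: In M(P_c) the generator 1 of P_c is identified with the unit of the monoid (extra relation: 1 equals the empty word); with only the relations p·q=r it would be a nontrivial idempotent and the isomorphism would fail. *)

theory Defs
  imports "HOL-Analysis.Analysis" "HOL-Algebra.Multiplicative_Group" "HOL-Algebra.Generated_Groups"
begin

inductive_set word_cong :: "'a set \<Rightarrow> ('a list \<times> 'a list) set \<Rightarrow> ('a list \<times> 'a list) set"
  for X :: "'a set" and R :: "('a list \<times> 'a list) set" where
  refl: "w \<in> lists X \<Longrightarrow> (w, w) \<in> word_cong X R"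
| sym: "(v, w) \<in> word_cong X R \<Longrightarrow> (w, v) \<in> word_cong X R"
| trans: "(u, v) \<in> word_cong X R \<Longrightarrow> (v, w) \<in> word_cong X R \<Longrightarrow> (u, w) \<in> word_cong X R"
| rel: "(l, r) \<in> R \<Longrightarrow> l \<in> lists X \<Longrightarrow> r \<in> lists X \<Longrightarrow> u \<in> lists X \<Longrightarrow> v \<in> lists X
    \<Longrightarrow> (u @ l @ v, u @ r @ v) \<in> word_cong X R"

definition word_class :: "'a set \<Rightarrow> ('a list \<times> 'a list) set \<Rightarrow> 'a list \<Rightarrow> 'a list set" where
  "word_class X R w = word_cong X R `` {w}"

definition presented_monoid :: "'a set \<Rightarrow> ('a list \<times> 'a list) set \<Rightarrow> 'a list set monoid" where
  "presented_monoid X R =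
     \<lparr>carrier = lists X // word_cong X R,
      monoid.mult = (\<lambda>A B. \<Union>u\<in>A. \<Union>v\<in>B. word_class X R (u @ v)),
      one = word_class X R []\<rparr>"

text \<open>The letter \<open>(x, True)\<close> stands for the generator \<open>x\<close> and \<open>(x, False)\<close> for its
  formal inverse; \<open>Rel\<close> is a set of relators.\<close>

definition presented_group ::
    "'a set \<Rightarrow> ('a \<times> bool) list set \<Rightarrow> ('a \<times> bool) list set monoid" where
  "presented_group X Rel =
     presented_monoid (X \<times> UNIV)
       ({([(x, b), (x, \<not> b)], []) | x b. x \<in> X} \<union> {(r, []) | r. r \<in> Rel})"

definition group_gen_class ::
    "'a set \<Rightarrow> ('a \<times> bool) list set \<Rightarrow> 'a \<Rightarrow> ('a \<times> bool) list set" where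
  "group_gen_class X Rel x =
     word_class (X \<times> UNIV)
       ({([(x, b), (x, \<not> b)], []) | x b. x \<in> X} \<union> {(r, []) | r. r \<in> Rel}) [(x, True)]"

lemma word_cong_lists: "(v, w) \<in> word_cong X R \<Longrightarrow> v \<in> lists X \<and> w \<in> lists X"
  by (induction rule: word_cong.induct) simp_all

lemma equiv_word_cong: "equiv (lists X) (word_cong X R)"
proof (rule equivI)
  show "word_cong X R \<subseteq> lists X \<times> lists X"
    using word_cong_lists by fastforce
  show "refl_on (lists X) (word_cong X R)"
    by (intro refl_onI word_cong.refl)
  show "sym (word_cong X R)" by (rule symI) (rule word_cong.sym)
  show "trans (word_cong X R)" by (rule transI) (rule word_cong.trans)
qed

lemma word_cong_append_left:
  assumes "(v, w) \<in> word_cong X R" "u \<in> lists X"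
  shows "(u @ v, u @ w) \<in> word_cong X R"
  using assms
proof (induction rule: word_cong.induct)
  case (rel l r a b)
  then show ?case using word_cong.rel[of l r R X "u @ a" b] by auto
next
  case (refl w)
  then show ?case by (intro word_cong.refl) auto
next
  case (sym v w)
  then show ?case by (simp add: word_cong.sym)
next
  case (trans x y z)
  then show ?case using word_cong.trans by metis
qed

lemma word_cong_append_right:
  assumes "(v, w) \<in> word_cong X R" "u \<in> lists X"
  shows "(v @ u, w @ u) \<in> word_cong X R"
  using assms
proof (induction rule: word_cong.induct)
  case (rel l r a b)
  then show ?case using word_cong.rel[of l r R X a "b @ u"] by auto
next
  case (refl w)
  then show ?case by (intro word_cong.refl) auto
next
  case (sym v w)
  then show ?case by (simp add: word_cong.sym)
next
  case (trans x y z)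
  then show ?case using word_cong.trans by metis
qed

lemma word_cong_append:
  assumes "(v, v') \<in> word_cong X R" "(w, w') \<in> word_cong X R"
  shows "(v @ w, v' @ w') \<in> word_cong X R"
  using word_cong_append_right[OF assms(1), of w] word_cong_append_left[OF assms(2), of v']
    word_cong_lists[OF assms(1)] word_cong_lists[OF assms(2)]
  by (metis word_cong.trans)

lemma presented_monoid_mult:
  assumes "v \<in> lists X" "w \<in> lists X"
  shows "word_class X R v \<otimes>\<^bsub>presented_monoid X R\<^esub> word_class X R w = word_class X R (v @ w)"
proof -
  have eq: "word_class X R (a @ b) = word_class X R (v @ w)"
    if "a \<in> word_class X R v" "b \<in> word_class X R w" for a b
  proof -
    have "(v @ w, a @ b) \<in> word_cong X R"
      using that by (intro word_cong_append) (simp_all add: word_class_def)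
    from equiv_class_eq[OF equiv_word_cong this] show ?thesis
      by (simp only: word_class_def)
  qed
  have v: "v \<in> word_class X R v" and w: "w \<in> word_class X R w"
    using assms by (simp_all only: word_class_def Image_singleton_iff word_cong.refl)
  have "(\<Union>a\<in>word_class X R v. \<Union>b\<in>word_class X R w. word_class X R (a @ b))
      = (\<Union>a\<in>word_class X R v. \<Union>b\<in>word_class X R w. word_class X R (v @ w))"
    by (intro SUP_cong HOL.refl eq)
  also have "\<dots> = word_class X R (v @ w)"
    using v w by blast
  finally show ?thesis by (simp add: presented_monoid_def)
qed

lemma presented_monoid_carrier:
  "carrier (presented_monoid X R) = word_class X R ` lists X"
  by (auto simp: presented_monoid_def quotient_def word_class_def)

lemma presented_monoid_one: "\<one>\<^bsub>presented_monoid X R\<^esub> = word_class X R []"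
  by (simp add: presented_monoid_def)

lemma monoid_presented_monoid: "monoid (presented_monoid X R)"
proof (rule monoidI)
  let ?M = "presented_monoid X R"
  fix x y z assume "x \<in> carrier ?M" "y \<in> carrier ?M" "z \<in> carrier ?M"
  then obtain u v w where "u \<in> lists X" "x = word_class X R u" "v \<in> lists X" "y = word_class X R v"
      "w \<in> lists X" "z = word_class X R w"
    unfolding presented_monoid_carrier by blast
  moreover from this have "u @ v \<in> lists X" "v @ w \<in> lists X" by auto
  ultimately show "x \<otimes>\<^bsub>?M\<^esub> y \<otimes>\<^bsub>?M\<^esub> z = x \<otimes>\<^bsub>?M\<^esub> (y \<otimes>\<^bsub>?M\<^esub> z)"
    by (simp add: presented_monoid_mult del: append_in_lists_conv)
next
  let ?M = "presented_monoid X R"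
  fix x y assume "x \<in> carrier ?M" "y \<in> carrier ?M"
  then obtain u v where "u \<in> lists X" "x = word_class X R u" "v \<in> lists X" "y = word_class X R v"
    unfolding presented_monoid_carrier by blast
  moreover from this have "u @ v \<in> lists X" by auto
  ultimately show "x \<otimes>\<^bsub>?M\<^esub> y \<in> carrier ?M"
    by (simp add: presented_monoid_mult presented_monoid_carrier
        del: append_in_lists_conv)
next
  let ?M = "presented_monoid X R"
  show "\<one>\<^bsub>?M\<^esub> \<in> carrier ?M"
    unfolding presented_monoid_carrier presented_monoid_one by blast
  fix x assume "x \<in> carrier ?M"
  then obtain u where u: "u \<in> lists X" "x = word_class X R u"
    unfolding presented_monoid_carrier by blast
  show "\<one>\<^bsub>?M\<^esub> \<otimes>\<^bsub>?M\<^esub> x = x"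
    using presented_monoid_mult[of "[]" X u R] u by (simp add: presented_monoid_one)
  show "x \<otimes>\<^bsub>?M\<^esub> \<one>\<^bsub>?M\<^esub> = x"
    using presented_monoid_mult[of u X "[]" R] u by (simp add: presented_monoid_one)
qed

definition GL :: "'v::real_vector itself \<Rightarrow> ('v \<Rightarrow> 'v) monoid" where
  "GL _ = \<lparr>carrier = {f. linear f \<and> bij f}, monoid.mult = (\<circ>), one = id\<rparr>"

text \<open>The vector space is the whole type \<open>'v\<close>, which is required to be finite-dimensional; so
  the codimension of a subspace \<open>K\<close> is \<open>1\<close> iff \<open>dim K + 1 = dim UNIV\<close>.\<close>

definition faithful_reflection_rep ::
    "('g, 'b) monoid_scheme \<Rightarrow> 'g set \<Rightarrow> ('g \<Rightarrow> 'v::real_vector \<Rightarrow> 'v) \<Rightarrow> bool" where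
  "faithful_reflection_rep W T \<rho> \<longleftrightarrow>
     (\<exists>B :: 'v set. finite B \<and> span B = UNIV) \<and>
     \<rho> \<in> hom W (GL TYPE('v)) \<and> inj_on \<rho> (carrier W) \<and>
     (\<forall>w\<in>carrier W. dim {v. \<rho> w v - v = 0} + 1 = dim (UNIV :: 'v set) \<longleftrightarrow> w \<in> T)"

definition abstract_reflection_group ::
    "'v::real_vector itself \<Rightarrow> ('g, 'b) monoid_scheme \<Rightarrow> 'g set \<Rightarrow> bool" where
  "abstract_reflection_group _ W T \<longleftrightarrow>
     group W \<and> finite (carrier W) \<and> T \<subseteq> carrier W \<and> generate W T = carrier W \<and>
     (\<exists>\<rho> :: 'g \<Rightarrow> 'v \<Rightarrow> 'v. faithful_reflection_rep W T \<rho>)"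

definition word_prod :: "('g, 'b) monoid_scheme \<Rightarrow> 'g list \<Rightarrow> 'g" where
  "word_prod W ws = foldr (\<otimes>\<^bsub>W\<^esub>) ws \<one>\<^bsub>W\<^esub>"

definition refl_length :: "('g, 'b) monoid_scheme \<Rightarrow> 'g set \<Rightarrow> 'g \<Rightarrow> nat" where
  "refl_length W T w = (LEAST n. \<exists>ts \<in> lists T. length ts = n \<and> word_prod W ts = w)"

definition refl_prec :: "('g, 'b) monoid_scheme \<Rightarrow> 'g set \<Rightarrow> 'g \<Rightarrow> 'g \<Rightarrow> bool" where
  "refl_prec W T w w' \<longleftrightarrow>
     refl_length W T w + refl_length W T (inv\<^bsub>W\<^esub> w \<otimes>\<^bsub>W\<^esub> w') = refl_length W T w'"

text \<open>Pairs \<open>s, t\<close> whose product has infinite order contribute no relation: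
  \<open>group.ord\<close> is then \<open>0\<close> and the relator is the empty word.\<close>

definition coxeter_relators :: "('g, 'b) monoid_scheme \<Rightarrow> 'g set \<Rightarrow> ('g \<times> bool) list set" where
  "coxeter_relators W S =
     {concat (replicate (group.ord W (s \<otimes>\<^bsub>W\<^esub> t)) [(s, True), (t, True)]) | s t. s \<in> S \<and> t \<in> S}"

definition coxeter_system :: "('g, 'b) monoid_scheme \<Rightarrow> 'g set \<Rightarrow> bool" where
  "coxeter_system W S \<longleftrightarrow>
     group W \<and> S \<subseteq> carrier W \<and> generate W S = carrier W \<and> (\<forall>s\<in>S. group.ord W s = 2) \<and>
     (\<exists>\<phi> \<in> iso (presented_group S (coxeter_relators W S)) W.
        \<forall>s\<in>S. \<phi> (group_gen_class S (coxeter_relators W S) s) = s)"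

definition chromatic_pair ::
    "('g, 'b) monoid_scheme \<Rightarrow> 'g set \<Rightarrow> 'g set \<Rightarrow> 'g set \<Rightarrow> bool" where
  "chromatic_pair W T L R \<longleftrightarrow>
     L \<subseteq> T \<and> R \<subseteq> T \<and> L \<inter> R = {} \<and>
     comm_group (W\<lparr>carrier := generate W L\<rparr>) \<and> comm_group (W\<lparr>carrier := generate W R\<rparr>) \<and>
     coxeter_system W (L \<union> R)"

text \<open>The product is taken in the abelian group generated by \<open>L\<close>, where it does not depend on
  the order of the factors.\<close>

definition color_prod :: "('g, 'b) monoid_scheme \<Rightarrow> 'g set \<Rightarrow> 'g" where
  "color_prod W L = finprod (W\<lparr>carrier := generate W L\<rparr>) (\<lambda>s. s) L"

definition coxeter_element :: "('g, 'b) monoid_scheme \<Rightarrow> 'g set \<Rightarrow> 'g \<Rightarrow> bool" where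
  "coxeter_element W T c \<longleftrightarrow>
     (\<exists>L R. chromatic_pair W T L R \<and> c = color_prod W L \<otimes>\<^bsub>W\<^esub> color_prod W R)"

definition dual_P :: "('g, 'b) monoid_scheme \<Rightarrow> 'g set \<Rightarrow> 'g \<Rightarrow> 'g set" where
  "dual_P W T c = {w \<in> carrier W. refl_prec W T w c}"

definition dual_P_defined :: "('g, 'b) monoid_scheme \<Rightarrow> 'g set \<Rightarrow> 'g \<Rightarrow> 'g \<Rightarrow> 'g \<Rightarrow> bool" where
  "dual_P_defined W T c p q \<longleftrightarrow>
     p \<in> dual_P W T c \<and> q \<in> dual_P W T c \<and> p \<otimes>\<^bsub>W\<^esub> q \<in> dual_P W T c \<and>
     refl_length W T (p \<otimes>\<^bsub>W\<^esub> q) = refl_length W T p + refl_length W T q"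

text \<open>The partial product has the unit \<open>\<one>\<^bsub>W\<^esub>\<close>, and this unit is the
  unit of the dual braid monoid. The relations \<open>p \<cdot> q = r\<close> between nonempty words alone would
  make the generator \<open>\<one>\<^bsub>W\<^esub>\<close> an idempotent different from the empty word, so
  the relation identifying the two is included.\<close>

definition dual_monoid_rels ::
    "('g, 'b) monoid_scheme \<Rightarrow> 'g set \<Rightarrow> 'g \<Rightarrow> ('g list \<times> 'g list) set" where
  "dual_monoid_rels W T c =
     {([p, q], [r]) | p q r. dual_P_defined W T c p q \<and> p \<otimes>\<^bsub>W\<^esub> q = r} \<union> {([\<one>\<^bsub>W\<^esub>], [])}"

definition dual_braid_monoid :: "('g, 'b) monoid_scheme \<Rightarrow> 'g set \<Rightarrow> 'g \<Rightarrow> 'g list set monoid" where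
  "dual_braid_monoid W T c = presented_monoid (dual_P W T c) (dual_monoid_rels W T c)"

definition dual_braid_rels ::
    "('g, 'b) monoid_scheme \<Rightarrow> 'g set \<Rightarrow> 'g \<Rightarrow> ('g list \<times> 'g list) set" where
  "dual_braid_rels W T c =
     {([s, t], [s \<otimes>\<^bsub>W\<^esub> t \<otimes>\<^bsub>W\<^esub> inv\<^bsub>W\<^esub> s, s]) | s t. s \<in> T \<and> t \<in> T \<and> refl_prec W T (s \<otimes>\<^bsub>W\<^esub> t) c}"

end

theory Submission
  imports Defs
begin

text \<open>Both presentations reduce to one statement: for every \<open>p\<close> below \<open>c\<close>, any two shortest
  factorisations of \<open>p\<close> into reflections are related by Hurwitz moves
  \<open>(s, t) \<rightarrow> (sts\<inverse>, s)\<close>. A peak of the Coxeter length along the partial products of a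
  factorisation can be removed by Hurwitz moves, so every shortest factorisation can be made
  ascending, and the exchange condition leads from an ascending factorisation of a product of
  distinct simple reflections to that product itself. Conversely, every reflection of the parabolic
  subgroup is, up to conjugation by a power of such a product \<open>q\<close>, an inversion of \<open>q\<close>, since the
  sum of a \<open>q\<close>-orbit of positive roots in the Tits representation would be fixed by \<open>q\<close>; hence
  removing a reflection from \<open>q\<close> leaves a conjugate of a shorter product of distinct simple
  reflections, which reaches all \<open>p\<close> below \<open>c\<close> and shows that all reflections are below \<open>c\<close>.
  The given representation serves only to show that \<open>T\<close> consists of the conjugates of the simple
  reflections: the product of the linear forms of all reflections changes sign under each of them.\<close>

section \<open>Words and length\<close>

text \<open>A shortest factorisation chosen for each \<open>p\<close> below \<open>c\<close> turns a
  relation \<open>p q = r\<close> of the dual monoid into a pair of shortest factorisations of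
  \<open>r\<close>. Conversely, a Hurwitz move between shortest factorisations acts on two
  neighbouring letters whose product is again below \<open>c\<close>, so it is a dual braid
  relation. Peaks are removed inside the dihedral group of two neighbouring letters: a stubborn peak
  would give a reflection of smallest length in that group's Hurwitz orbit too many inversions. The
  exchange argument needs a product of simple reflections, and an element below \<open>c\<close> is
  in general not one. Conjugation by a power of \<open>q\<close> helps because it leaves
  \<open>q\<close> itself unchanged, so an element below \<open>q\<close> can be moved below a
  shorter word of simple reflections. The set \<open>T\<close> is defined by a representation with
  no a priori relation to the Tits representation, and a chromatic pair only places the simple
  reflections inside \<open>T\<close>. Hence \<open>T\<close> has to be identified
  separately.\<close>

lemma word_prod_Nil [simp]: "word_prod G [] = \<one>\<^bsub>G\<^esub>"
  and word_prod_Cons [simp]: "word_prod G (x # ws) = x \<otimes>\<^bsub>G\<^esub> word_prod G ws"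
  by (simp_all add: word_prod_def)

context group
begin

lemma inv_mult_cancel [simp]:
  "x \<in> carrier G \<Longrightarrow> y \<in> carrier G \<Longrightarrow> inv x \<otimes> (x \<otimes> y) = y"
  "x \<in> carrier G \<Longrightarrow> y \<in> carrier G \<Longrightarrow> x \<otimes> (inv x \<otimes> y) = y"
  by (simp_all flip: m_assoc)

lemma word_prod_closed [simp]: "set ws \<subseteq> carrier G \<Longrightarrow> word_prod G ws \<in> carrier G"
  by (induction ws) auto

lemma word_prod_append:
  "set us \<subseteq> carrier G \<Longrightarrow> set vs \<subseteq> carrier G \<Longrightarrow>
    word_prod G (us @ vs) = word_prod G us \<otimes> word_prod G vs"
  by (induction us) (auto simp: m_assoc)

lemma word_prod_in_generate: "set ws \<subseteq> X \<Longrightarrow> word_prod G ws \<in> generate G X"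
  by (induction ws) (auto intro: generate.one generate.eng generate.incl)

lemma word_prod_map_conj:
  assumes "x \<in> carrier G" "set ws \<subseteq> carrier G"
  shows "word_prod G (map (\<lambda>t. x \<otimes> t \<otimes> inv x) ws) = x \<otimes> word_prod G ws \<otimes> inv x"
  using assms(2)
proof (induction ws)
  case Nil
  then show ?case using assms(1) by simp
next
  case (Cons t ws)
  then show ?case using assms(1) by (simp add: m_assoc)
qed

end

text \<open>Instantiated twice over the same group: with the simple reflections, where
  \<open>len\<close> is the Coxeter length, and with all reflections, where it is the reflection
  length. Hence only generation and involutivity are assumed.\<close>

locale involutive_generators = group +
  fixes X
  assumes gens_carrier: "X \<subseteq> carrier G"
    and generate_gens: "generate G X = carrier G"
    and gen_square: "x \<in> X \<Longrightarrow> x \<otimes> x = \<one>"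
begin

abbreviation len :: "'a \<Rightarrow> nat" where "len \<equiv> refl_length G X"

lemma gen_closed [simp]: "x \<in> X \<Longrightarrow> x \<in> carrier G"
  using gens_carrier by auto

lemma gen_inv [simp]: "x \<in> X \<Longrightarrow> inv x = x"
  by (simp add: gen_square inv_equality)

lemma gen_cancel [simp]: "x \<in> X \<Longrightarrow> y \<in> carrier G \<Longrightarrow> x \<otimes> (x \<otimes> y) = y"
  using inv_mult_cancel(1)[of x y] by simp

lemma word_prod_gens [simp]: "set ws \<subseteq> X \<Longrightarrow> word_prod G ws \<in> carrier G"
  using gens_carrier by (intro word_prod_closed) auto

lemma word_prod_gens_append:
  "set us \<subseteq> X \<Longrightarrow> set vs \<subseteq> X \<Longrightarrow> word_prod G (us @ vs) = word_prod G us \<otimes> word_prod G vs"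
  using gens_carrier by (intro word_prod_append) auto

lemma word_prod_rev: "set ws \<subseteq> X \<Longrightarrow> word_prod G (rev ws) = inv (word_prod G ws)"
  by (induction ws) (simp_all add: word_prod_gens_append inv_mult_group)

lemma generate_word:
  assumes "Y \<subseteq> X" "w \<in> generate G Y"
  shows "\<exists>ws. set ws \<subseteq> Y \<and> word_prod G ws = w"
  using assms(2)
proof (induction rule: generate.induct)
  case one
  show ?case by (intro exI[of _ "[]"]) auto
next
  case (incl h)
  then show ?case using assms(1) by (intro exI[of _ "[h]"]) auto
next
  case (inv h)
  then have "h \<in> X" using assms(1) by auto
  with inv show ?case by (intro exI[of _ "[h]"]) auto
next
  case (eng h1 h2)
  then obtain us vs where "set us \<subseteq> Y" "set vs \<subseteq> Y" "word_prod G us = h1" "word_prod G vs = h2"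
    by auto
  moreover from this have "set us \<subseteq> X" "set vs \<subseteq> X"
    using assms(1) by auto
  ultimately show ?case
    by (intro exI[of _ "us @ vs"]) (auto simp: word_prod_gens_append)
qed

lemma reduced_word:
  assumes "w \<in> carrier G"
  obtains ws where "set ws \<subseteq> X" "word_prod G ws = w" "length ws = len w"
proof -
  have "\<exists>n. \<exists>ws\<in>lists X. length ws = n \<and> word_prod G ws = w"
    using generate_word[of X w] assms generate_gens by (auto simp: lists_eq_set)
  from LeastI_ex[OF this] that show ?thesis
    unfolding refl_length_def by (auto simp only: lists_eq_set)
qed

lemma len_word_prod: "set ws \<subseteq> X \<Longrightarrow> len (word_prod G ws) \<le> length ws"
  unfolding refl_length_def by (rule Least_le) (auto simp: lists_eq_set)

lemma len_mult_le: "x \<in> carrier G \<Longrightarrow> y \<in> carrier G \<Longrightarrow> len (x \<otimes> y) \<le> len x + len y"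
  by (elim reduced_word) (use len_word_prod[of "_ @ _"] word_prod_gens_append in fastforce)

lemma len_one [simp]: "len \<one> = 0"
  using len_word_prod[of "[]"] by simp

lemma len_eq_0_iff: "w \<in> carrier G \<Longrightarrow> len w = 0 \<longleftrightarrow> w = \<one>"
  by (metis len_one length_0_conv reduced_word word_prod_Nil)

lemma len_inv [simp]: "w \<in> carrier G \<Longrightarrow> len (inv w) = len w"
proof -
  have "len (inv w) \<le> len w" if w: "w \<in> carrier G" for w
  proof -
    obtain ws where ws: "set ws \<subseteq> X" "word_prod G ws = w" "length ws = len w"
      using reduced_word[OF w] .
    then show ?thesis
      using len_word_prod[of "rev ws"] by (auto simp: word_prod_rev)
  qed
  from this[of w] this[of "inv w"] show "w \<in> carrier G \<Longrightarrow> len (inv w) = len w"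
    by simp
qed

lemma len_gen_le: "x \<in> X \<Longrightarrow> len x \<le> 1"
  using len_word_prod[of "[x]"] by simp

lemma len_gen_mult_le:
  assumes "x \<in> X" "w \<in> carrier G"
  shows "len (x \<otimes> w) \<le> Suc (len w)" "len (w \<otimes> x) \<le> Suc (len w)"
    "len w \<le> Suc (len (x \<otimes> w))" "len w \<le> Suc (len (w \<otimes> x))"
  using len_mult_le[of x w] len_mult_le[of w x] len_mult_le[of x "x \<otimes> w"]
    len_mult_le[of "w \<otimes> x" x] len_gen_le[of x] assms
  by (auto simp: m_assoc gen_square)

lemma reduced_append:
  assumes "set us \<subseteq> X" "set vs \<subseteq> X" "len (word_prod G (us @ vs)) = length (us @ vs)"
  shows "len (word_prod G us) = length us" "len (word_prod G vs) = length vs"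
  using len_mult_le[of "word_prod G us" "word_prod G vs"] len_word_prod[of us] len_word_prod[of vs]
    assms by (auto simp: word_prod_gens_append)

lemma obtain_right_descent:
  assumes "w \<in> carrier G" "w \<noteq> \<one>"
  obtains x where "x \<in> X" "len (w \<otimes> x) < len w"
proof -
  obtain ws where ws: "set ws \<subseteq> X" "word_prod G ws = w" "length ws = len w"
    using reduced_word[OF assms(1)] .
  with assms have "ws \<noteq> []" by auto
  then obtain vs x where eq: "ws = vs @ [x]" by (metis rev_exhaust)
  with ws have x: "x \<in> X" "set vs \<subseteq> X" by auto
  with ws eq have "w \<otimes> x = word_prod G vs"
    by (auto simp: word_prod_gens_append m_assoc gen_square)
  with len_word_prod[of vs] x ws(3) eq have "len (w \<otimes> x) < len w" by simp
  with x that show ?thesis by blast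
qed

end

section \<open>The Tits representation of a finite Coxeter group\<close>

text \<open>Built from the right end: a nonempty word ends in \<open>r\<close>, the letter that acts
  first on a vector.\<close>

fun alternating :: "'a \<Rightarrow> 'a \<Rightarrow> nat \<Rightarrow> 'a list" where
  "alternating s r 0 = []"
| "alternating s r (Suc k) = alternating r s k @ [r]"

lemma length_alternating [simp]: "length (alternating s r k) = k"
  by (induction s r k rule: alternating.induct) auto

lemma set_alternating: "set (alternating s r k) \<subseteq> {s, r}"
  by (induction s r k rule: alternating.induct) auto

lemma alternating_Suc_left:
  "alternating s r (Suc k) = (if even k then r else s) # alternating s r k"
proof (induction k arbitrary: s r)
  case (Suc k)
  have "alternating s r (Suc (Suc k)) = alternating r s (Suc k) @ [r]" by simp
  also have "\<dots> = (if even k then s else r) # alternating r s k @ [r]"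
    by (subst Suc.IH) simp
  finally show ?case by auto
qed auto

lemma rev_alternating:
  "rev (alternating s r k) = (if even k then alternating r s k else alternating s r k)"
proof (induction k arbitrary: s r)
  case (Suc k)
  have "rev (alternating s r (Suc k)) = r # (if even k then alternating s r k else alternating r s k)"
    by (simp add: Suc.IH)
  then show ?case
    using alternating_Suc_left[of s r k] alternating_Suc_left[of r s k]
    by (simp del: alternating.simps)
qed auto

lemma alternating_add:
  "alternating s r (a + b) = (if even b then alternating s r a else alternating r s a) @ alternating s r b"
  by (induction b arbitrary: s r) auto

lemma alternating_double: "alternating s r (2 * k) = concat (replicate k [s, r])"
proof (induction k)
  case (Suc k)
  have "concat (replicate (Suc k) [s, r]) = concat (replicate k [s, r]) @ [s, r]"
    by (simp flip: replicate_append_same)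
  then show ?case using Suc by simp
qed auto

section \<open>The Coxeter presentation and the parity of the length\<close>

locale finite_coxeter = group +
  fixes S
  assumes finite_carrier: "finite (carrier G)"
    and coxeter: "coxeter_system G S"
begin

sublocale involutive_generators G S
proof
  fix x assume "x \<in> S"
  then show "x \<otimes> x = \<one>"
    using coxeter pow_ord_eq_1[of x] unfolding coxeter_system_def
    by (auto simp: numeral_2_eq_2 subset_iff)
qed (use coxeter in \<open>auto simp: coxeter_system_def\<close>)

lemma finite_gens: "finite S"
  using finite_subset[OF gens_carrier finite_carrier] .

text \<open>The universal property of the Coxeter presentation, for functions on words without
  signs. Forgetting the sign of each letter turns a formal inverse pair into a square
  \<open>[s, s]\<close>, so invariance under squares and relators gives invariance under the whole
  congruence; injectivity of the isomorphism onto \<open>G\<close> makes words with equal product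
  congruent.\<close>

lemma presentation_invariant:
  assumes square: "\<And>u v s. s \<in> S \<Longrightarrow> set u \<subseteq> S \<Longrightarrow> set v \<subseteq> S \<Longrightarrow> f (u @ [s, s] @ v) = f (u @ v)"
    and braid: "\<And>u v s t. s \<in> S \<Longrightarrow> t \<in> S \<Longrightarrow> set u \<subseteq> S \<Longrightarrow> set v \<subseteq> S \<Longrightarrow>
      f (u @ concat (replicate (ord (s \<otimes> t)) [s, t]) @ v) = f (u @ v)"
    and ws: "set ws \<subseteq> S" "set ws' \<subseteq> S" "word_prod G ws = word_prod G ws'"
  shows "f ws = f ws'"
proof -
  let ?X = "S \<times> (UNIV :: bool set)"
  let ?R = "{([(x, b), (x, \<not> b)], []) | x b. x \<in> S} \<union> {(r, []) | r. r \<in> coxeter_relators G S}"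
  let ?M = "presented_group S (coxeter_relators G S)"
  let ?pos = "map (\<lambda>s. (s, True))"
  have M: "?M = presented_monoid ?X ?R"
    by (simp add: presented_group_def)
  have invariant: "f (map fst a) = f (map fst b)" if "(a, b) \<in> word_cong ?X ?R" for a b
    using that
  proof (induction rule: word_cong.induct)
    case (rel l r u v)
    have uv: "set (map fst u) \<subseteq> S" "set (map fst v) \<subseteq> S"
      using rel by (auto simp: lists_eq_set)
    from rel(1) consider x b where "x \<in> S" "l = [(x, b), (x, \<not> b)]" "r = []"
      | s t where "s \<in> S" "t \<in> S"
          "l = concat (replicate (ord (s \<otimes> t)) [(s, True), (t, True)])" "r = []"
      unfolding coxeter_relators_def by blast
    then show ?case
    proof cases
      case 1
      then show ?thesis using square[OF 1(1) uv] by simp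
    next
      case 2
      then show ?thesis using braid[OF 2(1,2) uv] by (simp add: map_concat)
    qed
  qed auto
  obtain \<phi> where \<phi>: "\<phi> \<in> iso ?M G" "\<And>s. s \<in> S \<Longrightarrow> \<phi> (group_gen_class S (coxeter_relators G S) s) = s"
    using coxeter unfolding coxeter_system_def by blast
  interpret M: monoid ?M
    unfolding M by (rule monoid_presented_monoid)
  have \<phi>_hom: "\<phi> \<in> hom ?M G" and \<phi>_inj: "inj_on \<phi> (carrier ?M)"
    using \<phi>(1) by (auto simp: iso_def bij_betw_def)
  have in_carrier: "word_class ?X ?R w \<in> carrier ?M" if "w \<in> lists ?X" for w
    using that by (auto simp: M presented_monoid_carrier)
  have one: "\<phi> (word_class ?X ?R []) = \<one>"
  proof -
    have "\<phi> \<one>\<^bsub>?M\<^esub> \<otimes> \<phi> \<one>\<^bsub>?M\<^esub> = \<phi> \<one>\<^bsub>?M\<^esub>" and "\<phi> \<one>\<^bsub>?M\<^esub> \<in> carrier G"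
      using hom_mult[OF \<phi>_hom M.one_closed M.one_closed] hom_in_carrier[OF \<phi>_hom M.one_closed] by auto
    then have "\<phi> \<one>\<^bsub>?M\<^esub> = \<one>" by (metis l_cancel_one)
    then show ?thesis by (simp add: M presented_monoid_one)
  qed
  have \<phi>_word: "\<phi> (word_class ?X ?R (?pos w)) = word_prod G w" if "set w \<subseteq> S" for w
    using that
  proof (induction w)
    case (Cons s w)
    have l: "[(s, True)] \<in> lists ?X" "?pos w \<in> lists ?X"
      using Cons.prems by auto
    have "word_class ?X ?R (?pos (s # w)) = word_class ?X ?R [(s, True)] \<otimes>\<^bsub>?M\<^esub> word_class ?X ?R (?pos w)"
      using presented_monoid_mult[OF l, of ?R] by (simp add: M)
    moreover have "word_class ?X ?R [(s, True)] = group_gen_class S (coxeter_relators G S) s"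
      by (simp add: group_gen_class_def)
    ultimately show ?case
      using hom_mult[OF \<phi>_hom in_carrier[OF l(1)] in_carrier[OF l(2)]] \<phi>(2)[of s] Cons by simp
  qed (simp only: list.map one word_prod_Nil)
  have l: "?pos ws \<in> lists ?X" "?pos ws' \<in> lists ?X" using ws by auto
  have "word_class ?X ?R (?pos ws) = word_class ?X ?R (?pos ws')"
    using \<phi>_word[OF ws(1)] \<phi>_word[OF ws(2)] ws(3)
    by (intro inj_onD[OF \<phi>_inj] in_carrier l) (simp only:)
  then have "(?pos ws, ?pos ws') \<in> word_cong ?X ?R"
    unfolding word_class_def by (rule eq_equiv_class[OF _ equiv_word_cong]) (rule l)
  from invariant[OF this] show ?thesis by (simp add: comp_def)
qed

text \<open>All relators have even length, so the parity of a word depends only on its product: this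
  is the sign character.\<close>

lemma even_len_word_prod:
  assumes "set ws \<subseteq> S"
  shows "even (len (word_prod G ws)) \<longleftrightarrow> even (length ws)"
proof -
  have "word_prod G ws \<in> carrier G"
    using assms by auto
  then obtain vs where vs: "set vs \<subseteq> S" "word_prod G vs = word_prod G ws" "length vs = len (word_prod G ws)"
    using reduced_word by blast
  have "even (length vs) = even (length ws)"
    by (rule presentation_invariant[where f = "\<lambda>w. even (length w)"])
      (use assms vs in \<open>auto simp: length_concat sum_list_replicate\<close>)
  with vs show ?thesis by simp
qed

lemma even_len_mult:
  assumes "x \<in> carrier G" "y \<in> carrier G"
  shows "even (len (x \<otimes> y)) \<longleftrightarrow> (even (len x) \<longleftrightarrow> even (len y))"
proof -
  obtain us vs where "set us \<subseteq> S" "word_prod G us = x" "set vs \<subseteq> S" "word_prod G vs = y"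
    using assms by (metis reduced_word)
  then show ?thesis
    using even_len_word_prod[of us] even_len_word_prod[of vs] even_len_word_prod[of "us @ vs"]
    by (auto simp: word_prod_gens_append)
qed

lemma odd_len_gen: "s \<in> S \<Longrightarrow> odd (len s)"
  using even_len_word_prod[of "[s]"] by simp

lemma len_mult_gen_neq:
  assumes "s \<in> S" "w \<in> carrier G"
  shows "len (w \<otimes> s) \<noteq> len w"
  using even_len_mult[of w s] odd_len_gen assms by (metis gen_closed)

section \<open>The Tits form and the action of words\<close>

definition kern :: "'a \<Rightarrow> 'a \<Rightarrow> real" where
  "kern s t = - cos (pi / real (ord (s \<otimes> t)))"

text \<open>Vectors are coordinate functions with respect to the simple roots, so this is the
  pairing of \<open>v\<close> with the simple root of \<open>s\<close> under the bilinear form with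
  matrix \<open>kern\<close>. Coordinates outside \<open>S\<close> do not enter.\<close>

definition form :: "('a \<Rightarrow> real) \<Rightarrow> 'a \<Rightarrow> real" where
  "form v s = (\<Sum>x\<in>S. v x * kern x s)"

definition act1 :: "'a \<Rightarrow> ('a \<Rightarrow> real) \<Rightarrow> 'a \<Rightarrow> real" where
  "act1 s v = v(s := v s - 2 * form v s)"

definition act :: "'a list \<Rightarrow> ('a \<Rightarrow> real) \<Rightarrow> 'a \<Rightarrow> real" where
  "act ws v = foldr act1 ws v"

definition simple :: "'a \<Rightarrow> 'a \<Rightarrow> real" where
  "simple s = (\<lambda>x. if x = s then 1 else 0)"

text \<open>An arbitrary word of \<open>w\<close> is chosen; independence of the choice is
  \<open>tits_word_prod\<close>, once the relators are known to act trivially.\<close>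

definition tits :: "'a \<Rightarrow> ('a \<Rightarrow> real) \<Rightarrow> 'a \<Rightarrow> real" where
  "tits w = act (SOME ws. set ws \<subseteq> S \<and> word_prod G ws = w)"

lemma act_simps [simp]: "act [] v = v" "act (s # ws) v = act1 s (act ws v)"
  "act (us @ vs) v = act us (act vs v)"
  by (simp_all add: act_def)

lemma kern_self: "s \<in> S \<Longrightarrow> kern s s = 1"
  by (simp add: kern_def gen_square)

lemma kern_sym: "s \<in> S \<Longrightarrow> t \<in> S \<Longrightarrow> kern s t = kern t s"
  using ord_inv[of "s \<otimes> t"] by (simp add: kern_def inv_mult_group)

lemma form_linear: "form (\<lambda>x. a * u x + b * v x) s = a * form u s + b * form v s"
  by (simp add: form_def sum.distrib sum_distrib_left algebra_simps)

lemma form_simple: "s \<in> S \<Longrightarrow> form (simple s) t = kern s t"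
  using finite_gens by (simp add: form_def simple_def if_distrib[of "\<lambda>c. c * _"] cong: if_cong)

lemma act1_eq: "act1 s v = (\<lambda>x. 1 * v x + (- 2 * form v s) * simple s x)"
  by (auto simp: act1_def simple_def)

lemma act1_linear: "act1 s (\<lambda>x. a * u x + b * v x) = (\<lambda>x. a * act1 s u x + b * act1 s v x)"
  unfolding act1_def by (auto simp: form_linear algebra_simps)

lemma act_linear: "act ws (\<lambda>x. a * u x + b * v x) = (\<lambda>x. a * act ws u x + b * act ws v x)"
  by (induction ws) (simp_all add: act1_linear)

lemma act1_act1:
  assumes "s \<in> S"
  shows "act1 s (act1 s v) = v"
proof -
  have "form (act1 s v) s = - form v s"
    unfolding act1_eq[of s v] using assms by (simp only: form_linear form_simple kern_self)
  then show ?thesis by (auto simp: act1_def)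
qed

lemma act_rev_act: "set ws \<subseteq> S \<Longrightarrow> act (rev ws) (act ws v) = v"
  by (induction ws) (auto simp: act1_act1)

lemma ord_pos: "w \<in> carrier G \<Longrightarrow> ord w > 0"
  using ord_ge_1[OF finite_carrier, of w] by linarith

lemma ord_ge_2:
  assumes "s \<in> S" "r \<in> S" "s \<noteq> r"
  shows "ord (s \<otimes> r) \<ge> 2"
proof -
  have "s \<otimes> r \<noteq> \<one>"
    using assms by (metis gen_closed gen_inv inv_equality inv_inv)
  then have "ord (s \<otimes> r) \<noteq> 1"
    using assms ord_eq_1[of "s \<otimes> r"] by simp
  then show ?thesis using ord_pos[of "s \<otimes> r"] assms by simp
qed

text \<open>By sin((n+2)\<theta>) + sin(n\<theta>) = 2 cos(\<theta>) sin((n+1)\<theta>), one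
  reflection advances both sine coordinates by one multiple of \<open>\<theta>\<close> and exchanges
  the roles of \<open>s\<close> and \<open>r\<close>. The free index \<open>j\<close> carries the
  induction.\<close>

lemma act_alternating:
  fixes j k :: nat
  assumes "s \<in> S" "r \<in> S" and "\<theta> = pi / real (ord (s \<otimes> r))"
  shows "act (alternating s r k) (\<lambda>x. sin (real (Suc j) * \<theta>) * simple s x + sin (real j * \<theta>) * simple r x) =
    (\<lambda>x. sin (real (Suc (j + k)) * \<theta>) * simple (if even k then s else r) x
        + sin (real (j + k) * \<theta>) * simple (if even k then r else s) x)"
  using assms
proof (induction k arbitrary: s r j)
  case (Suc k)
  define a b c where "a = sin (real (Suc j) * \<theta>)" and "b = sin (real j * \<theta>)"
    and "c = sin (real (Suc (Suc j)) * \<theta>)"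
  define X where "X = a * - cos \<theta> + b * 1"
  have kern: "kern s r = - cos \<theta>" using Suc.prems by (simp add: kern_def)
  have "c + b = 2 * cos \<theta> * a"
  proof -
    have "(real (Suc (Suc j)) * \<theta> + real j * \<theta>) / 2 = real (Suc j) * \<theta>"
      "(real (Suc (Suc j)) * \<theta> - real j * \<theta>) / 2 = \<theta>"
      by (simp_all add: field_simps)
    then show ?thesis
      using sin_plus_sin[of "real (Suc (Suc j)) * \<theta>" "real j * \<theta>"]
      by (simp add: a_def b_def c_def del: of_nat_Suc)
  qed
  then have b: "b = 2 * X + c" by (simp add: X_def algebra_simps)
  have "form (\<lambda>x. a * simple s x + b * simple r x) r = X"
    using Suc.prems by (simp only: form_linear form_simple kern kern_self X_def)
  then have "act1 r (\<lambda>x. a * simple s x + b * simple r x) = (\<lambda>x. c * simple r x + a * simple s x)"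
    unfolding act1_eq by (simp add: fun_eq_iff b algebra_simps)
  then have "act (alternating s r (Suc k)) (\<lambda>x. a * simple s x + b * simple r x) =
      act (alternating r s k) (\<lambda>x. c * simple r x + a * simple s x)"
    by simp
  moreover have "\<theta> = pi / real (ord (r \<otimes> s))"
    using Suc.prems ord_inv[of "s \<otimes> r"] by (simp add: inv_mult_group)
  from Suc.IH[OF Suc.prems(2,1) this, of "Suc j"]
  have "act (alternating r s k) (\<lambda>x. c * simple r x + a * simple s x) =
      (\<lambda>x. sin (real (Suc (j + Suc k)) * \<theta>) * simple (if even (Suc k) then s else r) x
        + sin (real (j + Suc k) * \<theta>) * simple (if even (Suc k) then r else s) x)"
    by (simp add: a_def c_def del: of_nat_Suc)
  ultimately show ?case unfolding a_def b_def by (rule HOL.trans)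
qed simp

text \<open>A vector splits into a part in the plane of the two simple roots and a part
  \<open>u\<close> paired to zero with both. Both reflections fix \<open>u\<close>, and on the plane
  the relator advances the angle by 2m\<theta> = 2\<pi>, so it is trivial there.\<close>

lemma act_relator:
  assumes "s \<in> S" "r \<in> S"
  shows "act (concat (replicate (ord (s \<otimes> r)) [s, r])) v = v"
proof (cases "s = r")
  case True
  then show ?thesis using assms by (simp add: gen_square act1_act1)
next
  case False
  define m where "m = ord (s \<otimes> r)"
  define \<theta> where "\<theta> = pi / real m"
  have m: "m \<ge> 2" unfolding m_def using ord_ge_2[OF assms False] .
  have m\<theta>: "real (2 * m) * \<theta> = 2 * pi" using m by (simp add: \<theta>_def)
  have "0 < \<theta>" "\<theta> < pi" using m by (auto simp: \<theta>_def field_simps)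
  then have sin: "sin \<theta> > 0" by (rule sin_gt_zero)
  have fix_simple: "act (alternating a b (2 * m)) (simple a) = simple a"
    if ab: "a \<in> S" "b \<in> S" "ord (a \<otimes> b) = m" for a b
  proof -
    have "real (Suc (0 + 2 * m)) * \<theta> = \<theta> + 2 * pi" "real (0 + 2 * m) * \<theta> = 2 * pi"
      using m\<theta> by (simp_all add: algebra_simps)
    then have periodic: "sin (real (Suc (0 + 2 * m)) * \<theta>) = sin \<theta>" "sin (real (0 + 2 * m) * \<theta>) = 0"
      by (simp_all only: sin_periodic sin_two_pi)
    have "act (alternating a b (2 * m)) (\<lambda>x. sin \<theta> * simple a x + 0 * simple b x)
      = (\<lambda>x. sin \<theta> * simple a x + 0 * simple b x)"
      using act_alternating[of a b \<theta> "2 * m" 0] ab \<theta>_def unfolding periodic by simp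
    then have "(\<lambda>x. sin \<theta> * act (alternating a b (2 * m)) (simple a) x) = (\<lambda>x. sin \<theta> * simple a x)"
      by (subst (asm) act_linear) simp
    then show ?thesis using sin by (auto simp: fun_eq_iff)
  qed
  let ?W = "alternating s r (2 * m)"
  have m': "ord (r \<otimes> s) = m"
    using assms ord_inv[of "s \<otimes> r"] by (simp add: inv_mult_group m_def)
  have s: "act ?W (simple s) = simple s"
    using fix_simple assms m_def by simp
  \<comment> \<open>The word for \<open>(s, r)\<close> is the reverse of the word for
    \<open>(r, s)\<close>, which already fixes \<open>simple r\<close>.\<close>
  have r: "act ?W (simple r) = simple r"
  proof -
    have "act (rev (alternating r s (2 * m))) (act (alternating r s (2 * m)) (simple r)) = simple r"
      using assms set_alternating[of r s "2 * m"] by (intro act_rev_act) auto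
    then show ?thesis
      using fix_simple[of r s] assms m' by (simp add: rev_alternating)
  qed
  define k where "k = kern s r"
  have "k\<^sup>2 + (sin \<theta>)\<^sup>2 = 1"
    by (simp add: k_def kern_def \<theta>_def m_def)
  then have k: "1 - k\<^sup>2 \<noteq> 0" using sin by (metis diff_add_cancel add.commute add_diff_cancel_left' less_irrefl zero_eq_power2)
  \<comment> \<open>Cramer's rule for the system \<open>p + q * k = form v s\<close>,
    \<open>p * k + q = form v r\<close>. Its determinant \<open>1 - k\<^sup>2\<close> is the square
    of \<open>sin \<theta>\<close>.\<close>
  define p where "p = (form v s - k * form v r) / (1 - k\<^sup>2)"
  define q where "q = (form v r - k * form v s) / (1 - k\<^sup>2)"
  have pq: "p + q * k = form v s" "p * k + q = form v r"
  proof -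
    have p: "p * (1 - k\<^sup>2) = form v s - k * form v r" and q: "q * (1 - k\<^sup>2) = form v r - k * form v s"
      using k by (simp_all add: p_def q_def)
    have "(p + q * k) * (1 - k\<^sup>2) = p * (1 - k\<^sup>2) + k * (q * (1 - k\<^sup>2))"
      "(p * k + q) * (1 - k\<^sup>2) = k * (p * (1 - k\<^sup>2)) + q * (1 - k\<^sup>2)"
      by (simp_all add: algebra_simps)
    then have "(p + q * k) * (1 - k\<^sup>2) = form v s * (1 - k\<^sup>2)"
      "(p * k + q) * (1 - k\<^sup>2) = form v r * (1 - k\<^sup>2)"
      unfolding p q by (simp_all add: algebra_simps power2_eq_square)
    then show "p + q * k = form v s" "p * k + q = form v r" using k by simp_all
  qed
  define z where "z = (\<lambda>x. p * simple s x + q * simple r x)"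
  define u where "u = (\<lambda>x. 1 * v x + (- 1) * z x)"
  have z: "act ?W z = z"
    by (simp add: z_def act_linear s r)
  have "form z s = form v s" "form z r = form v r"
    unfolding z_def form_linear
    using assms pq kern_sym[of r s] by (simp_all add: form_simple kern_self k_def)
  then have "form u s = 0" "form u r = 0"
    unfolding u_def form_linear by simp_all
  then have "act1 s u = u" "act1 r u = u" by (simp_all add: act1_def)
  then have "act ws u = u" if "set ws \<subseteq> {s, r}" for ws
    using that by (induction ws) auto
  then have u: "act ?W u = u" using set_alternating by metis
  have "v = (\<lambda>x. 1 * u x + 1 * z x)" by (simp add: u_def)
  moreover have "act ?W (\<lambda>x. 1 * u x + 1 * z x) = (\<lambda>x. 1 * u x + 1 * z x)"
    using act_linear[of ?W 1 u 1 z] unfolding u z .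
  ultimately have "act ?W v = v" by simp
  then show ?thesis by (simp add: alternating_double m_def)
qed

lemma tits_word_prod: "set ws \<subseteq> S \<Longrightarrow> tits (word_prod G ws) = act ws"
proof -
  assume ws: "set ws \<subseteq> S"
  let ?vs = "SOME vs. set vs \<subseteq> S \<and> word_prod G vs = word_prod G ws"
  have vs: "set ?vs \<subseteq> S \<and> word_prod G ?vs = word_prod G ws"
    by (rule someI[of _ ws]) (use ws in simp)
  have "act ?vs = act ws"
    by (rule presentation_invariant)
      (use vs ws in \<open>auto simp: act1_act1 act_relator fun_eq_iff[where 'b = "'a \<Rightarrow> real"]\<close>)
  then show ?thesis by (simp add: tits_def)
qed

lemma tits_mult:
  assumes "x \<in> carrier G" "y \<in> carrier G"
  shows "tits (x \<otimes> y) v = tits x (tits y v)"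
proof -
  obtain us vs where w: "set us \<subseteq> S" "word_prod G us = x" "set vs \<subseteq> S" "word_prod G vs = y"
    using assms by (metis reduced_word)
  then have "tits (x \<otimes> y) = act (us @ vs)"
    using tits_word_prod[of "us @ vs"] by (auto simp: word_prod_gens_append)
  with w tits_word_prod[of us] tits_word_prod[of vs] show ?thesis by auto
qed

lemma tits_one [simp]: "tits \<one> v = v"
  using tits_word_prod[of "[]"] by simp

lemma tits_gen: "s \<in> S \<Longrightarrow> tits s = act1 s"
  using tits_word_prod[of "[s]"] by (auto simp: fun_eq_iff)

lemma tits_linear:
  assumes "w \<in> carrier G"
  shows "tits w (\<lambda>x. a * u x + b * v x) = (\<lambda>x. a * tits w u x + b * tits w v x)"
proof -
  obtain ws where "set ws \<subseteq> S" "word_prod G ws = w"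
    using assms by (metis reduced_word)
  then show ?thesis using tits_word_prod act_linear by metis
qed

lemma tits_scale: "w \<in> carrier G \<Longrightarrow> tits w (\<lambda>x. a * u x) = (\<lambda>x. a * tits w u x)"
  using tits_linear[of w a u 0 u] by simp

lemma tits_uminus: "w \<in> carrier G \<Longrightarrow> tits w (\<lambda>x. - u x) = (\<lambda>x. - tits w u x)"
  using tits_scale[of w "- 1" u] by simp

lemma tits_sum:
  assumes "w \<in> carrier G" "finite I"
  shows "tits w (\<lambda>x. \<Sum>i\<in>I. u i x) = (\<lambda>x. \<Sum>i\<in>I. tits w (u i) x)"
  using assms(2)
proof (induction I)
  case empty
  then show ?case using tits_scale[OF assms(1), of 0] by simp
next
  case (insert i I)
  then show ?case using tits_linear[OF assms(1), of 1 "u i" 1] by simp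
qed

lemma tits_inv_cancel [simp]:
  "w \<in> carrier G \<Longrightarrow> tits (inv w) (tits w v) = v"
  "w \<in> carrier G \<Longrightarrow> tits w (tits (inv w) v) = v"
  by (simp_all flip: tits_mult)

lemma tits_gen_simple: "s \<in> S \<Longrightarrow> tits s (simple s) = (\<lambda>x. - simple s x)"
  by (auto simp: tits_gen act1_eq form_simple kern_self)

section \<open>Alternating suffixes and positivity of roots\<close>

lemma word_prod_alternating_ord:
  assumes "s \<in> S" "r \<in> S"
  shows "word_prod G (alternating s r (ord (s \<otimes> r))) = word_prod G (alternating r s (ord (s \<otimes> r)))"
proof -
  let ?m = "ord (s \<otimes> r)"
  have sub: "set (alternating a b k) \<subseteq> S" if "a \<in> {s, r}" "b \<in> {s, r}" for a b k
    using set_alternating[of a b k] that assms by auto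
  have "word_prod G (concat (replicate k [s, r])) = (s \<otimes> r) [^] k" for k
  proof (induction k)
    case (Suc k)
    have "(s \<otimes> r) [^] Suc k = (s \<otimes> r) \<otimes> (s \<otimes> r) [^] k"
      using assms by (intro nat_pow_Suc2) simp
    then show ?case using Suc assms by (simp add: m_assoc)
  qed simp
  then have "word_prod G (alternating s r (?m + ?m)) = \<one>"
    using assms alternating_double[of s r ?m] by (simp flip: mult_2)
  then have one: "word_prod G (if even ?m then alternating s r ?m else alternating r s ?m) \<otimes>
      word_prod G (alternating s r ?m) = \<one>"
    using sub by (simp add: alternating_add word_prod_gens_append split: if_splits)
  have "word_prod G (if even ?m then alternating s r ?m else alternating r s ?m)
      = inv (word_prod G (alternating s r ?m))"
    using one sub by (intro inv_equality[symmetric]) (auto split: if_splits)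
  also have "\<dots> = word_prod G (if even ?m then alternating r s ?m else alternating s r ?m)"
    using sub by (subst word_prod_rev[symmetric]) (auto simp: rev_alternating)
  finally show ?thesis by (auto split: if_splits)
qed

text \<open>Since \<open>s\<close> is an ascent of \<open>w\<close>, only \<open>r\<close> can be
  stripped; afterwards \<open>r\<close> is an ascent and the two letters change roles, so the
  stripped suffix alternates. The remainder \<open>v\<close> is the shortest element in the coset of
  the dihedral subgroup of \<open>s\<close> and \<open>r\<close>.\<close>

lemma split_alternating:
  assumes "s \<in> S" "r \<in> S" "w \<in> carrier G" "len (w \<otimes> s) > len w"
  shows "\<exists>v k. v \<in> carrier G \<and> w = v \<otimes> word_prod G (alternating s r k) \<and> len w = len v + k \<and>
    len (v \<otimes> s) > len v \<and> len (v \<otimes> r) > len v \<and> (len (w \<otimes> r) < len w \<longrightarrow> k > 0)"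
  using assms
proof (induction "len w" arbitrary: w s r rule: less_induct)
  case less
  show ?case
  proof (cases "len (w \<otimes> r) > len w")
    case True
    then show ?thesis using less.prems by (intro exI[of _ w] exI[of _ 0]) auto
  next
    case False
    with len_mult_gen_neq[of r w] less.prems have lt: "len (w \<otimes> r) < len w" by simp
    have wr: "w \<otimes> r \<otimes> r = w" using less.prems by (simp add: m_assoc gen_square)
    with lt have "len (w \<otimes> r \<otimes> r) > len (w \<otimes> r)" by simp
    from less.hyps[OF lt less.prems(2,1) _ this] less.prems obtain v k where v:
      "v \<in> carrier G" "w \<otimes> r = v \<otimes> word_prod G (alternating r s k)" "len (w \<otimes> r) = len v + k"
      "len (v \<otimes> r) > len v" "len (v \<otimes> s) > len v" by auto
    have "set (alternating r s k) \<subseteq> S" using set_alternating[of r s k] less.prems by auto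
    then have "w = v \<otimes> word_prod G (alternating s r (Suc k))"
      using v(1,2) wr less.prems by (simp add: word_prod_gens_append m_assoc[symmetric])
    moreover have "len w = len v + Suc k"
      using lt len_gen_mult_le(4)[of r w] v(3) less.prems by simp
    ultimately show ?thesis using v by blast
  qed
qed

text \<open>Strip from \<open>w\<close> the longest alternating suffix in \<open>s\<close> and a descent \<open>r\<close>; what remains
  lengthens under both letters, and the suffix moves the root of \<open>s\<close> inside the cone
  spanned by the roots of \<open>s\<close> and \<open>r\<close>.\<close>

theorem tits_simple_nonneg:
  assumes "w \<in> carrier G" "s \<in> S" "len (w \<otimes> s) > len w"
  shows "tits w (simple s) x \<ge> 0"
  using assms
proof (induction "len w" arbitrary: w s x rule: less_induct)
  case less
  show ?case
  proof (cases "w = \<one>")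
    case True
    then show ?thesis by (simp add: simple_def)
  next
    case False
    then obtain r where r: "r \<in> S" "len (w \<otimes> r) < len w"
      using obtain_right_descent less.prems by metis
    with less.prems have "s \<noteq> r" by auto
    from split_alternating[OF less.prems(2) r(1) less.prems(1,3)] r obtain v k where v:
      "v \<in> carrier G" "w = v \<otimes> word_prod G (alternating s r k)" "len w = len v + k"
      "len (v \<otimes> s) > len v" "len (v \<otimes> r) > len v" "k > 0" by auto
    have sub: "set (alternating a b j) \<subseteq> S" if "a \<in> {s, r}" "b \<in> {s, r}" for a b j
      using set_alternating[of a b j] that less.prems r by auto
    define m where "m = ord (s \<otimes> r)"
    have m: "m \<ge> 2" unfolding m_def by (rule ord_ge_2) (use less.prems r \<open>s \<noteq> r\<close> in auto)
    \<comment> \<open>A suffix of length at least \<open>m\<close> could be rewritten by the braid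
      relation to end in \<open>s\<close>, and \<open>s\<close> would then be a descent of
      \<open>w\<close>.\<close>
    have "k < m"
    proof (rule ccontr)
      assume "\<not> k < m"
      then obtain j where j: "k = j + m" by (metis le_add_diff_inverse2 not_less)
      obtain m' where m': "m = Suc m'" using m by (cases m) auto
      define p where "p = (if even m then alternating s r j else alternating r s j)"
      have p: "set p \<subseteq> S" "length p = j" using sub by (auto simp: p_def)
      have "word_prod G (alternating s r k) = word_prod G p \<otimes> word_prod G (alternating s r m)"
        unfolding j p_def alternating_add using sub by (subst word_prod_gens_append) auto
      also have "word_prod G (alternating s r m) = word_prod G (alternating r s m)"
        unfolding m_def using less.prems r by (intro word_prod_alternating_ord)
      also have "\<dots> = word_prod G (alternating s r m') \<otimes> s"
        using sub[of s r m'] less.prems by (simp add: m' word_prod_gens_append)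
      finally have "w \<otimes> s = v \<otimes> word_prod G (p @ alternating s r m')"
        using v(1,2) p less.prems sub[of s r m']
        by (simp add: word_prod_gens_append m_assoc gen_square)
      then have "len (w \<otimes> s) \<le> len v + (j + m')"
        using len_mult_le[of v "word_prod G (p @ alternating s r m')"] v(1) p sub[of s r m']
          len_word_prod[of "p @ alternating s r m'"] by simp
      with less.prems(3) v(3) j m' show False by simp
    qed
    define \<theta> where "\<theta> = pi / real m"
    have "\<theta> > 0" "\<theta> < pi" using m by (auto simp: \<theta>_def field_simps)
    then have sin: "sin \<theta> > 0" by (rule sin_gt_zero)
    have sin_nonneg: "sin (real i * \<theta>) \<ge> 0" if "i \<le> m" for i
    proof -
      have "real i * \<theta> \<le> real m * \<theta>" using that \<open>\<theta> > 0\<close> by simp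
      then have "real i * \<theta> \<le> pi" using m by (simp add: \<theta>_def)
      then show ?thesis using \<open>\<theta> > 0\<close> by (intro sin_ge_zero) auto
    qed
    \<comment> \<open>As \<open>k < m\<close>, both angles lie between 0 and \<pi>, so both
      coordinates are nonnegative.\<close>
    define a b where "a = sin (real (Suc k) * \<theta>)" and "b = sin (real k * \<theta>)"
    have ab: "a \<ge> 0" "b \<ge> 0" unfolding a_def b_def using \<open>k < m\<close> by (intro sin_nonneg; simp)+
    define y z where "y = (if even k then s else r)" and "z = (if even k then r else s)"
    have yz: "y \<in> S" "z \<in> S" "len (v \<otimes> y) > len v" "len (v \<otimes> z) > len v"
      using v less.prems r by (auto simp: y_def z_def)
    have "act (alternating s r k) (\<lambda>x. sin \<theta> * simple s x + 0 * simple r x) =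
        (\<lambda>x. a * simple y x + b * simple z x)"
      using act_alternating[of s r \<theta> k 0] less.prems r
      by (simp add: a_def b_def y_def z_def \<theta>_def m_def)
    then have E: "(\<lambda>x. sin \<theta> * act (alternating s r k) (simple s) x) = (\<lambda>x. a * simple y x + b * simple z x)"
      by (subst (asm) act_linear) simp
    have "tits w (simple s) = tits v (act (alternating s r k) (simple s))"
      using v(1,2) sub[of s r k] by (simp add: tits_mult tits_word_prod)
    then have "(\<lambda>x. sin \<theta> * tits w (simple s) x) = tits v (\<lambda>x. a * simple y x + b * simple z x)"
      using tits_scale[OF v(1), of "sin \<theta>" "act (alternating s r k) (simple s)"] E by simp
    also have "\<dots> = (\<lambda>x. a * tits v (simple y) x + b * tits v (simple z) x)"
      using v(1) by (rule tits_linear)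
    finally have "sin \<theta> * tits w (simple s) x = a * tits v (simple y) x + b * tits v (simple z) x"
      by (rule fun_cong)
    moreover have "tits v (simple y) x \<ge> 0" "tits v (simple z) x \<ge> 0"
      using less.hyps[of v] v yz by auto
    ultimately have "sin \<theta> * tits w (simple s) x \<ge> 0" using ab by simp
    then show ?thesis using sin by (simp add: zero_le_mult_iff)
  qed
qed

end

section \<open>Reflections and inversions\<close>

context finite_coxeter
begin

definition refls :: "'a set" where
  "refls = {x \<otimes> s \<otimes> inv x | x s. x \<in> carrier G \<and> s \<in> S}"

definition inversions :: "'a \<Rightarrow> 'a set" where
  "inversions w = {t \<in> refls. len (t \<otimes> w) < len w}"

lemma reflsI: "x \<in> carrier G \<Longrightarrow> s \<in> S \<Longrightarrow> x \<otimes> s \<otimes> inv x \<in> refls"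
  unfolding refls_def by blast

lemma refls_closed [simp]: "t \<in> refls \<Longrightarrow> t \<in> carrier G"
  unfolding refls_def by clarsimp

lemma reflsE:
  assumes "t \<in> refls"
  obtains x s where "x \<in> carrier G" "s \<in> S" "t = x \<otimes> s \<otimes> inv x"
  using assms unfolding refls_def by blast

lemma refls_square [simp]: "t \<in> refls \<Longrightarrow> t \<otimes> t = \<one>"
  by (elim reflsE) (simp add: m_assoc)

lemma refls_cancel [simp]: "t \<in> refls \<Longrightarrow> w \<in> carrier G \<Longrightarrow> t \<otimes> (t \<otimes> w) = w"
  by (simp flip: m_assoc)

lemma refls_inv [simp]: "t \<in> refls \<Longrightarrow> inv t = t"
  by (simp add: inv_equality)

lemma gen_refl: "s \<in> S \<Longrightarrow> s \<in> refls"
  using reflsI[of \<one> s] by simp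

lemma refls_conj:
  assumes "t \<in> refls" "y \<in> carrier G"
  shows "y \<otimes> t \<otimes> inv y \<in> refls" "inv y \<otimes> t \<otimes> y \<in> refls"
proof -
  have conj: "y \<otimes> t \<otimes> inv y \<in> refls" if y: "y \<in> carrier G" for y
  proof -
    obtain x s where "x \<in> carrier G" "s \<in> S" "t = x \<otimes> s \<otimes> inv x"
      using assms(1) by (rule reflsE)
    with y show ?thesis
      using reflsI[of "y \<otimes> x" s] by (simp add: inv_mult_group m_assoc)
  qed
  from conj[of y] conj[of "inv y"] assms(2)
  show "y \<otimes> t \<otimes> inv y \<in> refls" "inv y \<otimes> t \<otimes> y \<in> refls" by simp_all
qed

lemma odd_len_refl: "t \<in> refls \<Longrightarrow> odd (len t)"
  by (elim reflsE) (simp add: even_len_mult odd_len_gen)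

lemma tits_mult_gen_simple:
  assumes "x \<in> carrier G" "s \<in> S"
  shows "tits (x \<otimes> s) (simple s) = (\<lambda>y. - tits x (simple s) y)"
  using assms by (simp add: tits_mult tits_gen_simple tits_uminus)

lemma tits_simple_nonpos:
  assumes "w \<in> carrier G" "s \<in> S" "len (w \<otimes> s) < len w"
  shows "tits w (simple s) x \<le> 0"
proof -
  have "w \<otimes> s \<otimes> s = w" using assms by (simp add: m_assoc gen_square)
  with assms have "tits (w \<otimes> s) (simple s) x \<ge> 0" by (intro tits_simple_nonneg) auto
  with assms show ?thesis by (simp add: tits_mult_gen_simple)
qed

lemma root_sign:
  assumes "x \<in> carrier G" "s \<in> S"
  shows "(\<forall>y. tits x (simple s) y \<ge> 0) \<or> (\<forall>y. tits x (simple s) y \<le> 0)"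
  using len_mult_gen_neq[OF assms(2,1)]
proof (rule linorder_neqE_nat)
  assume "len (x \<otimes> s) < len x"
  then show ?thesis using tits_simple_nonpos[OF assms] by blast
next
  assume "len x < len (x \<otimes> s)"
  then show ?thesis using tits_simple_nonneg[OF assms] by blast
qed

lemma root_nonzero:
  assumes "x \<in> carrier G" "s \<in> S"
  obtains y where "tits x (simple s) y \<noteq> 0"
proof -
  have False if 0: "\<And>y. tits x (simple s) y = 0"
  proof -
    have "tits x (simple s) = (\<lambda>y. 0 * simple s y)" using 0 by auto
    then have "tits (inv x) (tits x (simple s)) = (\<lambda>y. 0 * tits (inv x) (simple s) y)"
      using assms by (simp only: tits_scale inv_closed)
    then have "simple s s = 0" using assms by simp
    then show False by (simp add: simple_def)
  qed
  with that show ?thesis by blast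
qed

lemma tits_refl:
  assumes "x \<in> carrier G" "s \<in> S"
  shows "\<exists>d. tits (x \<otimes> s \<otimes> inv x) v = (\<lambda>y. v y + d * tits x (simple s) y)"
proof -
  let ?u = "tits (inv x) v"
  have "tits (x \<otimes> s \<otimes> inv x) v = tits x (act1 s ?u)"
    using assms by (simp add: tits_mult tits_gen)
  also have "\<dots> = (\<lambda>y. 1 * tits x ?u y + (- 2 * form ?u s) * tits x (simple s) y)"
    unfolding act1_eq by (rule tits_linear[OF assms(1)])
  also have "tits x ?u = v" using assms by simp
  finally show ?thesis by (intro exI[of _ "- 2 * form ?u s"]) simp
qed

text \<open>A right descent \<open>q\<close> of \<open>z\<close> would send the simple root of
  \<open>q\<close> to a nonpositive vector; the single coordinate at \<open>q\<close> is enough to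
  exclude this.\<close>

lemma eq_one_if_no_descent:
  assumes "z \<in> carrier G" "\<And>q. q \<in> S \<Longrightarrow> tits z (simple q) q > 0"
  shows "z = \<one>"
proof (rule ccontr)
  assume "z \<noteq> \<one>"
  with assms obtain q where "q \<in> S" "len (z \<otimes> q) < len z"
    using obtain_right_descent by metis
  with assms show False using tits_simple_nonpos[of z q q] by force
qed

text \<open>The product of the reflection with \<open>r\<close> fixes the simple root of
  \<open>r\<close> and alters every other simple root only by a multiple of it, so it has no descent
  and is the identity.\<close>

lemma refl_eq_gen:
  assumes "x \<in> carrier G" "s \<in> S" "r \<in> S" and root: "tits x (simple s) = (\<lambda>y. b * simple r y)"
  shows "x \<otimes> s \<otimes> inv x = r"
proof -
  let ?t = "x \<otimes> s \<otimes> inv x"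
  have t: "?t \<in> carrier G" "?t \<in> refls" using assms by (auto intro: reflsI)
  have b: "b \<noteq> 0"
  proof
    assume "b = 0"
    then have "tits x (simple s) y = 0" for y by (simp add: root)
    then show False using root_nonzero[OF assms(1,2)] by blast
  qed
  have "tits ?t (tits x (simple s)) = (\<lambda>y. - tits x (simple s) y)"
    using assms(1,2) by (simp add: tits_mult m_assoc tits_gen_simple tits_uminus)
  then have "(\<lambda>y. b * tits ?t (simple r) y) = (\<lambda>y. - (b * simple r y))"
    unfolding root tits_scale[OF t(1)] by simp
  then have tr: "tits ?t (simple r) = (\<lambda>y. - simple r y)"
    using b by (intro ext) (metis mult_cancel_left mult_minus_right)
  have "?t \<otimes> r = \<one>"
  proof (rule eq_one_if_no_descent)
    show "?t \<otimes> r \<in> carrier G" using t(1) assms(3) by simp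
    fix q assume q: "q \<in> S"
    have z: "tits (?t \<otimes> r) v = tits ?t (act1 r v)" for v
      using assms(3) t(1) by (simp only: tits_mult tits_gen gen_closed)
    show "tits (?t \<otimes> r) (simple q) q > 0"
    proof (cases "q = r")
      case True
      have "act1 r (simple r) = (\<lambda>y. - simple r y)"
        using tits_gen_simple[OF assms(3)] tits_gen[OF assms(3)] by simp
      then have "tits (?t \<otimes> r) (simple r) = simple r"
        unfolding z by (simp only: tits_uminus[OF t(1)] tr minus_minus)
      with True show ?thesis by (simp add: simple_def)
    next
      case False
      obtain d where "tits ?t (act1 r (simple q)) = (\<lambda>y. act1 r (simple q) y + d * tits x (simple s) y)"
        using tits_refl[OF assms(1,2)] by blast
      then have "tits (?t \<otimes> r) (simple q) q = act1 r (simple q) q + d * (b * simple r q)"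
        unfolding z root by simp
      with False show ?thesis by (simp add: act1_def simple_def)
    qed
  qed
  then show ?thesis
    using assms(3) t(1) by (metis gen_closed gen_inv inv_equality inv_inv)
qed

section \<open>The exchange condition, read off from roots\<close>

lemma obtain_nonneg_root:
  assumes "x \<in> carrier G" "s \<in> S"
  obtains x' where "x' \<in> {x, x \<otimes> s}" "x' \<otimes> s \<otimes> inv x' = x \<otimes> s \<otimes> inv x"
    "\<And>y. tits x' (simple s) y \<ge> 0"
proof (cases "\<forall>y. tits x (simple s) y \<ge> 0")
  case True
  then show ?thesis using that by blast
next
  case False
  then have "\<forall>y. tits x (simple s) y \<le> 0"
    using root_sign[OF assms] by blast
  then have "\<forall>y. tits (x \<otimes> s) (simple s) y \<ge> 0"
    using assms by (simp add: tits_mult_gen_simple)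
  moreover have "x \<otimes> s \<otimes> s \<otimes> inv (x \<otimes> s) = x \<otimes> s \<otimes> inv x"
    using assms by (simp add: m_assoc inv_mult_group gen_square)
  ultimately show ?thesis using that by blast
qed

text \<open>As the letters of \<open>ws\<close> are applied one at a time, the root passes from
  nonnegative to nonpositive at some letter \<open>r\<close>. That step changes only the coordinate
  at \<open>r\<close>, so the root just before it is a multiple of the simple root of
  \<open>r\<close>, and \<open>refl_eq_gen\<close> identifies the reflection. The word
  \<open>ws\<close> may be non-reduced.\<close>

lemma root_exchange:
  assumes "x \<in> carrier G" "s \<in> S" "set ws \<subseteq> S"
    and "\<And>y. tits x (simple s) y \<ge> 0"
    and "\<And>y. tits (inv (word_prod G ws)) (tits x (simple s)) y \<le> 0"
  shows "\<exists>u r v. ws = u @ r # v \<and> x \<otimes> s \<otimes> inv x = word_prod G u \<otimes> r \<otimes> inv (word_prod G u)"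
  using assms
proof (induction ws arbitrary: x)
  case Nil
  then have "tits x (simple s) y = 0" for y
    by (intro antisym) auto
  then show ?case using root_nonzero[of x s] Nil by metis
next
  case (Cons r vs)
  let ?\<beta> = "tits x (simple s)"
  have rx: "tits (r \<otimes> x) (simple s) = act1 r ?\<beta>"
    using Cons.prems by (simp add: tits_mult tits_gen)
  have "tits (inv (word_prod G (r # vs))) ?\<beta> = tits (inv (word_prod G vs)) (tits (r \<otimes> x) (simple s))"
    using Cons.prems by (simp add: inv_mult_group tits_mult)
  with Cons.prems(5) have le: "tits (inv (word_prod G vs)) (tits (r \<otimes> x) (simple s)) y \<le> 0" for y
    by metis
  from root_sign[of "r \<otimes> x" s] Cons.prems
  consider "\<forall>y. tits (r \<otimes> x) (simple s) y \<ge> 0" | "\<forall>y. tits (r \<otimes> x) (simple s) y \<le> 0" by auto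
  then show ?case
  proof cases
    case 1
    then obtain u q v where *: "vs = u @ q # v"
      "r \<otimes> x \<otimes> s \<otimes> inv (r \<otimes> x) = word_prod G u \<otimes> q \<otimes> inv (word_prod G u)"
      using Cons.IH[of "r \<otimes> x"] Cons.prems le by auto
    have "x \<otimes> s \<otimes> inv x = r \<otimes> (r \<otimes> x \<otimes> s \<otimes> inv (r \<otimes> x)) \<otimes> r"
      using Cons.prems by (simp add: m_assoc inv_mult_group gen_square)
    also have "\<dots> = word_prod G (r # u) \<otimes> q \<otimes> inv (word_prod G (r # u))"
      unfolding *(2) using Cons.prems * by (simp add: m_assoc inv_mult_group)
    finally show ?thesis using *(1) by (intro exI[of _ "r # u"] exI) auto
  next
    case 2
    have "?\<beta> y = 0" if "y \<noteq> r" for y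
      using 2[rule_format, of y] Cons.prems(4)[of y] that unfolding rx by (simp add: act1_def)
    then have "?\<beta> = (\<lambda>y. ?\<beta> r * simple r y)" by (auto simp: simple_def)
    then have "x \<otimes> s \<otimes> inv x = r"
      using Cons.prems by (intro refl_eq_gen) auto
    then show ?thesis using Cons.prems by (intro exI[of _ "[]"] exI) auto
  qed
qed

lemma refl_mult_word_prod:
  assumes "set u \<subseteq> S" "r \<in> S" "set v \<subseteq> S"
  shows "word_prod G u \<otimes> r \<otimes> inv (word_prod G u) \<otimes> word_prod G (u @ r # v) = word_prod G (u @ v)"
  using assms by (simp add: word_prod_gens_append m_assoc gen_square)

lemma len_refl_mult_less:
  assumes "x \<in> carrier G" "s \<in> S" "w \<in> carrier G"
    and "\<And>y. tits x (simple s) y \<ge> 0"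
    and "\<And>y. tits (inv w) (tits x (simple s)) y \<le> 0"
  shows "len (x \<otimes> s \<otimes> inv x \<otimes> w) < len w"
proof -
  obtain ws where ws: "set ws \<subseteq> S" "word_prod G ws = w" "length ws = len w"
    using reduced_word assms(3) by blast
  with root_exchange[of x s ws] assms obtain u r v where
    uv: "ws = u @ r # v" "x \<otimes> s \<otimes> inv x = word_prod G u \<otimes> r \<otimes> inv (word_prod G u)" by auto
  then have "x \<otimes> s \<otimes> inv x \<otimes> w = word_prod G (u @ v)"
    using refl_mult_word_prod[of u r v] ws by auto
  also have "len \<dots> \<le> length (u @ v)"
    using uv(1) ws(1) by (intro len_word_prod) auto
  finally show ?thesis using ws uv(1) by simp
qed

text \<open>The reflection negates its own root, so passing from \<open>w\<close> to its product
  with the reflection reverses the sign condition and \<open>len_refl_mult_less\<close> applies to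
  that product.\<close>

lemma len_refl_mult_greater:
  assumes "x \<in> carrier G" "s \<in> S" "w \<in> carrier G"
    and "\<And>y. tits x (simple s) y \<ge> 0"
    and "\<And>y. tits (inv w) (tits x (simple s)) y \<ge> 0"
  shows "len (x \<otimes> s \<otimes> inv x \<otimes> w) > len w"
proof -
  let ?t = "x \<otimes> s \<otimes> inv x"
  have t: "?t \<in> refls" using assms by (intro reflsI)
  have "tits (inv (?t \<otimes> w)) (tits x (simple s)) = (\<lambda>y. - tits (inv w) (tits x (simple s)) y)"
  proof -
    have "tits (inv (?t \<otimes> w)) (tits x (simple s)) = tits (inv w) (tits ?t (tits x (simple s)))"
      using assms(1-3) t by (simp add: inv_mult_group tits_mult)
    also have "tits ?t (tits x (simple s)) = (\<lambda>y. - tits x (simple s) y)"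
      using assms(1,2) by (simp add: tits_mult m_assoc tits_gen_simple tits_uminus)
    finally show ?thesis using assms(1-3) by (simp add: tits_uminus)
  qed
  then have nonpos: "tits (inv (?t \<otimes> w)) (tits x (simple s)) y \<le> 0" for y
    using assms(5)[of y] by (metis neg_le_0_iff_le)
  have "?t \<otimes> w \<in> carrier G" using assms(3) t by simp
  from len_refl_mult_less[OF assms(1,2) this assms(4) nonpos]
  show ?thesis unfolding refls_cancel[OF t assms(3)] .
qed

lemma inversions_iff_root:
  assumes "x \<in> carrier G" "s \<in> S" "w \<in> carrier G" "\<And>y. tits x (simple s) y \<ge> 0"
  shows "x \<otimes> s \<otimes> inv x \<in> inversions w \<longleftrightarrow> (\<forall>y. tits (inv w) (tits x (simple s)) y \<le> 0)"
proof -
  have t: "x \<otimes> s \<otimes> inv x \<in> refls" using assms(1,2) by (rule reflsI)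
  have "tits (inv w) (tits x (simple s)) = tits (inv w \<otimes> x) (simple s)"
    using assms(1-3) by (simp add: tits_mult)
  moreover have "inv w \<otimes> x \<in> carrier G" using assms(1,3) by simp
  ultimately have sign: "(\<forall>y. tits (inv w) (tits x (simple s)) y \<ge> 0) \<or>
      (\<forall>y. tits (inv w) (tits x (simple s)) y \<le> 0)"
    using root_sign[of "inv w \<otimes> x" s] assms(2) by simp
  consider "\<forall>y. tits (inv w) (tits x (simple s)) y \<le> 0"
    | "\<forall>y. tits (inv w) (tits x (simple s)) y \<ge> 0" "\<not> (\<forall>y. tits (inv w) (tits x (simple s)) y \<le> 0)"
    using sign by blast
  then show ?thesis
  proof cases
    case 1
    then have "len (x \<otimes> s \<otimes> inv x \<otimes> w) < len w"
      using assms(4) by (intro len_refl_mult_less[OF assms(1-3)]) blast+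
    with 1 t show ?thesis unfolding inversions_def by blast
  next
    case 2
    then have "len (x \<otimes> s \<otimes> inv x \<otimes> w) > len w"
      using assms(4) by (intro len_refl_mult_greater[OF assms(1-3)]) blast+
    then have "\<not> len (x \<otimes> s \<otimes> inv x \<otimes> w) < len w" by simp
    with 2(2) show ?thesis unfolding inversions_def by blast
  qed
qed

lemma refl_nonneg_root:
  assumes "t \<in> refls"
  obtains x s where "x \<in> carrier G" "s \<in> S" "t = x \<otimes> s \<otimes> inv x" "\<And>y. tits x (simple s) y \<ge> 0"
proof -
  obtain x s where xs: "x \<in> carrier G" "s \<in> S" "t = x \<otimes> s \<otimes> inv x"
    using assms by (rule reflsE)
  from obtain_nonneg_root[OF xs(1,2)] obtain x' where
    "x' \<in> {x, x \<otimes> s}" "x' \<otimes> s \<otimes> inv x' = t" "\<And>y. tits x' (simple s) y \<ge> 0" using xs(3) by metis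
  then have "x' \<in> carrier G" "t = x' \<otimes> s \<otimes> inv x'" "\<And>y. tits x' (simple s) y \<ge> 0"
    using xs(1,2) by (blast intro: m_closed gen_closed)+
  with xs(2) show ?thesis using that by blast
qed

lemma len_refl_mult_neq:
  assumes "t \<in> refls" "w \<in> carrier G"
  shows "len (t \<otimes> w) \<noteq> len w"
  using even_len_mult[of t w] odd_len_refl[of t] assms by auto

text \<open>A positive root becomes negative under \<open>inv (u \<otimes> v)\<close> exactly when
  one and only one of the stages \<open>inv u\<close> and \<open>inv v\<close> changes its sign. In
  terms of reflections this is the cocycle rule for inversion sets.\<close>

lemma inversions_mult:
  assumes "u \<in> carrier G" "v \<in> carrier G" "t \<in> refls"
  shows "t \<in> inversions (u \<otimes> v) \<longleftrightarrow> (t \<in> inversions u) \<noteq> (inv u \<otimes> t \<otimes> u \<in> inversions v)"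
proof -
  obtain x s where xs: "x \<in> carrier G" "s \<in> S" "t = x \<otimes> s \<otimes> inv x" "\<And>y. tits x (simple s) y \<ge> 0"
    using refl_nonneg_root[OF assms(3)] by metis
  let ?g = "tits (inv u \<otimes> x) (simple s)"
  have g: "tits (inv u) (tits x (simple s)) = ?g" using assms(1) xs(1,2) by (simp add: tits_mult)
  have uv: "tits (inv (u \<otimes> v)) (tits x (simple s)) = tits (inv v) ?g"
    using assms(1,2) xs(1,2) by (simp add: tits_mult inv_mult_group)
  have t: "t \<in> inversions u \<longleftrightarrow> (\<forall>y. ?g y \<le> 0)"
    "t \<in> inversions (u \<otimes> v) \<longleftrightarrow> (\<forall>y. tits (inv v) ?g y \<le> 0)"
    using inversions_iff_root[OF xs(1,2) assms(1) xs(4)]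
      inversions_iff_root[OF xs(1,2) m_closed[OF assms(1,2)] xs(4)]
    unfolding xs(3) g uv by blast+
  show ?thesis
  proof (cases "\<forall>y. ?g y \<le> 0")
    case False
    then have pos: "\<And>y. ?g y \<ge> 0" using root_sign[of "inv u \<otimes> x" s] xs assms by auto
    have "inv u \<otimes> x \<in> carrier G" using assms(1) xs(1) by simp
    note iff = inversions_iff_root[OF this xs(2) assms(2) pos]
    have "inv u \<otimes> t \<otimes> u = inv u \<otimes> x \<otimes> s \<otimes> inv (inv u \<otimes> x)"
      using xs(1-3) assms by (simp add: m_assoc inv_mult_group)
    then have "inv u \<otimes> t \<otimes> u \<in> inversions v \<longleftrightarrow> (\<forall>y. tits (inv v) ?g y \<le> 0)"
      using iff by simp
    with t False show ?thesis by simp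
  next
    case True
    \<comment> \<open>The image of the root under \<open>inv u\<close> is negative here, so the
      positive root of \<open>inv u \<otimes> t \<otimes> u\<close> is its opposite; appending
      \<open>s\<close> produces it.\<close>
    let ?x = "inv u \<otimes> x \<otimes> s"
    have x: "?x \<in> carrier G" and ux: "inv u \<otimes> x \<in> carrier G"
      using xs(1,2) assms(1) by simp_all
    have x_root: "tits ?x (simple s) = (\<lambda>y. - ?g y)"
      using ux xs(2) by (rule tits_mult_gen_simple)
    have "tits ?x (simple s) y \<ge> 0" for y
      unfolding x_root using True by simp
    note iff = inversions_iff_root[OF x xs(2) assms(2) this]
    have "inv u \<otimes> t \<otimes> u = ?x \<otimes> s \<otimes> inv ?x"
      using xs(1-3) assms by (simp add: m_assoc inv_mult_group gen_square)
    moreover have "tits (inv v) (tits ?x (simple s)) = (\<lambda>y. - tits (inv v) ?g y)"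
      unfolding x_root using assms(2) by (intro tits_uminus) simp
    ultimately have "inv u \<otimes> t \<otimes> u \<in> inversions v \<longleftrightarrow> (\<forall>y. - tits (inv v) ?g y \<le> 0)"
      using iff by simp
    moreover have "(\<forall>y. - tits (inv v) ?g y \<le> 0) \<longleftrightarrow> \<not> (\<forall>y. tits (inv v) ?g y \<le> 0)"
    proof -
      have eq: "tits (inv v) ?g = tits (inv v \<otimes> (inv u \<otimes> x)) (simple s)"
        using xs(1,2) assms(1,2) by (simp add: tits_mult)
      have vux: "inv v \<otimes> (inv u \<otimes> x) \<in> carrier G" using ux assms(2) by simp
      obtain y where "tits (inv v) ?g y \<noteq> 0"
        using root_nonzero[OF vux xs(2)] unfolding eq by blast
      moreover have "(\<forall>y. tits (inv v) ?g y \<ge> 0) \<or> (\<forall>y. tits (inv v) ?g y \<le> 0)"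
        using root_sign[OF vux xs(2)] unfolding eq .
      ultimately show ?thesis
        by (metis antisym neg_le_0_iff_le)
    qed
    ultimately show ?thesis using t True by simp
  qed
qed

lemma inversions_exchange:
  assumes "set ws \<subseteq> S" "t \<in> inversions (word_prod G ws)"
  obtains u r v where "ws = u @ r # v" "t = word_prod G u \<otimes> r \<otimes> inv (word_prod G u)"
    "t \<otimes> word_prod G ws = word_prod G (u @ v)"
proof -
  have t: "t \<in> refls" using assms(2) by (auto simp: inversions_def)
  then obtain x s where xs: "x \<in> carrier G" "s \<in> S" "t = x \<otimes> s \<otimes> inv x" "\<And>y. tits x (simple s) y \<ge> 0"
    using refl_nonneg_root by metis
  have "word_prod G ws \<in> carrier G" using assms(1) by simp
  from inversions_iff_root[OF xs(1,2) this xs(4)] assms(2)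
  have "tits (inv (word_prod G ws)) (tits x (simple s)) y \<le> 0" for y
    unfolding xs(3) by blast
  from root_exchange[OF xs(1,2) assms(1) xs(4) this] obtain u r v where
    uv: "ws = u @ r # v" "t = word_prod G u \<otimes> r \<otimes> inv (word_prod G u)" unfolding xs(3) by blast
  moreover have "t \<otimes> word_prod G ws = word_prod G (u @ v)"
    using refl_mult_word_prod[of u r v] uv assms(1) by simp
  ultimately show ?thesis using that by blast
qed

lemma refl_in_own_inversions: "t \<in> refls \<Longrightarrow> t \<in> inversions t"
  using odd_len_refl[of t] by (cases "len t") (auto simp: inversions_def)

lemma inversions_one [simp]: "inversions \<one> = {}"
  by (auto simp: inversions_def)

end

section \<open>Hurwitz moves\<close>

context finite_coxeter
begin

sublocale R: involutive_generators G refls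
proof
  show "generate G refls = carrier G"
  proof (rule antisym)
    show "generate G refls \<subseteq> carrier G" by (intro generate_incl subsetI) simp
    show "carrier G \<subseteq> generate G refls"
      using mono_generate[of S refls] gen_refl generate_gens by blast
  qed
qed (auto simp: subset_iff)

abbreviation rlen :: "'a \<Rightarrow> nat" where "rlen \<equiv> refl_length G refls"

text \<open>The moves are not restricted to pairs with product below \<open>c\<close>; this is
  recovered later for neighbours in a shortest factorisation. Through \<open>word_cong\<close> the
  moves are available in both directions and in any context.\<close>

definition hurwitz :: "('a list \<times> 'a list) set" where
  "hurwitz = word_cong refls {([s, t], [s \<otimes> t \<otimes> inv s, s]) | s t. s \<in> refls \<and> t \<in> refls}"

lemma hurwitz_refl: "set ws \<subseteq> refls \<Longrightarrow> (ws, ws) \<in> hurwitz"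
  unfolding hurwitz_def by (rule word_cong.refl) (simp add: lists_eq_set)

lemma hurwitz_sym: "(v, w) \<in> hurwitz \<Longrightarrow> (w, v) \<in> hurwitz"
  unfolding hurwitz_def by (rule word_cong.sym)

lemma hurwitz_trans [trans]: "(u, v) \<in> hurwitz \<Longrightarrow> (v, w) \<in> hurwitz \<Longrightarrow> (u, w) \<in> hurwitz"
  unfolding hurwitz_def by (rule word_cong.trans)

lemma hurwitz_set: "(v, w) \<in> hurwitz \<Longrightarrow> set v \<subseteq> refls \<and> set w \<subseteq> refls"
  unfolding hurwitz_def using word_cong_lists by (fastforce simp: lists_eq_set)

lemma hurwitz_append:
  "(v, v') \<in> hurwitz \<Longrightarrow> (w, w') \<in> hurwitz \<Longrightarrow> (v @ w, v' @ w') \<in> hurwitz"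
  unfolding hurwitz_def by (rule word_cong_append)

lemma hurwitz_Cons: "t \<in> refls \<Longrightarrow> (v, w) \<in> hurwitz \<Longrightarrow> (t # v, t # w) \<in> hurwitz"
  using hurwitz_append[of "[t]" "[t]" v w] hurwitz_refl[of "[t]"] by simp

lemma hurwitz_in_context:
  assumes "(v, w) \<in> hurwitz" "set a \<subseteq> refls" "set b \<subseteq> refls"
  shows "(a @ v @ b, a @ w @ b) \<in> hurwitz"
  using assms by (intro hurwitz_append hurwitz_refl)

lemma hurwitz_move: "s \<in> refls \<Longrightarrow> t \<in> refls \<Longrightarrow> ([s, t], [s \<otimes> t \<otimes> inv s, s]) \<in> hurwitz"
  unfolding hurwitz_def
  using word_cong.rel[of "[s, t]" "[s \<otimes> t \<otimes> inv s, s]" _ refls "[]" "[]"] refls_conj(1)[of t s]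
  by simp

lemma hurwitz_induct [consumes 1, case_names refl sym trans move]:
  assumes "(v, w) \<in> hurwitz"
    and "\<And>w. set w \<subseteq> refls \<Longrightarrow> P w w"
    and "\<And>v w. (v, w) \<in> hurwitz \<Longrightarrow> P v w \<Longrightarrow> P w v"
    and "\<And>u v w. (u, v) \<in> hurwitz \<Longrightarrow> P u v \<Longrightarrow> (v, w) \<in> hurwitz \<Longrightarrow> P v w \<Longrightarrow> P u w"
    and "\<And>s t a b. s \<in> refls \<Longrightarrow> t \<in> refls \<Longrightarrow> set a \<subseteq> refls \<Longrightarrow> set b \<subseteq> refls \<Longrightarrow>
      P (a @ [s, t] @ b) (a @ [s \<otimes> t \<otimes> inv s, s] @ b)"
  shows "P v w"
  using assms(1) unfolding hurwitz_def
proof (induction rule: word_cong.induct)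
  case (refl w)
  then show ?case by (intro assms(2)) (simp add: lists_eq_set)
next
  case (sym v w)
  from sym show ?case by - (rule assms(3)[of v w], simp_all add: hurwitz_def)
next
  case (trans u v w)
  from trans show ?case by - (rule assms(4)[of u v w], simp_all add: hurwitz_def)
next
  case (rel l r a b)
  then obtain s t where "s \<in> refls" "t \<in> refls" "l = [s, t]" "r = [s \<otimes> t \<otimes> inv s, s]"
    by blast
  with rel(4,5) show ?case by (simp only: lists_eq_set mem_Collect_eq assms(5))
qed

lemma hurwitz_invariants:
  assumes "(v, w) \<in> hurwitz"
  shows "word_prod G v = word_prod G w \<and> length v = length w"
  using assms
proof (induction rule: hurwitz_induct)
  case (move s t a b)
  have "s \<otimes> t \<otimes> inv s \<in> refls" using move by (intro refls_conj) simp_all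
  with move have "word_prod G (a @ [s, t] @ b) = word_prod G (a @ [s \<otimes> t \<otimes> inv s, s] @ b)"
    by (simp add: R.word_prod_gens_append m_assoc)
  then show ?case by simp
qed simp_all

lemma hurwitz_conj:
  assumes "(v, w) \<in> hurwitz" "y \<in> carrier G"
  shows "(map (\<lambda>t. y \<otimes> t \<otimes> inv y) v, map (\<lambda>t. y \<otimes> t \<otimes> inv y) w) \<in> hurwitz"
  using assms(1)
proof (induction rule: hurwitz_induct)
  case (refl w)
  then show ?case using assms(2) by (intro hurwitz_refl) (auto simp: refls_conj)
next
  case (sym v w)
  from sym(2) show ?case by (rule hurwitz_sym)
next
  case (trans u v w)
  then show ?case by (blast intro: hurwitz_trans)
next
  case (move s t a b)
  let ?c = "\<lambda>t. y \<otimes> t \<otimes> inv y"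
  have st: "?c s \<in> refls" "?c t \<in> refls" using move assms(2) by (simp_all only: refls_conj)
  have eq: "?c (s \<otimes> t \<otimes> inv s) = ?c s \<otimes> ?c t \<otimes> inv (?c s)"
    using move assms(2) by (simp add: m_assoc inv_mult_group)
  have "set (map ?c a) \<subseteq> refls" "set (map ?c b) \<subseteq> refls"
    using move assms(2) by (auto simp: refls_conj)
  from hurwitz_in_context[OF hurwitz_move[OF st] this]
  show ?case by (simp only: map_append list.map eq)
qed

text \<open>One inverse move per letter of \<open>u\<close>: on passing the letter \<open>a\<close>
  to its right, the conjugate \<open>a \<otimes> y \<otimes> inv a\<close> becomes
  \<open>y\<close>.\<close>

lemma hurwitz_slide:
  assumes "set u \<subseteq> refls" "r \<in> refls"
  shows "((word_prod G u \<otimes> r \<otimes> inv (word_prod G u)) # u, u @ [r]) \<in> hurwitz"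
  using assms(1)
proof (induction u)
  case Nil
  then show ?case using assms(2) by (simp add: hurwitz_refl)
next
  case (Cons a u)
  let ?y = "word_prod G u \<otimes> r \<otimes> inv (word_prod G u)"
  have u: "set u \<subseteq> refls" "a \<in> refls" "word_prod G u \<in> carrier G" using Cons.prems by auto
  then have y: "?y \<in> refls" using assms(2) by (intro refls_conj)
  have "word_prod G (a # u) \<otimes> r \<otimes> inv (word_prod G (a # u)) = a \<otimes> ?y \<otimes> inv a"
    using u assms(2) by (simp add: m_assoc inv_mult_group)
  moreover have "((a \<otimes> ?y \<otimes> inv a) # a # u, a # ?y # u) \<in> hurwitz"
    using hurwitz_append[OF hurwitz_sym[OF hurwitz_move[OF u(2) y]] hurwitz_refl[OF u(1)]] by simp
  moreover have "(a # ?y # u, a # u @ [r]) \<in> hurwitz"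
    using Cons.IH[OF u(1)] u(2) by (intro hurwitz_Cons)
  ultimately show ?case using hurwitz_trans by fastforce
qed

text \<open>\<open>r\<close> is the product of the palindrome with arm \<open>u\<close> around the
  letter \<open>a\<close>. Conjugation by the whole word turns it into a palindrome around the same
  letter whose arm is \<open>v\<close> reversed.\<close>

lemma len_conj_prefix:
  assumes "ws = u @ a # v" "set ws \<subseteq> S"
    and r: "r = word_prod G u \<otimes> a \<otimes> inv (word_prod G u)"
  shows "len r \<le> 2 * length u + 1"
    and "len (inv (word_prod G ws) \<otimes> r \<otimes> word_prod G ws) \<le> 2 * length v + 1"
proof -
  have uv: "set u \<subseteq> S" "a \<in> S" "set v \<subseteq> S" using assms by auto
  have conj: "len (word_prod G x \<otimes> a \<otimes> inv (word_prod G x)) \<le> 2 * length x + 1" if "set x \<subseteq> S" for x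
  proof -
    have "word_prod G x \<otimes> a \<otimes> inv (word_prod G x) = word_prod G (x @ a # rev x)"
      using that uv by (simp add: word_prod_gens_append word_prod_rev m_assoc)
    then show ?thesis using len_word_prod[of "x @ a # rev x"] that uv by simp
  qed
  from conj[OF uv(1)] show "len r \<le> 2 * length u + 1" unfolding r .
  have "inv (word_prod G ws) \<otimes> r \<otimes> word_prod G ws
      = word_prod G (rev v) \<otimes> a \<otimes> inv (word_prod G (rev v))"
    unfolding r assms(1) using uv
    by (simp add: word_prod_gens_append word_prod_rev m_assoc inv_mult_group)
  with conj[of "rev v"] uv show "len (inv (word_prod G ws) \<otimes> r \<otimes> word_prod G ws) \<le> 2 * length v + 1"
    by simp
qed

text \<open>A reduced word of \<open>r\<close> is a palindrome around the letter that produces \<open>r\<close>, and every other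
  inversion \<open>r'\<close> comes from a position left or right of the centre; then \<open>r'\<close> or its conjugate
  by \<open>r\<close> is shorter than \<open>r\<close>.\<close>

lemma inversions_shortest:
  assumes "r \<in> refls" "r' \<in> inversions r" "len r \<le> len r'" "len r \<le> len (r \<otimes> r' \<otimes> r)"
  shows "r' = r"
proof -
  obtain ws where ws: "set ws \<subseteq> S" "word_prod G ws = r" "length ws = len r"
    using reduced_word[OF refls_closed[OF assms(1)]] by blast
  obtain u a v where uv: "ws = u @ a # v" "r = word_prod G u \<otimes> a \<otimes> inv (word_prod G u)"
    using inversions_exchange[OF ws(1), of r] refl_in_own_inversions[OF assms(1)] ws(2) by metis
  obtain u' a' v' where uv': "ws = u' @ a' # v'" "r' = word_prod G u' \<otimes> a' \<otimes> inv (word_prod G u')"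
    using inversions_exchange[OF ws(1), of r'] assms(2) ws(2) by metis
  have "r \<otimes> r \<otimes> r = r" using assms(1) by (simp add: m_assoc)
  then have "len r \<le> 2 * length u + 1" "len r \<le> 2 * length v + 1"
    using len_conj_prefix[OF uv(1) ws(1) uv(2)] ws(2) assms(1) by simp_all
  moreover have "len r' \<le> 2 * length u' + 1" "len (r \<otimes> r' \<otimes> r) \<le> 2 * length v' + 1"
    using len_conj_prefix[OF uv'(1) ws(1) uv'(2)] ws(2) assms(1) by simp_all
  moreover have "len r = length u + length v + 1" "len r = length u' + length v' + 1"
    using arg_cong[OF uv(1), of length] arg_cong[OF uv'(1), of length] ws(3) by simp_all
  ultimately have "length u = length u'" using assms(3,4) by linarith
  with uv(1) uv'(1) have "u = u'" "a = a'" by auto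
  with uv(2) uv'(2) show ?thesis by simp
qed

text \<open>The Hurwitz class of \<open>[t, t']\<close> contains all neighbours
  \<open>[d (Suc k), d k]\<close> in the family of reflections \<open>d k\<close>. If none of them
  serves, no \<open>d k\<close> is an inversion of \<open>u\<close> or of
  \<open>\<rho> \<otimes> u\<close>, hence none of \<open>\<rho>\<close>, by the cocycle rule. The
  same rule applied to \<open>\<rho> \<otimes> d k\<close> for a shortest \<open>d k\<close> then
  yields a second inversion of \<open>d k\<close> in the family, against
  \<open>inversions_shortest\<close>. At a peak, either alternative puts the new middle partial
  product below the old one.\<close>

lemma hurwitz_no_peak:
  assumes t: "t \<in> refls" "t' \<in> refls" "t \<noteq> t'" and u: "u \<in> carrier G"
  shows "\<exists>r r'. ([t, t'], [r, r']) \<in> hurwitz \<and>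
    (len (r' \<otimes> u) < len u \<or> len (r' \<otimes> u) < len (t \<otimes> (t' \<otimes> u)))"
proof (rule ccontr)
  assume no: "\<not> ?thesis"
  define \<rho> where "\<rho> = t \<otimes> t'"
  define d where "d k = \<rho> [^] k \<otimes> t" for k :: nat
  have \<rho>: "\<rho> \<in> carrier G" using t by (simp add: \<rho>_def)
  have d0: "d 0 = t" using t by (simp add: d_def)
  have d_Suc: "d (Suc k) = \<rho> \<otimes> d k" for k
    using \<rho> t nat_pow_Suc2[OF \<rho>, of k] by (simp add: d_def m_assoc)
  have d_closed [simp]: "d k \<in> carrier G" for k using \<rho> t by (simp add: d_def)
  have all: "d k \<in> refls \<and> d (Suc k) \<in> refls \<and> ([t, t'], [d (Suc k), d k]) \<in> hurwitz" for k
  proof (induction k)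
    case 0
    have "d (Suc 0) = t \<otimes> t' \<otimes> inv t" using t by (simp add: d_Suc d0 \<rho>_def)
    then show ?case using hurwitz_move[of t t'] refls_conj(1)[of t' t] t d0 by simp
  next
    case (Suc k)
    let ?a = "d (Suc k)" and ?b = "d k"
    have "?a \<otimes> ?b = \<rho>" using Suc \<rho> by (simp add: d_Suc m_assoc)
    then have "?a \<otimes> ?b \<otimes> inv ?a = d (Suc (Suc k))" using Suc d_Suc[of "Suc k"] by simp
    then show ?case
      using Suc hurwitz_move[of ?a ?b] refls_conj(1)[of ?b ?a] hurwitz_trans by auto
  qed
  have d_refl [simp]: "d k \<in> refls" for k using all by blast
  have d_add: "d (j + n) = \<rho> [^] n \<otimes> d j" for j n
    using \<rho> t by (simp add: d_def m_assoc[symmetric] nat_pow_mult add.commute)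
  have d_ord: "d (j + n * ord \<rho>) = d j" for j n
    using \<rho> by (simp add: d_add pow_eq_id)
  have ord: "ord \<rho> > 0" using ord_pos[OF \<rho>] .
  have dd: "d (j + n) \<otimes> d j = \<rho> [^] n" for j n
    using \<rho> by (simp add: d_add m_assoc)
  have d_conj: "d i \<otimes> d j \<otimes> d i \<in> range d" for i j
  proof -
    \<comment> \<open>With integer indices, \<open>d i \<otimes> d j\<close> is the power of
      \<open>\<rho>\<close> with exponent \<open>i - j\<close>; adding a multiple of
      \<open>ord \<rho>\<close> keeps the exponent a natural number.\<close>
    define n where "n = i + j * ord \<rho> - j"
    have "j \<le> i + j * ord \<rho>" using ord by (cases "ord \<rho>") auto
    then have n: "j + n = i + j * ord \<rho>" by (simp add: n_def)
    then have i: "d i = d (j + n)" using d_ord by metis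
    have "d i \<otimes> d j \<otimes> d i = \<rho> [^] n \<otimes> d i" using dd i by metis
    then show ?thesis using d_add[of i n] by (metis rangeI)
  qed
  have d_\<rho>: "d (Suc k) \<otimes> \<rho> = d k" for k
  proof -
    have "\<rho> = d (Suc k) \<otimes> d k" using dd[of k 1] \<rho> by simp
    then show ?thesis by simp
  qed
  \<comment> \<open>The family is periodic with period \<open>ord \<rho>\<close>, so the index 0 has
    a predecessor too.\<close>
  have prev: "\<exists>k'. d k = d (Suc k')" for k
    using d_ord[of k 1] ord by (metis add_Suc_right gr0_implies_Suc mult_1)
  have not_below: "d k \<notin> inversions u" for k
    using no all[of k] unfolding inversions_def by blast
  \<comment> \<open>An index shift exchanges the two alternatives: \<open>d (Suc k')\<close> carries
    \<open>\<rho> \<otimes> u\<close> to \<open>d k' \<otimes> u\<close>.\<close>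
  have not_below': "d k \<notin> inversions (\<rho> \<otimes> u)" for k
  proof -
    obtain k' where k': "d k = d (Suc k')" using prev by blast
    have "d (Suc k') \<otimes> (\<rho> \<otimes> u) = d k' \<otimes> u" using d_\<rho>[of k'] \<rho> u by (simp add: m_assoc[symmetric])
    moreover have "t \<otimes> (t' \<otimes> u) = \<rho> \<otimes> u" using t u by (simp add: \<rho>_def m_assoc)
    ultimately show ?thesis using no all[of k'] unfolding k' inversions_def by auto
  qed
  have conj_\<rho>: "inv \<rho> \<otimes> d (Suc (Suc k)) \<otimes> \<rho> = d k" for k
    using d_\<rho>[of "Suc k"] \<rho> by (simp add: m_assoc) (simp add: d_Suc \<rho>)
  have "d k \<notin> inversions \<rho>" for k
  proof -
    obtain k' where "d k = d (Suc (Suc k'))" using prev[of k] prev d_Suc by metis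
    with conj_\<rho>[of k'] not_below[of k'] not_below'[of k] inversions_mult[OF \<rho> u, of "d k"] show ?thesis
      by simp
  qed
  moreover obtain k0 where k0: "\<And>k. len (d k0) \<le> len (d k)"
    using ex_has_least_nat[of "\<lambda>_. True" 0 "\<lambda>k. len (d k)"] by blast
  obtain j where j: "d k0 = d (Suc j)" using prev by blast
  \<comment> \<open>The next term of the family is a reflection, hence its own inversion. It is not
    an inversion of \<open>\<rho>\<close>, so the cocycle rule conjugates it into an inversion of
    \<open>d k0\<close>.\<close>
  have "\<rho> \<otimes> d k0 \<in> inversions (\<rho> \<otimes> d k0)"
    using refl_in_own_inversions[OF d_refl[of "Suc k0"]] unfolding d_Suc .
  ultimately have "inv \<rho> \<otimes> (\<rho> \<otimes> d k0) \<otimes> \<rho> \<in> inversions (d k0)"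
    using inversions_mult[OF \<rho>, of "d k0" "\<rho> \<otimes> d k0"] d_refl[of "Suc k0"] unfolding d_Suc[symmetric] by simp
  moreover have "inv \<rho> \<otimes> (\<rho> \<otimes> d k0) \<otimes> \<rho> = d j" using \<rho> d_\<rho>[of j] j by simp
  ultimately have "d j \<in> inversions (d k0)" by simp
  moreover have "len (d k0) \<le> len (d k0 \<otimes> d j \<otimes> d k0)" using d_conj k0 by (metis imageE)
  ultimately have "d j = d (Suc j)" using inversions_shortest[of "d k0" "d j"] k0 j by simp
  then have "\<rho> = \<one>" using dd[of j 1] \<rho> by simp
  then have "t = t'" using t by (metis \<rho>_def inv_equality R.gen_inv refls_closed inv_inv)
  with t show False by simp
qed

section \<open>Ascending factorisations\<close>

fun ascending :: "'a list \<Rightarrow> bool" where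
  "ascending [] \<longleftrightarrow> True"
| "ascending (t # ts) \<longleftrightarrow> len (word_prod G ts) < len (t \<otimes> word_prod G ts) \<and> ascending ts"

text \<open>The termination measure for removing peaks: a move changes one partial product only,
  since those of the suffix and of the prefix stay the same.\<close>

fun path_weight :: "'a list \<Rightarrow> nat" where
  "path_weight [] = 0"
| "path_weight (t # ts) = len (word_prod G (t # ts)) + path_weight ts"

lemma path_weight_context:
  assumes "path_weight v < path_weight w" "word_prod G v = word_prod G w"
  shows "path_weight (a @ v) < path_weight (a @ w)"
proof (induction a)
  case (Cons t a)
  have "word_prod G (a @ v) = word_prod G (a @ w)"
    using assms(2) by (induction a) auto
  with Cons show ?case by simp
qed (use assms in simp)

lemma not_ascending_peak:
  assumes "set ts \<subseteq> refls" "\<not> ascending ts"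
  shows "\<exists>a t t' b. ts = a @ [t, t'] @ b \<and> len (word_prod G b) < len (t' \<otimes> word_prod G b) \<and>
    len (t \<otimes> (t' \<otimes> word_prod G b)) < len (t' \<otimes> word_prod G b)"
  using assms
proof (induction ts)
  case (Cons t us)
  show ?case
  proof (cases "ascending us")
    case False
    then obtain a t1 t2 b where "us = a @ [t1, t2] @ b"
      "len (word_prod G b) < len (t2 \<otimes> word_prod G b)"
      "len (t1 \<otimes> (t2 \<otimes> word_prod G b)) < len (t2 \<otimes> word_prod G b)"
      using Cons by auto
    then show ?thesis by (intro exI[of _ "t # a"]) auto
  next
    case True
    have t: "t \<in> refls" "word_prod G us \<in> carrier G" using Cons.prems by auto
    have le: "len (t \<otimes> word_prod G us) < len (word_prod G us)"
      using Cons.prems(2) True len_refl_mult_neq[OF t] by simp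
    show ?thesis
    proof (cases us)
      case Nil
      with le show ?thesis by simp
    next
      case (Cons t' b)
      with le True show ?thesis by (intro exI[of _ "[]"]) auto
    qed
  qed
qed simp

text \<open>Shortness excludes equal neighbours at a peak, the case that
  \<open>hurwitz_no_peak\<close> does not cover; at any other peak a replacement lowers
  \<open>path_weight\<close>.\<close>

lemma hurwitz_ascending:
  assumes "set ts \<subseteq> refls" "rlen (word_prod G ts) = length ts"
  shows "\<exists>us. (ts, us) \<in> hurwitz \<and> ascending us"
  using assms
proof (induction "path_weight ts" arbitrary: ts rule: less_induct)
  case less
  show ?case
  proof (cases "ascending ts")
    case True
    then show ?thesis using hurwitz_refl less.prems by blast
  next
    case False
    then obtain a t t' b where ts: "ts = a @ [t, t'] @ b"
      and peak: "len (word_prod G b) < len (t' \<otimes> word_prod G b)"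
      "len (t \<otimes> (t' \<otimes> word_prod G b)) < len (t' \<otimes> word_prod G b)"
      using not_ascending_peak less.prems by blast
    have sub: "set a \<subseteq> refls" "t \<in> refls" "t' \<in> refls" "set b \<subseteq> refls" "word_prod G b \<in> carrier G"
      using less.prems ts by auto
    have "t \<noteq> t'"
    proof
      assume "t = t'"
      then have "word_prod G ts = word_prod G (a @ b)"
        unfolding ts using sub by (simp add: R.word_prod_gens_append)
      then have "rlen (word_prod G ts) \<le> length (a @ b)"
        using R.len_word_prod[of "a @ b"] sub by simp
      with less.prems ts show False by simp
    qed
    then obtain r r' where r: "([t, t'], [r, r']) \<in> hurwitz"
      "len (r' \<otimes> word_prod G b) < len (word_prod G b) \<or>
        len (r' \<otimes> word_prod G b) < len (t \<otimes> (t' \<otimes> word_prod G b))"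
      using hurwitz_no_peak sub by blast
    let ?ts = "a @ [r, r'] @ b"
    have h: "(ts, ?ts) \<in> hurwitz"
      unfolding ts using r(1) sub by (intro hurwitz_in_context)
    have rr: "set [r, r'] \<subseteq> refls" "word_prod G [t, t'] = word_prod G [r, r']"
      using hurwitz_set[OF r(1)] hurwitz_invariants[OF r(1)] by auto
    have eq: "word_prod G ([t, t'] @ b) = word_prod G ([r, r'] @ b)"
      using rr sub by (simp only: R.word_prod_gens_append set_simps insert_subset empty_subsetI simp_thms)
    have "path_weight ([r, r'] @ b) < path_weight ([t, t'] @ b)"
      using eq peak r(2) by auto
    from path_weight_context[OF this eq[symmetric]] have "path_weight ?ts < path_weight ts"
      unfolding ts .
    then obtain us where "(?ts, us) \<in> hurwitz" "ascending us"
      using less.hyps[of ?ts] hurwitz_set[OF h] hurwitz_invariants[OF h] less.prems by auto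
    with h show ?thesis using hurwitz_trans by blast
  qed
qed

section \<open>Products of distinct simple reflections\<close>

lemma act_notin: "x \<notin> set ws \<Longrightarrow> act ws v x = v x"
  by (induction ws) (auto simp: act1_def)

text \<open>Each letter changes only its own coordinate and occurs once, so no other letter can undo
  its change; if the whole word fixes \<open>v\<close>, every letter does.\<close>

lemma act_distinct_fixed:
  assumes "distinct ws" "act ws v = v" "s \<in> set ws"
  shows "act1 s v = v"
  using assms
proof (induction ws)
  case (Cons a ws)
  have "act ws v x = v x" for x
  proof (cases "x = a")
    case True
    then show ?thesis using Cons.prems by (simp add: act_notin)
  next
    case False
    then have "act1 a (act ws v) x = act ws v x" by (simp add: act1_def)
    with Cons.prems show ?thesis by simp
  qed
  then have *: "act ws v = v" by auto
  with Cons show ?case by auto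
qed simp

lemma word_prod_distinct_eq_one:
  assumes "set ws \<subseteq> S" "distinct ws" "word_prod G ws = \<one>"
  shows "ws = []"
proof (rule ccontr)
  assume "ws \<noteq> []"
  then obtain s where s: "s \<in> set ws" by (meson list.set_sel(1))
  have "act ws v = v" for v
    using tits_word_prod[OF assms(1)] assms(3) tits_one by metis
  then have "act1 s (simple s) = simple s"
    using act_distinct_fixed[OF assms(2) _ s] by blast
  moreover have "act1 s (simple s) = (\<lambda>x. - simple s x)"
    using tits_gen_simple[of s] tits_gen[of s] s assms(1) by auto
  ultimately have "simple s s = - simple s s" by metis
  then show False by (simp add: simple_def)
qed

text \<open>The first letter of an ascending factorisation is an inversion of the product, so the
  exchange condition deletes one letter of \<open>ss\<close> and leaves a distinct word for the
  induction. The base case holds because only the empty distinct word has product one.\<close>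

lemma ascending_length:
  assumes "set ts \<subseteq> refls" "ascending ts" "set ss \<subseteq> S" "distinct ss" "word_prod G ts = word_prod G ss"
  shows "length ts = length ss"
  using assms
proof (induction ts arbitrary: ss)
  case Nil
  then show ?case using word_prod_distinct_eq_one[of ss] by simp
next
  case (Cons t us)
  have t: "t \<in> refls" "set us \<subseteq> refls" using Cons.prems by auto
  have us: "t \<otimes> word_prod G ss = word_prod G us"
    using t by (simp add: Cons.prems(5)[symmetric])
  then have "t \<in> inversions (word_prod G ss)"
    using Cons.prems t unfolding inversions_def by auto
  then obtain u r v where uv: "ss = u @ r # v" "t \<otimes> word_prod G ss = word_prod G (u @ v)"
    using inversions_exchange[OF Cons.prems(3)] by metis
  have "length us = length (u @ v)"
    using Cons.IH[of "u @ v"] Cons.prems uv us by auto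
  then show ?case using uv(1) by simp
qed

text \<open>A shortest factorisation can be made ascending without changing its length, and
  ascending factorisations have exactly as many letters as \<open>ss\<close>.\<close>

lemma rlen_distinct:
  assumes "set ss \<subseteq> S" "distinct ss"
  shows "rlen (word_prod G ss) = length ss"
proof -
  have "word_prod G ss \<in> carrier G" using assms by simp
  then obtain ts where ts: "set ts \<subseteq> refls" "word_prod G ts = word_prod G ss"
    "length ts = rlen (word_prod G ss)"
    using R.reduced_word by blast
  then obtain us where us: "(ts, us) \<in> hurwitz" "ascending us"
    using hurwitz_ascending by metis
  then have "length us = length ss"
    using ascending_length[of us ss] hurwitz_set[OF us(1)] hurwitz_invariants[OF us(1)] ts assms by auto
  with ts us hurwitz_invariants show ?thesis by metis
qed

text \<open>Once \<open>ts\<close> is ascending, its first letter is an inversion of the product and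
  corresponds by exchange to a letter \<open>r\<close> of \<open>ss\<close>. The other letters are
  compared by induction with \<open>ss\<close> without \<open>r\<close>, and
  \<open>hurwitz_slide\<close> puts \<open>r\<close> back in its place.\<close>

lemma hurwitz_simple_word:
  assumes "set ss \<subseteq> S" "rlen (word_prod G ss) = length ss"
    and "set ts \<subseteq> refls" "word_prod G ts = word_prod G ss" "length ts = length ss"
  shows "(ts, ss) \<in> hurwitz"
  using assms
proof (induction "length ss" arbitrary: ss ts)
  case 0
  then show ?case using hurwitz_refl[of "[]"] by simp
next
  case (Suc n)
  obtain us' where us': "(ts, us') \<in> hurwitz" "ascending us'"
    using hurwitz_ascending[of ts] Suc.prems by auto
  note inv = hurwitz_invariants[OF us'(1)]
  obtain t us where us: "us' = t # us" using inv Suc by (cases us') auto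
  have t: "t \<in> refls" "set us \<subseteq> refls" using hurwitz_set[OF us'(1)] us by auto
  have prod: "t \<otimes> word_prod G us = word_prod G ss" using inv us Suc.prems by simp
  have us_eq: "t \<otimes> word_prod G ss = word_prod G us"
    using t by (simp add: prod[symmetric])
  then have "t \<in> inversions (word_prod G ss)"
    using us'(2) t prod unfolding us inversions_def by auto
  then obtain u r v where uv: "ss = u @ r # v" "t = word_prod G u \<otimes> r \<otimes> inv (word_prod G u)"
      "t \<otimes> word_prod G ss = word_prod G (u @ v)"
    using inversions_exchange[OF Suc.prems(1)] by metis
  have S: "set u \<subseteq> S" "r \<in> S" "set v \<subseteq> S" using uv(1) Suc.prems(1) by auto
  then have refls: "set u \<subseteq> refls" "r \<in> refls" "set v \<subseteq> refls" by (auto intro: gen_refl)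
  have len: "length us = n" "length (u @ v) = n"
    using inv us Suc.prems Suc.hyps(2) uv(1) by auto
  have "rlen (word_prod G us) = length us"
    using R.reduced_append(2)[of "[t]" us] t inv us Suc.prems by auto
  moreover have "set (u @ v) \<subseteq> S" using S by simp
  moreover have "word_prod G us = word_prod G (u @ v)" using us_eq uv(3) by (rule HOL.trans[OF HOL.sym])
  ultimately have "(us, u @ v) \<in> hurwitz"
    using Suc.hyps(1)[of "u @ v" us] len t(2) by simp
  then have "(t # us, t # u @ v) \<in> hurwitz"
    using t by (intro hurwitz_Cons)
  also have "(t # u @ v, ss) \<in> hurwitz"
    using hurwitz_append[OF hurwitz_slide[OF refls(1,2)] hurwitz_refl[OF refls(3)]]
    unfolding uv(1,2) by simp
  finally show ?case using us'(1) us hurwitz_trans by blast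
qed

end

section \<open>Elements below a Coxeter element\<close>

context finite_coxeter
begin

definition parabolic_refls :: "'a set \<Rightarrow> 'a set" where
  "parabolic_refls J = {x \<otimes> s \<otimes> inv x | x s. x \<in> generate G J \<and> s \<in> J}"

lemma generate_parabolic_carrier: "J \<subseteq> S \<Longrightarrow> x \<in> generate G J \<Longrightarrow> x \<in> carrier G"
  using generate_in_carrier gens_carrier by blast

lemma parabolic_refls_subset: "J \<subseteq> S \<Longrightarrow> parabolic_refls J \<subseteq> refls"
  unfolding parabolic_refls_def using generate_parabolic_carrier reflsI by blast

lemma parabolic_refls_generate:
  assumes "J \<subseteq> S" "t \<in> parabolic_refls J"
  shows "t \<in> generate G J"
proof -
  obtain x s where x: "x \<in> generate G J" "s \<in> J" "t = x \<otimes> s \<otimes> inv x"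
    using assms(2) unfolding parabolic_refls_def by blast
  then show ?thesis
    using assms(1) gens_carrier by (metis generate.eng generate.incl generate_m_inv_closed order_trans)
qed

lemma parabolic_refls_conj:
  assumes "J \<subseteq> S" "a \<in> generate G J" "t \<in> parabolic_refls J"
  shows "a \<otimes> t \<otimes> inv a \<in> parabolic_refls J"
proof -
  obtain x s where x: "x \<in> generate G J" "s \<in> J" "t = x \<otimes> s \<otimes> inv x"
    using assms(3) unfolding parabolic_refls_def by blast
  moreover have "a \<in> carrier G" "x \<in> carrier G" "s \<in> carrier G"
    using x assms generate_parabolic_carrier by auto
  ultimately have "a \<otimes> t \<otimes> inv a = (a \<otimes> x) \<otimes> s \<otimes> inv (a \<otimes> x)"
    by (simp add: m_assoc inv_mult_group)
  moreover have "a \<otimes> x \<in> generate G J" using assms(2) x(1) by (rule generate.eng)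
  ultimately show ?thesis unfolding parabolic_refls_def using x(2) by blast
qed

lemma gens_parabolic_refls:
  assumes "J \<subseteq> S"
  shows "J \<subseteq> parabolic_refls J"
proof
  fix s assume s: "s \<in> J"
  then have "s = \<one> \<otimes> s \<otimes> inv \<one>" using assms by auto
  then show "s \<in> parabolic_refls J"
    unfolding parabolic_refls_def using s generate.one by blast
qed

text \<open>Serves to place all letters of a shortest factorisation of a product of simple
  reflections in their parabolic subgroup, since that factorisation is Hurwitz equivalent to the
  simple word itself.\<close>

lemma hurwitz_parabolic:
  assumes "(v, w) \<in> hurwitz" "J \<subseteq> S"
  shows "set v \<subseteq> parabolic_refls J \<longleftrightarrow> set w \<subseteq> parabolic_refls J"
  using assms(1)
proof (induction rule: hurwitz_induct)
  case (move s t a b)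
  have "t \<in> parabolic_refls J \<longleftrightarrow> s \<otimes> t \<otimes> inv s \<in> parabolic_refls J" if s: "s \<in> parabolic_refls J"
  proof
    assume "t \<in> parabolic_refls J"
    then show "s \<otimes> t \<otimes> inv s \<in> parabolic_refls J"
      using parabolic_refls_conj parabolic_refls_generate s assms(2) by blast
  next
    assume "s \<otimes> t \<otimes> inv s \<in> parabolic_refls J"
    from parabolic_refls_conj[OF assms(2) parabolic_refls_generate[OF assms(2) s] this]
    show "t \<in> parabolic_refls J" using move by (simp add: m_assoc)
  qed
  then show ?case by auto
qed auto

section \<open>Fixed vectors and orbits of roots\<close>

lemma tits_generate_fixed:
  assumes "J \<subseteq> S" "\<And>s. s \<in> J \<Longrightarrow> act1 s u = u" "w \<in> generate G J"
  shows "tits w u = u"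
  using assms(3)
proof (induction rule: generate.induct)
  case one
  show ?case by simp
next
  case (incl s)
  with assms show ?case by (auto simp: tits_gen)
next
  case (inv s)
  then have "s \<in> S" using assms(1) by blast
  with inv assms(2) show ?case by (simp add: tits_gen)
next
  case (eng x y)
  then show ?case using generate_parabolic_carrier[OF assms(1)] by (simp add: tits_mult)
qed

lemma tits_generate_support:
  assumes "J \<subseteq> S" "w \<in> generate G J" "y \<notin> J"
  shows "tits w v y = v y"
proof -
  obtain ws where "set ws \<subseteq> J" "word_prod G ws = w"
    using generate_word[OF assms(1,2)] by blast
  with assms tits_word_prod[of ws] show ?thesis by (auto intro!: act_notin)
qed

text \<open>Under \<open>w\<close> and \<open>w \<otimes> s\<close> the simple root of
  \<open>s\<close> has opposite images, so its sum over the parabolic subgroup is zero, and by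
  linearity so is that of \<open>u\<close>. For a fixed vector, however, this sum is a nonzero
  multiple of the vector.\<close>

lemma generate_fixed_eq_zero:
  assumes J: "J \<subseteq> S" and fixed: "\<And>s. s \<in> J \<Longrightarrow> act1 s u = u" and support: "\<And>y. y \<notin> J \<Longrightarrow> u y = 0"
  shows "u y = 0"
proof -
  let ?W = "generate G J"
  have W: "?W \<subseteq> carrier G" using generate_parabolic_carrier[OF J] by blast
  have finite: "finite ?W" "finite J"
    using finite_subset[OF W finite_carrier] finite_subset[OF J finite_gens] .
  have average: "(\<Sum>w\<in>?W. tits w (simple s) y) = 0" if s: "s \<in> J" for s
  proof -
    have sS: "s \<in> S" using s J by blast
    have "(\<Sum>w\<in>?W. tits w (simple s) y) = (\<Sum>w\<in>?W. tits (w \<otimes> s) (simple s) y)"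
    proof (rule sum.reindex_bij_witness[of _ "\<lambda>w. w \<otimes> s" "\<lambda>w. w \<otimes> s"])
      fix w assume w: "w \<in> ?W"
      show "w \<otimes> s \<in> ?W" by (rule generate.eng[OF w generate.incl[OF s]])
      show *: "w \<otimes> s \<otimes> s = w" using w W sS by (auto simp: m_assoc gen_square)
      show "tits (w \<otimes> s \<otimes> s) (simple s) y = tits w (simple s) y" unfolding * ..
      show "w \<otimes> s \<in> ?W" by fact
      show "w \<otimes> s \<otimes> s = w" by fact
    qed
    also have "\<dots> = - (\<Sum>w\<in>?W. tits w (simple s) y)"
      using W sS by (simp add: tits_mult_gen_simple subset_iff flip: sum_negf)
    finally show ?thesis by simp
  qed
  have u: "u = (\<lambda>y. \<Sum>s\<in>J. u s * simple s y)"
    using finite(2) support by (auto simp: simple_def if_distrib[of "\<lambda>c. _ * c"] cong: if_cong)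
  have "tits w u y = (\<Sum>s\<in>J. u s * tits w (simple s) y)" if "w \<in> ?W" for w
  proof -
    have w: "w \<in> carrier G" using that W by blast
    have "tits w (\<lambda>y. \<Sum>s\<in>J. u s * simple s y) = (\<lambda>y. \<Sum>s\<in>J. u s * tits w (simple s) y)"
      using tits_sum[OF w finite(2), of "\<lambda>s y. u s * simple s y"] by (simp add: tits_scale[OF w])
    then show ?thesis by (subst u) simp
  qed
  then have "(\<Sum>w\<in>?W. tits w u y) = (\<Sum>w\<in>?W. \<Sum>s\<in>J. u s * tits w (simple s) y)" by simp
  also have "\<dots> = (\<Sum>s\<in>J. u s * (\<Sum>w\<in>?W. tits w (simple s) y))"
    by (subst sum.swap) (simp add: sum_distrib_left)
  also have "\<dots> = 0" using average by simp
  finally have "real (card ?W) * u y = 0"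
    using tits_generate_fixed[OF J fixed] by simp
  moreover have "card ?W \<noteq> 0" using finite(1) generate.one by auto
  ultimately show ?thesis by simp
qed

text \<open>If no power of the Coxeter element \<open>q\<close> inverted \<open>t\<close>, the sum of the \<open>q\<close>-orbit of its positive
  root would be a nonzero vector fixed by \<open>q\<close>, hence by every simple reflection occurring in \<open>q\<close>;
  but averaging over the finite group they generate kills it.\<close>

lemma coxeter_orbit_meets_inversions:
  assumes ss: "set ss \<subseteq> S" "distinct ss" and t: "t \<in> parabolic_refls (set ss)"
    and q: "q = word_prod G ss"
  shows "\<exists>j::nat. inv (q [^] j) \<otimes> t \<otimes> q [^] j \<in> inversions q"
proof (rule ccontr)
  assume "\<not> ?thesis"
  then have no: "inv (q [^] j) \<otimes> t \<otimes> q [^] j \<notin> inversions q" for j :: nat by blast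
  have qc: "q \<in> carrier G" using ss q by simp
  have t_refl: "t \<in> refls" using t parabolic_refls_subset[OF ss(1)] by blast
  \<comment> \<open>By the cocycle rule each further factor \<open>q\<close> tests the next
    conjugate of \<open>t\<close>, so the powers of \<open>q\<close> invert no member of the orbit
    either.\<close>
  have not_inv: "inv (q [^] j) \<otimes> t \<otimes> q [^] j \<notin> inversions (q [^] m)" for j m :: nat
  proof (induction m arbitrary: j)
    case (Suc m)
    let ?t = "inv (q [^] j) \<otimes> t \<otimes> q [^] j"
    have "inv q \<otimes> ?t \<otimes> q = inv (q [^] Suc j) \<otimes> t \<otimes> q [^] Suc j"
      using qc t_refl by (simp add: m_assoc inv_mult_group)
    moreover have "?t \<in> refls" using t_refl qc by (intro refls_conj) simp_all
    ultimately show ?case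
      using inversions_mult[OF qc, of "q [^] m" ?t] Suc[of "Suc j"] no[of j] qc
      by (simp only: nat_pow_Suc2[OF qc] nat_pow_closed simp_thms)
  qed simp
  obtain x0 s where x0: "x0 \<in> generate G (set ss)" "s \<in> set ss" "t = x0 \<otimes> s \<otimes> inv x0"
    using t unfolding parabolic_refls_def by blast
  have s: "s \<in> S" using x0(2) ss by blast
  have x0c: "x0 \<in> carrier G" using generate_parabolic_carrier[OF ss(1) x0(1)] .
  obtain x where x: "x \<in> {x0, x0 \<otimes> s}" "x \<otimes> s \<otimes> inv x = t" and pos: "\<And>y. tits x (simple s) y \<ge> 0"
    using obtain_nonneg_root[OF x0c s] x0(3) by metis
  have xg: "x \<in> generate G (set ss)"
    using x(1) x0 generate.eng[OF x0(1) generate.incl[OF x0(2)]] by blast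
  have xc: "x \<in> carrier G" using generate_parabolic_carrier[OF ss(1) xg] .
  have qg: "q \<in> generate G (set ss)" unfolding q by (rule word_prod_in_generate) simp
  have qpow: "inv (q [^] m) \<in> generate G (set ss)" for m :: nat
  proof -
    have "set ss \<subseteq> carrier G" using ss(1) gens_carrier by blast
    moreover have "q [^] m \<in> generate G (set ss)"
      by (induction m) (use qg in \<open>auto intro: generate.one generate.eng\<close>)
    ultimately show ?thesis by (rule generate_m_inv_closed)
  qed
  \<comment> \<open>The orbit of the positive root of \<open>t\<close>. It closes up after
    \<open>ord q\<close> steps, so its sum is fixed by \<open>q\<close>.\<close>
  define v where "v m = tits (inv (q [^] m)) (tits x (simple s))" for m :: nat
  have v_eq: "v m = tits (inv (q [^] m) \<otimes> x) (simple s)" for m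
    unfolding v_def using qc xc by (simp add: tits_mult)
  have v_nonneg: "v m y \<ge> 0" for m y
  proof -
    have "\<not> (\<forall>y. v m y \<le> 0)"
      using inversions_iff_root[OF xc s nat_pow_closed[OF qc] pos, of m] not_inv[of 0 m] x(2) t_refl
      unfolding v_def by simp
    moreover have "inv (q [^] m) \<otimes> x \<in> carrier G" using qc xc by simp
    ultimately show ?thesis using root_sign[OF _ s] unfolding v_eq by blast
  qed
  have v_Suc: "tits (inv q) (v m) = v (Suc m)" for m
    unfolding v_def using qc by (simp add: tits_mult inv_mult_group)
  define N where "N = ord q"
  have N: "N > 0" unfolding N_def by (rule ord_pos[OF qc])
  have v_N: "v N = v 0" unfolding v_def N_def using qc by simp
  define u where "u = (\<lambda>y. \<Sum>m<N. v m y)"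
  have "tits (inv q) u = (\<lambda>y. \<Sum>m<N. v (Suc m) y)"
    unfolding u_def using qc by (simp add: tits_sum v_Suc)
  also have "\<dots> = u"
  proof
    fix y
    have "v 0 y + (\<Sum>m<N. v (Suc m) y) = (\<Sum>m<N. v m y) + v N y"
      using sum.lessThan_Suc_shift[of "\<lambda>m. v m y" N] by simp
    then show "(\<Sum>m<N. v (Suc m) y) = u y" by (simp add: u_def v_N)
  qed
  finally have "tits q u = u" using tits_inv_cancel(2)[OF qc, of u] by simp
  then have "act ss u = u" unfolding q tits_word_prod[OF ss(1)] .
  then have fixed: "act1 r u = u" if "r \<in> set ss" for r
    using act_distinct_fixed[OF ss(2) _ that] by blast
  have "u y = 0" if "y \<notin> set ss" for y
  proof -
    have "v m y = 0" for m
    proof -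
      have "v m y = simple s y"
        unfolding v_eq using generate.eng[OF qpow xg] that
        by (intro tits_generate_support[OF ss(1)])
      with that x0(2) show ?thesis by (auto simp: simple_def)
    qed
    then show ?thesis by (simp add: u_def)
  qed
  with fixed have u0: "u y = 0" for y
    using generate_fixed_eq_zero[OF ss(1)] by blast
  \<comment> \<open>The terms of the sum are nonnegative, so a zero sum forces the term at index 0,
    the root itself, to vanish.\<close>
  have "tits x (simple s) y = 0" for y
  proof -
    have "v 0 y \<le> u y"
      unfolding u_def using N v_nonneg by (intro member_le_sum) auto
    then have "v 0 y = 0" using u0[of y] v_nonneg[of 0 y] by simp
    then show ?thesis by (simp add: v_def)
  qed
  then show False using root_nonzero[OF xc s] by blast
qed

section \<open>Induction below a product of distinct simple reflections\<close>

lemma rlen_conj: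
  assumes "y \<in> carrier G" "w \<in> carrier G"
  shows "rlen (y \<otimes> w \<otimes> inv y) = rlen w"
proof -
  have le: "rlen (y \<otimes> w \<otimes> inv y) \<le> rlen w" if y: "y \<in> carrier G" and w: "w \<in> carrier G" for y w
  proof -
    obtain ws where ws: "set ws \<subseteq> refls" "word_prod G ws = w" "length ws = rlen w"
      using R.reduced_word[OF w] by blast
    have "set (map (\<lambda>t. y \<otimes> t \<otimes> inv y) ws) \<subseteq> refls"
      using ws(1) y by (auto simp: refls_conj)
    from R.len_word_prod[OF this] show ?thesis
      using word_prod_map_conj[of y ws] ws y by (auto simp: subset_iff)
  qed
  have "inv y \<otimes> (y \<otimes> w \<otimes> inv y) \<otimes> inv (inv y) = w" using assms by (simp add: m_assoc)
  with le[of y w] le[of "inv y" "y \<otimes> w \<otimes> inv y"] assms show ?thesis by simp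
qed

text \<open>Removing a reflection from a product of distinct simple reflections leaves, up to conjugation
  by a power of that product, a product of fewer distinct simple reflections; this is the
  induction that reaches every element below it.\<close>

lemma hurwitz_transitive_below:
  assumes "set ss \<subseteq> S" "distinct ss" "p \<in> carrier G" "refl_prec G refls p (word_prod G ss)"
    and "set v \<subseteq> refls" "word_prod G v = p" "length v = rlen p"
    and "set w \<subseteq> refls" "word_prod G w = p" "length w = rlen p"
  shows "(v, w) \<in> hurwitz"
  using assms
proof (induction "length ss" arbitrary: ss p v w)
  case 0
  then have "rlen p = 0" by (simp add: refl_prec_def)
  with 0 show ?case using hurwitz_refl[of "[]"] by simp
next
  case (Suc n)
  define q where "q = word_prod G ss"
  have qc: "q \<in> carrier G" using Suc.prems(1) by (simp add: q_def)
  note pc = Suc.prems(3)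
  have rq: "rlen q = length ss" unfolding q_def by (rule rlen_distinct) fact+
  have prec: "rlen p + rlen (inv p \<otimes> q) = rlen q"
    using Suc.prems(4) by (simp add: refl_prec_def q_def)
  \<comment> \<open>The complement of \<open>p\<close> is moved to its left by conjugation, which
    keeps its length; \<open>zs\<close> followed by a factorisation of \<open>p\<close> then factors
    \<open>q\<close>.\<close>
  have "rlen (p \<otimes> (inv p \<otimes> q) \<otimes> inv p) = rlen (inv p \<otimes> q)"
    using pc qc by (intro rlen_conj) simp_all
  then have rz: "rlen (q \<otimes> inv p) = rlen (inv p \<otimes> q)" using pc qc by simp
  obtain zs where zs: "set zs \<subseteq> refls" "word_prod G zs = q \<otimes> inv p" "length zs = rlen (inv p \<otimes> q)"
    using R.reduced_word[of "q \<otimes> inv p"] pc qc rz by auto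
  show ?case
  proof (cases zs)
    case Nil
    then have "p = q" using zs(2) pc qc by (metis inv_equality inv_inv inv_closed word_prod_Nil)
    then show ?thesis
      using hurwitz_simple_word[of ss v] hurwitz_simple_word[of ss w] Suc.prems rq q_def
        hurwitz_trans hurwitz_sym by metis
  next
    case (Cons t zs')
    have t: "t \<in> refls" "set zs' \<subseteq> refls" "word_prod G zs' \<in> carrier G" using zs(1) Cons by auto
    have tq: "t \<otimes> q = word_prod G zs' \<otimes> p"
    proof -
      have "q = t \<otimes> word_prod G zs' \<otimes> p" using zs(2) Cons pc qc t by (simp add: m_assoc)
      then show ?thesis using t pc by (simp add: m_assoc)
    qed
    \<comment> \<open>This equivalence with a word of simple reflections is what puts
      \<open>t\<close> into the parabolic subgroup of \<open>set ss\<close>.\<close>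
    have "(zs @ v, ss) \<in> hurwitz"
    proof (rule hurwitz_simple_word)
      show "word_prod G (zs @ v) = word_prod G ss"
        using zs Suc.prems(5,6) pc qc by (simp add: R.word_prod_gens_append m_assoc q_def)
      show "length (zs @ v) = length ss" using zs(3) Suc.prems(7) prec rq by simp
    qed (use Suc.prems zs rq q_def in auto)
    from hurwitz_parabolic[OF this Suc.prems(1)] gens_parabolic_refls[OF Suc.prems(1)] Cons
    have "t \<in> parabolic_refls (set ss)" by simp
    from coxeter_orbit_meets_inversions[OF Suc.prems(1,2) this q_def]
    obtain j :: nat where j: "inv (q [^] j) \<otimes> t \<otimes> q [^] j \<in> inversions q" by blast
    \<comment> \<open>As \<open>y\<close> commutes with \<open>q\<close>, conjugation by it carries
      \<open>t \<otimes> q\<close> to \<open>t' \<otimes> q\<close>, which by exchange is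
      \<open>ss\<close> with one letter deleted.\<close>
    define y where "y = inv (q [^] j)"
    have y: "y \<in> carrier G" "inv y = q [^] j" using qc by (simp_all add: y_def)
    define t' where "t' = y \<otimes> t \<otimes> inv y"
    have "t' = inv (q [^] j) \<otimes> t \<otimes> q [^] j" unfolding t'_def y(2) by (simp add: y_def)
    with j have "t' \<in> inversions (word_prod G ss)" by (simp add: q_def)
    then obtain a r b where ab: "ss = a @ r # b" "t' \<otimes> q = word_prod G (a @ b)"
      using inversions_exchange[OF Suc.prems(1)] unfolding q_def by metis
    have qq: "inv y \<otimes> q = q \<otimes> inv y"
      unfolding y(2) using qc by (simp add: nat_pow_Suc2[symmetric])
    have t'q: "t' \<otimes> q = y \<otimes> (t \<otimes> q) \<otimes> inv y"
      unfolding t'_def using y(1) qc t qq by (simp add: m_assoc)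
    let ?c = "\<lambda>g. y \<otimes> g \<otimes> inv y" and ?d = "\<lambda>g. inv y \<otimes> g \<otimes> inv (inv y)"
    have undo: "map ?d (map ?c ws) = ws" if "set ws \<subseteq> refls" for ws
      using that y(1) by (induction ws) (auto simp: m_assoc)
    have red: "set (map ?c ws) \<subseteq> refls" "word_prod G (map ?c ws) = ?c p"
        "length (map ?c ws) = rlen (?c p)"
      if "set ws \<subseteq> refls" "word_prod G ws = p" "length ws = rlen p" for ws
      using that y(1) pc word_prod_map_conj[of y ws] rlen_conj[of y p] by (auto simp: refls_conj subset_iff)
    \<comment> \<open>\<open>p\<close> is still below \<open>t \<otimes> q\<close>, because
      \<open>zs'\<close> is a shortest factorisation of the new complement; conjugation transports
      this to the shorter simple word.\<close>
    have "refl_prec G refls (?c p) (word_prod G (a @ b))"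
    proof -
      have "inv (?c p) \<otimes> (t' \<otimes> q) = ?c (inv p \<otimes> word_prod G zs' \<otimes> inv (inv p))"
        unfolding t'q tq using y(1) pc t by (simp add: m_assoc inv_mult_group)
      then have "rlen (inv (?c p) \<otimes> (t' \<otimes> q)) = rlen (word_prod G zs')"
        using rlen_conj[of "inv p" "word_prod G zs'"] y(1) pc t by (simp add: rlen_conj)
      moreover have "rlen (word_prod G zs') = length zs'"
        using R.reduced_append(2)[of "[t]" zs'] t Cons zs rz by simp
      moreover have "rlen (word_prod G (a @ b)) = length (a @ b)"
        using ab(1) Suc.prems(1,2) by (intro rlen_distinct) auto
      moreover have "rlen (?c p) = rlen p" using y(1) pc by (rule rlen_conj)
      ultimately show ?thesis
        unfolding refl_prec_def ab(2)[symmetric] using prec rq zs(3) Cons ab(1) by simp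
    qed
    then have "(map ?c v, map ?c w) \<in> hurwitz"
      using Suc.hyps(1)[of "a @ b" "?c p" "map ?c v" "map ?c w"] Suc.hyps(2) Suc.prems(1,2) ab(1)
        red[OF Suc.prems(5-7)] red[OF Suc.prems(8-10)] y(1) pc by auto
    from hurwitz_conj[OF this inv_closed[OF y(1)]]
    show ?thesis unfolding undo[OF Suc.prems(5)] undo[OF Suc.prems(8)] .
  qed
qed

lemma refl_neq_one: "t \<in> refls \<Longrightarrow> t \<noteq> \<one>"
  using odd_len_refl by fastforce

lemma rlen_refl: "t \<in> refls \<Longrightarrow> rlen t = 1"
  using R.len_gen_le[of t] R.len_eq_0_iff[of t] refl_neq_one[of t] by simp

text \<open>For the full set of simple reflections every \<open>t\<close> is parabolic, so some
  conjugate of \<open>t\<close> by a power of \<open>q\<close> is an inversion of \<open>q\<close>.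
  Up to that conjugation, removing \<open>t\<close> from \<open>q\<close> deletes one letter and
  lowers the reflection length by exactly one.\<close>

lemma refl_prec_coxeter:
  assumes "set ss = S" "distinct ss" "t \<in> refls"
  shows "refl_prec G refls t (word_prod G ss)"
proof -
  define q where "q = word_prod G ss"
  have qc: "q \<in> carrier G" using assms(1) by (simp add: q_def)
  have S: "set ss \<subseteq> S" using assms(1) by simp
  have "t \<in> parabolic_refls (set ss)"
    using assms(1,3) generate_gens unfolding parabolic_refls_def refls_def by simp
  from coxeter_orbit_meets_inversions[OF S assms(2) this q_def]
  obtain j :: nat where j: "inv (q [^] j) \<otimes> t \<otimes> q [^] j \<in> inversions q" by blast
  let ?t = "inv (q [^] j) \<otimes> t \<otimes> q [^] j"
  obtain a r b where ab: "ss = a @ r # b" "?t \<otimes> q = word_prod G (a @ b)"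
    using inversions_exchange[OF S, of ?t] j unfolding q_def by metis
  have qq: "q [^] j \<otimes> q = q \<otimes> q [^] j"
    using qc by (simp add: nat_pow_Suc2[symmetric])
  have "inv (q [^] j) \<otimes> (inv t \<otimes> q) \<otimes> inv (inv (q [^] j)) = ?t \<otimes> q"
    using qc assms(3) qq by (simp add: m_assoc)
  then have "rlen (inv t \<otimes> q) = rlen (word_prod G (a @ b))"
    using rlen_conj[of "inv (q [^] j)" "inv t \<otimes> q"] qc assms(3) ab(2) by simp
  also have "\<dots> = length (a @ b)"
    using ab(1) S assms(2) by (intro rlen_distinct) auto
  finally show ?thesis
    using rlen_distinct[OF S assms(2)] rlen_refl[OF assms(3)] ab(1)
    by (simp add: refl_prec_def q_def)
qed

end

section \<open>Factors of shortest factorisations\<close>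

context finite_coxeter
begin

text \<open>Write \<open>c\<close> as \<open>x y z d\<close>, where \<open>d\<close> completes
  \<open>p\<close> to \<open>c\<close>. Then \<open>inv y c\<close> is the product of
  \<open>inv y x y\<close>, \<open>z\<close> and \<open>d\<close>, and conjugation keeps the
  reflection length, so its length is at most that of \<open>x\<close>, \<open>z\<close> and
  \<open>d\<close> together; the triangle inequality gives the opposite bound.\<close>

lemma refl_prec_factor:
  assumes "set (a @ m @ b) \<subseteq> refls" "word_prod G (a @ m @ b) = p" "rlen p = length (a @ m @ b)"
    and "refl_prec G refls p c" "c \<in> carrier G"
  shows "refl_prec G refls (word_prod G m) c" "rlen (word_prod G m) = length m"
proof -
  have sub: "set a \<subseteq> refls" "set m \<subseteq> refls" "set b \<subseteq> refls" using assms(1) by auto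
  define x y z where "x = word_prod G a" and "y = word_prod G m" and "z = word_prod G b"
  have carr: "x \<in> carrier G" "y \<in> carrier G" "z \<in> carrier G"
    using sub by (simp_all add: x_def y_def z_def)
  have p: "p = x \<otimes> (y \<otimes> z)"
    using assms(2) sub by (simp add: R.word_prod_gens_append x_def y_def z_def)
  show y: "rlen (word_prod G m) = length m"
    using R.reduced_append(1)[of m b] R.reduced_append(2)[of a "m @ b"] sub assms(2,3) by simp
  define d where "d = inv p \<otimes> c"
  have d: "d \<in> carrier G" using assms(5) carr p by (simp add: d_def)
  have c: "c = p \<otimes> d" using assms(5) carr p by (simp add: d_def)
  have "inv y \<otimes> c = (inv y \<otimes> x \<otimes> inv (inv y)) \<otimes> (z \<otimes> d)"
    unfolding c p using carr d by (simp add: m_assoc)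
  then have "rlen (inv y \<otimes> c) \<le> rlen (inv y \<otimes> x \<otimes> inv (inv y)) + rlen (z \<otimes> d)"
    using R.len_mult_le[of "inv y \<otimes> x \<otimes> inv (inv y)" "z \<otimes> d"] carr d by simp
  also have "\<dots> \<le> rlen x + (rlen z + rlen d)"
    using rlen_conj[of "inv y" x] R.len_mult_le[of z d] carr d by simp
  also have "\<dots> \<le> length a + (length b + rlen d)"
    using R.len_word_prod sub by (auto simp: x_def z_def intro!: add_mono)
  finally have "rlen (inv y \<otimes> c) \<le> length a + (length b + rlen d)" .
  moreover have "rlen p + rlen d = rlen c"
    using assms(4) by (simp add: refl_prec_def d_def)
  moreover have "rlen c \<le> rlen y + rlen (inv y \<otimes> c)"
    using R.len_mult_le[of y "inv y \<otimes> c"] carr assms(5) by simp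
  ultimately show "refl_prec G refls (word_prod G m) c"
    using y assms(3) unfolding refl_prec_def y_def[symmetric] by simp
qed

lemma rlen_one_refl:
  assumes "w \<in> carrier G" "rlen w = 1"
  shows "w \<in> refls"
proof -
  obtain ws where "set ws \<subseteq> refls" "word_prod G ws = w" "length ws = rlen w"
    using R.reduced_word[OF assms(1)] by blast
  then show ?thesis using assms(2) by (cases ws) auto
qed

text \<open>Length one is excluded by parity: the Coxeter length is odd on reflections and even on a
  product of two.\<close>

lemma rlen_refl_mult_refl:
  assumes "s \<in> refls" "t \<in> refls" "s \<noteq> t"
  shows "rlen (s \<otimes> t) = 2"
proof -
  have "rlen (s \<otimes> t) \<le> 2" using R.len_word_prod[of "[s, t]"] assms by simp
  moreover have "rlen (s \<otimes> t) \<noteq> 0"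
    using assms R.len_eq_0_iff[of "s \<otimes> t"] by (metis R.gen_inv inv_equality m_closed refls_closed)
  moreover have "rlen (s \<otimes> t) \<noteq> 1"
    using rlen_one_refl[of "s \<otimes> t"] odd_len_refl[of "s \<otimes> t"] odd_len_refl[of s] odd_len_refl[of t]
      even_len_mult[of s t] assms by auto
  ultimately show ?thesis by linarith
qed

end

section \<open>The two presentations\<close>

text \<open>\<open>ss\<close> lists the simple reflections in some order; a chromatic pair supplies
  the letters of \<open>L\<close> followed by those of \<open>R\<close>.\<close>

locale dual_braid = finite_coxeter +
  fixes ss c
  assumes word: "set ss = S" "distinct ss" and c: "c = word_prod G ss"
begin

abbreviation "P \<equiv> dual_P G refls c"
abbreviation "braid_cong \<equiv> word_cong refls (dual_braid_rels G refls c)"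
abbreviation "dual_cong \<equiv> word_cong P (dual_monoid_rels G refls c)"

lemma c_closed [simp]: "c \<in> carrier G"
  using word(1) by (simp add: c)

lemma P_iff: "p \<in> P \<longleftrightarrow> p \<in> carrier G \<and> refl_prec G refls p c"
  by (simp add: dual_P_def)

lemma refls_subset_P: "refls \<subseteq> P"
proof
  fix t assume t: "t \<in> refls"
  then have "refl_prec G refls t c" unfolding c by (rule refl_prec_coxeter[OF word])
  with t show "t \<in> P" by (simp only: P_iff refls_closed)
qed

text \<open>Length and product are constant along a chain of moves, so each word on it is a shortest
  factorisation of the same element below \<open>c\<close>. By \<open>refl_prec_factor\<close> the
  two letters being moved have product below \<open>c\<close>, and the move is a dual braid
  relation.\<close>

lemma hurwitz_imp_braid_cong:
  assumes "(v, w) \<in> hurwitz" "rlen (word_prod G v) = length v" "refl_prec G refls (word_prod G v) c"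
  shows "(v, w) \<in> braid_cong"
  using assms
proof (induction rule: hurwitz_induct)
  case (refl w)
  then show ?case by (intro word_cong.refl) (simp add: lists_eq_set)
next
  case (sym v w)
  then have "(v, w) \<in> braid_cong" using hurwitz_invariants[OF sym(1)] by simp
  then show ?case by (rule word_cong.sym)
next
  case (trans u v w)
  then have "(u, v) \<in> braid_cong" "(v, w) \<in> braid_cong"
    using hurwitz_invariants[OF trans(1)] by simp_all
  then show ?case by (rule word_cong.trans)
next
  case (move s t a b)
  have "refl_prec G refls (word_prod G [s, t]) c"
    by (rule refl_prec_factor(1)[of a "[s, t]" b]) (use move in auto)
  then have "([s, t], [s \<otimes> t \<otimes> inv s, s]) \<in> dual_braid_rels G refls c"
    using move unfolding dual_braid_rels_def by auto
  moreover have "s \<otimes> t \<otimes> inv s \<in> refls" using move by (intro refls_conj) simp_all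
  ultimately show ?case
    using move by (intro word_cong.rel) (simp_all add: lists_eq_set)
qed

lemma reduced_words_braid_cong:
  assumes "p \<in> P" "set v \<subseteq> refls" "word_prod G v = p" "length v = rlen p"
    "set w \<subseteq> refls" "word_prod G w = p" "length w = rlen p"
  shows "(v, w) \<in> braid_cong"
proof (rule hurwitz_imp_braid_cong)
  show "(v, w) \<in> hurwitz"
    by (rule hurwitz_transitive_below[of ss p]) (use assms word c P_iff in auto)
qed (use assms P_iff in auto)

lemma dual_cong_factor:
  assumes "p \<in> P" "q \<in> P" "p \<otimes> q \<in> P" "rlen (p \<otimes> q) = rlen p + rlen q"
  shows "([p, q], [p \<otimes> q]) \<in> dual_cong"
proof -
  have "([p, q], [p \<otimes> q]) \<in> dual_monoid_rels G refls c"
    using assms unfolding dual_monoid_rels_def dual_P_defined_def by blast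
  from word_cong.rel[OF this, of P "[]" "[]"] assms show ?thesis by simp
qed

text \<open>Suffixes of a shortest factorisation are again below \<open>c\<close> and lengths add,
  so splitting off one reflection is a defined product in \<open>P\<close>. The empty factorisation
  needs the relation between the generator \<open>\<one>\<close> and the empty word.\<close>

lemma reduced_word_dual_cong:
  assumes "p \<in> P" "set ws \<subseteq> refls" "word_prod G ws = p" "length ws = rlen p"
  shows "([p], ws) \<in> dual_cong"
  using assms
proof (induction ws arbitrary: p)
  case Nil
  have "([\<one>], []) \<in> dual_monoid_rels G refls c" by (simp add: dual_monoid_rels_def)
  from word_cong.rel[OF this, of P "[]" "[]"] Nil show ?case by simp
next
  case (Cons t us)
  have t: "t \<in> refls" "t \<in> P" "set us \<subseteq> refls" "t \<otimes> word_prod G us = p"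
    using Cons.prems refls_subset_P by auto
  have us: "word_prod G us \<in> P" "rlen (word_prod G us) = length us"
    using refl_prec_factor[of "[t]" us "[]" p c] Cons.prems t by (auto simp: P_iff)
  have "([t, word_prod G us], [p]) \<in> dual_cong"
    using dual_cong_factor[of t "word_prod G us"] t us Cons.prems rlen_refl[OF t(1)] by simp
  moreover have "([t] @ [word_prod G us], [t] @ us) \<in> dual_cong"
    using Cons.IH[OF us(1) t(3)] us(2) t(2) by (intro word_cong_append_left) simp_all
  ultimately have "([p], [t] @ us) \<in> dual_cong"
    using word_cong.trans[OF word_cong.sym, of "[t, word_prod G us]" "[p]"] by simp
  then show ?case by simp
qed

lemma braid_cong_subset_dual_cong: "braid_cong \<subseteq> dual_cong"
proof (rule subrelI)
  fix v w assume "(v, w) \<in> braid_cong"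
  then show "(v, w) \<in> dual_cong"
  proof (induction rule: word_cong.induct)
    case (refl w)
    then show ?case using refls_subset_P by (intro word_cong.refl) (auto simp: lists_eq_set)
  next
    case (sym v w)
    from sym(2) show ?case by (rule word_cong.sym)
  next
    case (trans u v w)
    from trans(3,4) show ?case by (rule word_cong.trans)
  next
    case (rel l r a b)
    from rel(1) obtain s t where st: "s \<in> refls" "t \<in> refls" "refl_prec G refls (s \<otimes> t) c"
      and lr: "l = [s, t]" "r = [s \<otimes> t \<otimes> inv s, s]"
      unfolding dual_braid_rels_def by blast
    have st': "s \<otimes> t \<otimes> inv s \<in> refls" using st by (intro refls_conj) simp_all
    have P: "s \<in> P" "t \<in> P" "s \<otimes> t \<otimes> inv s \<in> P" "s \<otimes> t \<in> P"
      using st st' refls_subset_P by (auto simp: P_iff)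
    have "(l, r) \<in> dual_cong"
    proof (cases "s = t")
      \<comment> \<open>Here \<open>s \<otimes> t\<close> is the identity and lengths do not add, so
        the product is undefined in \<open>P\<close>; but both sides of the relation are the same
        word.\<close>
      case True
      then have "s \<otimes> t \<otimes> inv s = s" using st(1) by (simp add: m_assoc)
      then have "r = l" using lr True by simp
      moreover have "l \<in> lists P" using lr(1) P by simp
      ultimately show ?thesis using word_cong.refl by metis
    next
      case False
      have len: "rlen (s \<otimes> t) = 1 + 1" using rlen_refl_mult_refl[OF st(1,2) False] by simp
      have eq: "s \<otimes> t \<otimes> inv s \<otimes> s = s \<otimes> t" using st by (simp add: m_assoc)
      have "([s, t], [s \<otimes> t]) \<in> dual_cong"
        using P len rlen_refl st(1,2) by (intro dual_cong_factor) simp_all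
      moreover have "([s \<otimes> t \<otimes> inv s, s], [s \<otimes> t \<otimes> inv s \<otimes> s]) \<in> dual_cong"
        using P len rlen_refl[OF st(1)] rlen_refl[OF st'] eq
        by (intro dual_cong_factor) (simp_all only: eq)
      ultimately show ?thesis unfolding lr eq using word_cong.trans word_cong.sym by metis
    qed
    moreover have "a \<in> lists P" "b \<in> lists P"
      using rel(4,5) refls_subset_P by (auto simp: lists_eq_set)
    ultimately show ?case by (intro word_cong_append word_cong.refl)
  qed
qed

text \<open>Applied letter by letter, this gives the inverse of the isomorphism on words. Up to
  \<open>braid_cong\<close> the choice does not matter.\<close>

definition refl_word :: "'a \<Rightarrow> 'a list" where
  "refl_word p = (SOME ws. set ws \<subseteq> refls \<and> word_prod G ws = p \<and> length ws = rlen p)"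

lemma refl_word:
  assumes "p \<in> carrier G"
  shows "set (refl_word p) \<subseteq> refls" "word_prod G (refl_word p) = p" "length (refl_word p) = rlen p"
proof -
  have "\<exists>ws. set ws \<subseteq> refls \<and> word_prod G ws = p \<and> length ws = rlen p"
    using R.reduced_word[OF assms] by blast
  from someI_ex[OF this]
  show "set (refl_word p) \<subseteq> refls" "word_prod G (refl_word p) = p" "length (refl_word p) = rlen p"
    unfolding refl_word_def by blast+
qed

lemma refl_word_refl: "t \<in> refls \<Longrightarrow> refl_word t = [t]"
  using refl_word[of t] rlen_refl[of t] by (cases "refl_word t") auto

text \<open>When a product is defined lengths add, so the words chosen for \<open>p\<close> and
  \<open>q\<close> concatenate to a shortest factorisation of \<open>p \<otimes> q\<close>, and
  \<open>reduced_words_braid_cong\<close> compares it with the chosen one.\<close>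

lemma dual_cong_imp_braid_cong:
  assumes "(v, w) \<in> dual_cong"
  shows "(concat (map refl_word v), concat (map refl_word w)) \<in> braid_cong"
  using assms
proof (induction rule: word_cong.induct)
  case (refl w)
  then show ?case
    using refl_word(1) by (intro word_cong.refl) (fastforce simp: lists_eq_set P_iff)
next
  case (sym v w)
  from sym(2) show ?case by (rule word_cong.sym)
next
  case (trans u v w)
  from trans(3,4) show ?case by (rule word_cong.trans)
next
  case (rel l r a b)
  have lists: "concat (map refl_word x) \<in> lists refls" if "x \<in> lists P" for x
    using that refl_word(1) by (fastforce simp: lists_eq_set P_iff)
  from rel(1) consider p q where "dual_P_defined G refls c p q" "l = [p, q]" "r = [p \<otimes> q]"
    | "l = [\<one>]" "r = []"
    unfolding dual_monoid_rels_def by blast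
  then have "(concat (map refl_word l), concat (map refl_word r)) \<in> braid_cong"
  proof cases
    case 1
    then have pq: "p \<in> P" "q \<in> P" "p \<otimes> q \<in> P" "rlen (p \<otimes> q) = rlen p + rlen q"
      by (simp_all add: dual_P_defined_def)
    then have carr: "p \<in> carrier G" "q \<in> carrier G" "p \<otimes> q \<in> carrier G" by (simp_all add: P_iff)
    have "(refl_word p @ refl_word q, refl_word (p \<otimes> q)) \<in> braid_cong"
      using pq refl_word[OF carr(1)] refl_word[OF carr(2)] refl_word[OF carr(3)]
      by (intro reduced_words_braid_cong[OF pq(3)]) (simp_all add: R.word_prod_gens_append)
    with 1 show ?thesis by simp
  next
    case 2
    have "refl_word \<one> = []" using refl_word(3)[of \<one>] by simp
    with 2 show ?thesis by (simp add: word_cong.refl)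
  qed
  with lists[OF rel(4)] lists[OF rel(5)] show ?case
    by (simp only: map_append concat_append) (intro word_cong_append word_cong.refl)
qed

lemma concat_refl_word: "set w \<subseteq> refls \<Longrightarrow> concat (map refl_word w) = w"
  by (induction w) (simp_all add: refl_word_refl)

lemma dual_cong_concat_refl_word:
  assumes "set w \<subseteq> P"
  shows "(w, concat (map refl_word w)) \<in> dual_cong"
  using assms
proof (induction w)
  case Nil
  show ?case by (simp add: word_cong.refl)
next
  case (Cons p w)
  then have "p \<in> P" "p \<in> carrier G" by (simp_all add: P_iff)
  then have "([p], refl_word p) \<in> dual_cong"
    using refl_word by (intro reduced_word_dual_cong) simp_all
  with Cons show ?case using word_cong_append[of "[p]" "refl_word p" P _ w] by simp
qed

text \<open>A class of words in reflections is sent to the class over \<open>P\<close> that contains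
  it. Injectivity holds since replacing letters by their \<open>refl_word\<close> leaves words in
  reflections unchanged, surjectivity since it does not change the class of a word over
  \<open>P\<close>. The unit is stated separately because \<open>iso\<close> speaks only of
  multiplication and bijectivity.\<close>

theorem braid_presentation_iso:
  shows "\<exists>\<phi> \<in> iso (presented_monoid refls (dual_braid_rels G refls c)) (dual_braid_monoid G refls c).
    \<phi> \<one>\<^bsub>presented_monoid refls (dual_braid_rels G refls c)\<^esub> = \<one>\<^bsub>dual_braid_monoid G refls c\<^esub> \<and>
    (\<forall>t\<in>refls. \<phi> (word_class refls (dual_braid_rels G refls c) [t])
          = word_class P (dual_monoid_rels G refls c) [t])"
proof -
  let ?R1 = "dual_braid_rels G refls c" and ?R2 = "dual_monoid_rels G refls c"
  let ?M1 = "presented_monoid refls ?R1" and ?M2 = "presented_monoid P ?R2"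
  let ?c1 = "word_class refls ?R1" and ?c2 = "word_class P ?R2"
  have lists: "w \<in> lists P" if "w \<in> lists refls" for w
    using that refls_subset_P by (auto simp: lists_eq_set)
  define \<phi> where "\<phi> A = dual_cong `` A" for A
  have \<phi>: "\<phi> (?c1 w) = ?c2 w" if w: "w \<in> lists refls" for w
  proof
    show "\<phi> (?c1 w) \<subseteq> ?c2 w"
      using braid_cong_subset_dual_cong word_cong.trans[of w _ P ?R2]
      unfolding \<phi>_def word_class_def by blast
    have "w \<in> ?c1 w" using w by (simp add: word_class_def word_cong.refl)
    then show "?c2 w \<subseteq> \<phi> (?c1 w)" unfolding \<phi>_def word_class_def by blast
  qed
  have closed: "\<phi> A \<in> carrier ?M2" if "A \<in> carrier ?M1" for A
  proof -
    obtain v where "v \<in> lists refls" "A = ?c1 v"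
      using \<open>A \<in> carrier ?M1\<close> unfolding presented_monoid_carrier by blast
    then show ?thesis unfolding presented_monoid_carrier using \<phi> lists by blast
  qed
  have "\<phi> \<in> hom ?M1 ?M2"
  proof (rule homI)
    fix A assume "A \<in> carrier ?M1"
    then show "\<phi> A \<in> carrier ?M2" by (rule closed)
  next
    fix A B assume "A \<in> carrier ?M1" "B \<in> carrier ?M1"
    then obtain v w where vw: "v \<in> lists refls" "A = ?c1 v" "w \<in> lists refls" "B = ?c1 w"
      unfolding presented_monoid_carrier by blast
    then have "v @ w \<in> lists refls" by (simp add: lists_eq_set)
    with vw show "\<phi> (A \<otimes>\<^bsub>?M1\<^esub> B) = \<phi> A \<otimes>\<^bsub>?M2\<^esub> \<phi> B"
      by (simp only: presented_monoid_mult \<phi> lists)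
  qed
  moreover have "inj_on \<phi> (carrier ?M1)"
  proof (rule inj_onI)
    fix A B assume "A \<in> carrier ?M1" "B \<in> carrier ?M1" and eq: "\<phi> A = \<phi> B"
    then obtain v w where vw: "v \<in> lists refls" "A = ?c1 v" "w \<in> lists refls" "B = ?c1 w"
      unfolding presented_monoid_carrier by blast
    with eq \<phi> have "?c2 v = ?c2 w" by simp
    then have "(v, w) \<in> dual_cong"
      unfolding word_class_def by (rule eq_equiv_class[OF _ equiv_word_cong]) (rule lists[OF vw(3)])
    from dual_cong_imp_braid_cong[OF this] have "(v, w) \<in> braid_cong"
      using vw(1,3) by (simp add: concat_refl_word lists_eq_set)
    from equiv_class_eq[OF equiv_word_cong this] show "A = B"
      unfolding vw word_class_def .
  qed
  moreover have "\<phi> ` carrier ?M1 = carrier ?M2"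
  proof
    show "\<phi> ` carrier ?M1 \<subseteq> carrier ?M2" using closed by blast
    show "carrier ?M2 \<subseteq> \<phi> ` carrier ?M1"
    proof
      fix B assume "B \<in> carrier ?M2"
      then obtain w where w: "w \<in> lists P" "B = ?c2 w" unfolding presented_monoid_carrier by blast
      let ?v = "concat (map refl_word w)"
      have "set ?v \<subseteq> refls" using w(1) refl_word(1) by (fastforce simp: lists_eq_set P_iff)
      then have v: "?v \<in> lists refls" by (simp add: lists_eq_set)
      have "(w, ?v) \<in> dual_cong" using w(1) by (intro dual_cong_concat_refl_word) (simp add: lists_eq_set)
      from equiv_class_eq[OF equiv_word_cong this] have "?c2 w = ?c2 ?v"
        unfolding word_class_def .
      then have "B = \<phi> (?c1 ?v)" using \<phi>[OF v] w(2) by simp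
      then show "B \<in> \<phi> ` carrier ?M1" using v unfolding presented_monoid_carrier by blast
    qed
  qed
  ultimately have "\<phi> \<in> iso ?M1 ?M2" by (simp add: iso_def bij_betw_def)
  moreover have "\<phi> \<one>\<^bsub>?M1\<^esub> = \<one>\<^bsub>?M2\<^esub>"
    using \<phi>[of "[]"] by (simp add: presented_monoid_one)
  moreover have "\<phi> (?c1 [t]) = ?c2 [t]" if "t \<in> refls" for t
    using \<phi>[of "[t]"] that by simp
  ultimately show ?thesis unfolding dual_braid_monoid_def by blast
qed

end

section \<open>Reflections in a finite linear group\<close>

text \<open>A real vector space is not a finite union of hyperplanes: along the line
  \<open>u + e w\<close> each functional excludes at most one value of \<open>e\<close>.\<close>

lemma functionals_common_nonzero:
  fixes F :: "('v::real_vector \<Rightarrow> real) set"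
  assumes "finite F" "subspace U" "\<And>\<phi>. \<phi> \<in> F \<Longrightarrow> linear \<phi> \<and> (\<exists>u\<in>U. \<phi> u \<noteq> 0)"
  shows "\<exists>u\<in>U. \<forall>\<phi>\<in>F. \<phi> u \<noteq> 0"
  using assms(1,3)
proof (induction F)
  case empty
  show ?case using subspace_0[OF assms(2)] by auto
next
  case (insert \<psi> F)
  then obtain u where u: "u \<in> U" "\<And>\<phi>. \<phi> \<in> F \<Longrightarrow> \<phi> u \<noteq> 0" by auto
  obtain w where w: "w \<in> U" "\<psi> w \<noteq> 0" using insert.prems by blast
  have lin: "\<phi> (u + e *\<^sub>R w) = \<phi> u + e * \<phi> w" if "\<phi> \<in> insert \<psi> F" for \<phi> e
    using insert.prems[OF that] by (auto simp: linear_add linear_scale)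
  let ?bad = "(\<lambda>\<phi>. - \<phi> u / \<phi> w) ` insert \<psi> F"
  have "finite (insert 0 ?bad)" using insert.hyps(1) by simp
  then obtain e where e: "e \<notin> insert 0 ?bad"
    using ex_new_if_finite[OF infinite_UNIV_char_0] by blast
  have "\<phi> (u + e *\<^sub>R w) \<noteq> 0" if \<phi>: "\<phi> \<in> insert \<psi> F" for \<phi>
  proof (cases "\<phi> w = 0")
    case True
    then have "\<phi> \<in> F" using \<phi> w(2) by auto
    then show ?thesis using u(2) True lin[OF \<phi>] by simp
  next
    case False
    have "e \<noteq> - \<phi> u / \<phi> w" using e \<phi> by auto
    then show ?thesis using False lin[OF \<phi>] by (auto simp: field_simps)
  qed
  moreover have "u + e *\<^sub>R w \<in> U" using u(1) w(1) assms(2) by (simp add: subspace_add subspace_scale)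
  ultimately show ?case by blast
qed

lemma linear_functional_multiple:
  fixes \<phi> \<psi> :: "'v::real_vector \<Rightarrow> real"
  assumes "linear \<phi>" "linear \<psi>" "\<phi> x \<noteq> 0" "\<And>v. \<phi> v = 0 \<Longrightarrow> \<psi> v = 0"
  shows "\<psi> v = \<psi> x / \<phi> x * \<phi> v"
proof -
  have "\<phi> (v - (\<phi> v / \<phi> x) *\<^sub>R x) = 0"
    using assms(1,3) by (simp add: linear_diff linear_scale)
  then have "\<psi> (v - (\<phi> v / \<phi> x) *\<^sub>R x) = 0" by (rule assms(4))
  then show ?thesis using assms(2) by (simp add: linear_diff linear_scale)
qed

text \<open>Reflections are described by a functional and a vector, with no condition on the
  value of one at the other: it is \<open>2\<close> because the group is finite.\<close>

locale finite_linear_group = group +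
  fixes \<rho> :: "'a \<Rightarrow> 'v::real_vector \<Rightarrow> 'v"
  assumes finite_carrier: "finite (carrier G)"
    and rho_mult: "x \<in> carrier G \<Longrightarrow> y \<in> carrier G \<Longrightarrow> \<rho> (x \<otimes> y) v = \<rho> x (\<rho> y v)"
    and rho_one: "\<rho> \<one> v = v"
    and rho_linear: "x \<in> carrier G \<Longrightarrow> linear (\<rho> x)"
    and rho_inj: "x \<in> carrier G \<Longrightarrow> y \<in> carrier G \<Longrightarrow> (\<And>v. \<rho> x v = \<rho> y v) \<Longrightarrow> x = y"
begin

definition reflections :: "'a set" where
  "reflections = {t \<in> carrier G. \<exists>f a. linear f \<and> (\<exists>x. f x \<noteq> 0) \<and> a \<noteq> 0 \<and> (\<forall>v. \<rho> t v = v - f v *\<^sub>R a)}"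

text \<open>A linear form cutting out the reflecting hyperplane. Its scalar is chosen arbitrarily,
  so conjugation formulas for it hold only up to constants.\<close>

definition functional :: "'a \<Rightarrow> 'v \<Rightarrow> real" where
  "functional t = (SOME f. linear f \<and> (\<exists>x. f x \<noteq> 0) \<and> (\<exists>a. a \<noteq> 0 \<and> (\<forall>v. \<rho> t v = v - f v *\<^sub>R a)))"

lemma reflections_closed [simp]: "t \<in> reflections \<Longrightarrow> t \<in> carrier G"
  by (simp add: reflections_def)

text \<open>The vector \<open>a\<close> has eigenvalue \<open>\<mu> = 1 - functional t a\<close>, a
  real root of unity. The value 1 would make \<open>t\<close> a transvection, whose powers shift
  \<open>x\<close> by ever larger multiples of \<open>a\<close>, against finite order; so
  \<open>\<mu>\<close> is -1.\<close>

lemma reflectionE: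
  assumes "t \<in> reflections"
  obtains a x where "linear (functional t)" "functional t x \<noteq> 0" "a \<noteq> 0"
    "\<And>v. \<rho> t v = v - functional t v *\<^sub>R a" "functional t a = 2"
proof -
  have "\<exists>f. linear f \<and> (\<exists>x. f x \<noteq> 0) \<and> (\<exists>a. a \<noteq> 0 \<and> (\<forall>v. \<rho> t v = v - f v *\<^sub>R a))"
    using assms unfolding reflections_def by blast
  then have "linear (functional t) \<and> (\<exists>x. functional t x \<noteq> 0) \<and>
      (\<exists>a. a \<noteq> 0 \<and> (\<forall>v. \<rho> t v = v - functional t v *\<^sub>R a))"
    unfolding functional_def by (rule someI_ex)
  then obtain a x where *: "linear (functional t)" "functional t x \<noteq> 0" "a \<noteq> 0"
    and t: "\<And>v. \<rho> t v = v - functional t v *\<^sub>R a"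
    by blast
  define \<mu> where "\<mu> = 1 - functional t a"
  define N where "N = ord t"
  have N: "N > 0" unfolding N_def using ord_ge_1[OF finite_carrier, of t] assms by simp
  have pow: "\<rho> (t [^] n) = \<rho> t ^^ n" for n :: nat
  proof (induction n)
    case (Suc n)
    have "\<rho> (t [^] Suc n) v = \<rho> t (\<rho> (t [^] n) v)" for v
      using assms nat_pow_Suc2[of t n] by (simp add: rho_mult del: nat_pow_Suc)
    then show ?case using Suc by auto
  qed (simp add: rho_one fun_eq_iff)
  then have period: "(\<rho> t ^^ N) v = v" for v
    using rho_one assms pow_ord_eq_1[of t] unfolding N_def by (metis reflections_closed)
  have "(\<rho> t ^^ n) a = \<mu> ^ n *\<^sub>R a" for n
    by (induction n) (simp_all add: t *(1) linear_scale \<mu>_def algebra_simps)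
  with period[of a] have "\<mu> ^ N *\<^sub>R a = 1 *\<^sub>R a" by simp
  then have "\<mu> ^ N = 1" using *(3) by (metis scaleR_cancel_right)
  with N have "\<bar>\<mu>\<bar> = 1" using power_eq_1_iff[of \<mu> N] by simp
  moreover have "\<mu> \<noteq> 1"
  proof
    assume "\<mu> = 1"
    then have f: "functional t a = 0" by (simp add: \<mu>_def)
    have "(\<rho> t ^^ n) x = x - (real n * functional t x) *\<^sub>R a" for n
    proof (induction n)
      case (Suc n)
      have "(\<rho> t ^^ Suc n) x = \<rho> t (x - (real n * functional t x) *\<^sub>R a)"
        using Suc by simp
      also have "\<dots> = x - (real (Suc n) * functional t x) *\<^sub>R a"
        unfolding t using *(1) f by (simp add: linear_diff linear_scale algebra_simps)
      finally show ?case .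
    qed simp
    with period[of x] have "(real N * functional t x) *\<^sub>R a = 0" by simp
    with N *(2,3) show False by simp
  qed
  ultimately have "functional t a = 2" unfolding \<mu>_def by linarith
  from that[OF * t this] show ?thesis .
qed

lemma reflections_conj:
  assumes "t \<in> reflections" "g \<in> carrier G"
  shows "g \<otimes> t \<otimes> inv g \<in> reflections"
proof -
  obtain a x where t: "linear (functional t)" "functional t x \<noteq> 0" "a \<noteq> 0"
    "\<And>v. \<rho> t v = v - functional t v *\<^sub>R a"
    using reflectionE[OF assms(1)] by metis
  have inv: "\<rho> g (\<rho> (inv g) v) = v" "\<rho> (inv g) (\<rho> g v) = v" for v
    using assms(2) by (simp_all add: rho_one flip: rho_mult)
  let ?f = "\<lambda>v. functional t (\<rho> (inv g) v)"
  have "linear ?f"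
    using linear_compose[OF rho_linear[of "inv g"] t(1)] assms(2) by (simp add: comp_def)
  moreover have "?f (\<rho> g x) \<noteq> 0" using t(2) by (simp add: inv)
  moreover have "\<rho> g a \<noteq> 0"
    using inv(2)[of a] t(3) linear_0[OF rho_linear[of "inv g"]] assms(2) by fastforce
  moreover have "\<rho> (g \<otimes> t \<otimes> inv g) v = v - ?f v *\<^sub>R \<rho> g a" for v
    using assms t(4) rho_linear[OF assms(2)] by (simp add: rho_mult inv linear_diff linear_scale)
  ultimately show ?thesis using assms unfolding reflections_def by blast
qed

text \<open>The two functionals are proportional, so \<open>s \<otimes> r\<close> is a transvection
  in a direction \<open>e\<close> inside the common hyperplane. Finite order forces
  \<open>e = 0\<close>, which makes \<open>a\<close> the matching multiple of
  \<open>b\<close>.\<close>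

lemma reflection_eqI:
  assumes "s \<in> reflections" "r \<in> reflections" "\<And>v. functional s v = 0 \<Longrightarrow> functional r v = 0"
  shows "s = r"
proof -
  obtain a x where s: "linear (functional s)" "functional s x \<noteq> 0"
    "\<And>v. \<rho> s v = v - functional s v *\<^sub>R a" "functional s a = 2"
    using reflectionE[OF assms(1)] by metis
  obtain b y where r: "linear (functional r)" "functional r y \<noteq> 0"
    "\<And>v. \<rho> r v = v - functional r v *\<^sub>R b" "functional r b = 2"
    using reflectionE[OF assms(2)] by metis
  define k where "k = functional r x / functional s x"
  have k: "functional r v = k * functional s v" for v
    unfolding k_def by (rule linear_functional_multiple[OF s(1) r(1) s(2) assms(3)])
  define e where "e = a - k *\<^sub>R b"
  have e: "functional s e = 0"
    using s(1,4) r(4) k[of b] by (simp add: e_def linear_diff linear_scale)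
  have kb: "k * (functional s b * c) = c + c" for c
    using r(4) k[of b] by (simp add: mult.assoc[symmetric])
  have sr: "\<rho> (s \<otimes> r) v = v + functional s v *\<^sub>R e" for v
    using assms(1,2) s(1,4) r(4) k[of b]
    by (simp add: rho_mult s(3) r(3) k linear_diff linear_scale e_def algebra_simps kb)
  define N where "N = ord (s \<otimes> r)"
  have N: "N > 0" unfolding N_def using ord_ge_1[OF finite_carrier, of "s \<otimes> r"] assms by simp
  have "\<rho> ((s \<otimes> r) [^] n) x = x + (real n * functional s x) *\<^sub>R e" for n :: nat
  proof (induction n)
    case (Suc n)
    have "\<rho> ((s \<otimes> r) [^] Suc n) x = \<rho> (s \<otimes> r) (\<rho> ((s \<otimes> r) [^] n) x)"
      using assms(1,2) nat_pow_Suc2[of "s \<otimes> r" n] by (simp add: rho_mult del: nat_pow_Suc)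
    then show ?case
      using Suc s(1) e by (simp add: sr linear_add linear_scale algebra_simps)
  qed (simp add: rho_one)
  from this[of N] have "x = x + (real N * functional s x) *\<^sub>R e"
    using assms(1,2) by (simp add: N_def rho_one)
  with N s(2) have "e = 0" by simp
  then have "a = k *\<^sub>R b" by (simp add: e_def)
  then have "\<rho> s v = \<rho> r v" for v by (simp add: s(3) r(3) k)
  then show ?thesis using assms by (intro rho_inj) auto
qed

section \<open>Discriminants of conjugation-stable sets of reflections\<close>

definition discriminant :: "'a set \<Rightarrow> 'v \<Rightarrow> real" where
  "discriminant Q v = (\<Prod>r\<in>Q. functional r v)"

lemma functional_conj:
  assumes "r \<in> reflections" "g \<in> carrier G"
  shows "\<exists>k. \<forall>v. functional r (\<rho> g v) = k * functional (inv g \<otimes> r \<otimes> g) v"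
proof -
  let ?r = "inv g \<otimes> r \<otimes> g"
  have r': "?r \<in> reflections" using reflections_conj[OF assms(1), of "inv g"] assms(2) by simp
  obtain a where r: "linear (functional r)" "a \<noteq> 0" "\<And>v. \<rho> r v = v - functional r v *\<^sub>R a"
    using reflectionE[OF assms(1)] by metis
  obtain b y where b: "linear (functional ?r)" "functional ?r y \<noteq> 0"
    "\<And>v. \<rho> ?r v = v - functional ?r v *\<^sub>R b"
    using reflectionE[OF r'] by metis
  have lin: "linear (\<lambda>v. functional r (\<rho> g v))"
    using linear_compose[OF rho_linear[OF assms(2)] r(1)] by (simp add: comp_def)
  have zero: "functional r (\<rho> g v) = 0" if "functional ?r v = 0" for v
  proof -
    have "\<rho> ?r v = v" using that b(3) by simp
    then have "\<rho> g (\<rho> ?r v) = \<rho> g v" by simp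
    moreover have "\<rho> g (\<rho> ?r v) = \<rho> r (\<rho> g v)"
      using assms r' by (simp add: m_assoc flip: rho_mult)
    ultimately show ?thesis using r(2,3) by simp
  qed
  show ?thesis
    using linear_functional_multiple[OF b(1) lin b(2) zero] by blast
qed

text \<open>Composition with \<open>g\<close> permutes the reflecting hyperplanes of
  \<open>Q\<close>, hence permutes the factors up to scalars.\<close>

lemma discriminant_scale:
  assumes "Q \<subseteq> reflections" "\<And>r g. r \<in> Q \<Longrightarrow> g \<in> carrier G \<Longrightarrow> g \<otimes> r \<otimes> inv g \<in> Q"
    and g: "g \<in> carrier G"
  shows "\<exists>k. \<forall>v. discriminant Q (\<rho> g v) = k * discriminant Q v"
proof -
  have "\<forall>r\<in>Q. \<exists>k. \<forall>v. functional r (\<rho> g v) = k * functional (inv g \<otimes> r \<otimes> g) v"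
    using functional_conj assms(1) g by blast
  then obtain k where k: "\<And>r v. r \<in> Q \<Longrightarrow> functional r (\<rho> g v) = k r * functional (inv g \<otimes> r \<otimes> g) v"
    by metis
  have "discriminant Q (\<rho> g v) = (\<Prod>r\<in>Q. k r) * discriminant Q v" for v
  proof -
    have "(\<Prod>r\<in>Q. functional (inv g \<otimes> r \<otimes> g) v) = (\<Prod>r\<in>Q. functional r v)"
    proof (rule prod.reindex_bij_witness[of _ "\<lambda>r. g \<otimes> r \<otimes> inv g" "\<lambda>r. inv g \<otimes> r \<otimes> g"])
      fix r assume r: "r \<in> Q"
      then have rc: "r \<in> carrier G" using assms(1) by auto
      show "inv g \<otimes> r \<otimes> g \<in> Q" using assms(2)[OF r inv_closed[OF g]] g by simp
      show "g \<otimes> r \<otimes> inv g \<in> Q" using assms(2)[OF r g] .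
      show "g \<otimes> (inv g \<otimes> r \<otimes> g) \<otimes> inv g = r" "inv g \<otimes> (g \<otimes> r \<otimes> inv g) \<otimes> g = r"
        using rc g by (simp_all add: m_assoc)
    qed simp
    then show ?thesis unfolding discriminant_def by (simp add: k prod.distrib)
  qed
  then show ?thesis by blast
qed

lemma discriminant_nonzero:
  assumes "Q \<subseteq> reflections" "subspace U" "\<And>r. r \<in> Q \<Longrightarrow> \<exists>u\<in>U. functional r u \<noteq> 0"
  shows "\<exists>u\<in>U. discriminant Q u \<noteq> 0"
proof -
  have fin: "finite Q"
    using assms(1) finite_carrier by (meson finite_subset reflections_closed subset_iff)
  have "\<exists>u\<in>U. \<forall>\<phi>\<in>functional ` Q. \<phi> u \<noteq> 0"
  proof (rule functionals_common_nonzero[OF _ assms(2)])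
    show "finite (functional ` Q)" using fin by simp
    fix \<phi> assume "\<phi> \<in> functional ` Q"
    then obtain r where r: "r \<in> Q" "\<phi> = functional r" by blast
    then have "linear \<phi>" using reflectionE assms(1) by blast
    with r assms(3) show "linear \<phi> \<and> (\<exists>u\<in>U. \<phi> u \<noteq> 0)" by blast
  qed
  then show ?thesis using fin by (auto simp: discriminant_def)
qed

text \<open>The factor is read off at a point \<open>u\<close> on the hyperplane of \<open>t\<close>
  and on no other hyperplane of \<open>Q\<close>. If \<open>t \<notin> Q\<close>, the discriminant
  is nonzero at the fixed point \<open>u\<close>, so the factor is 1. If \<open>t \<in> Q\<close>,
  it vanishes at \<open>u\<close>; but \<open>t\<close> maps \<open>u + \<epsilon> a\<close> to
  \<open>u - \<epsilon> a\<close>, and dividing out the form of \<open>t\<close>, with values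
  \<open>2 * \<epsilon>\<close> and \<open>- 2 * \<epsilon>\<close> there, leaves -1 in the
  limit.\<close>

lemma discriminant_sign:
  assumes Q: "Q \<subseteq> reflections" "\<And>r g. r \<in> Q \<Longrightarrow> g \<in> carrier G \<Longrightarrow> g \<otimes> r \<otimes> inv g \<in> Q"
    and t: "t \<in> reflections"
  shows "discriminant Q (\<rho> t v) = (if t \<in> Q then - 1 else 1) * discriminant Q v"
proof -
  obtain a where a: "linear (functional t)" "\<And>v. \<rho> t v = v - functional t v *\<^sub>R a" "functional t a = 2"
    using reflectionE[OF t] by metis
  obtain k where k: "\<And>v. discriminant Q (\<rho> t v) = k * discriminant Q v"
    using discriminant_scale[OF Q reflections_closed[OF t]] by blast
  define U where "U = {v. functional t v = 0}"
  have U: "subspace U" 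
    unfolding U_def subspace_def using a(1) by (simp add: linear_0 linear_add linear_scale)
  have "\<exists>u\<in>U. functional r u \<noteq> 0" if r: "r \<in> Q - {t}" for r
    using reflection_eqI[OF t, of r] r Q(1) unfolding U_def by blast
  then obtain u where u: "functional t u = 0" "discriminant (Q - {t}) u \<noteq> 0"
    using discriminant_nonzero[of "Q - {t}" U] U Q(1) unfolding U_def by blast
  have "k = (if t \<in> Q then - 1 else 1)"
  proof (cases "t \<in> Q")
    case False
    then have "discriminant Q u \<noteq> 0" using u(2) by simp
    moreover have "\<rho> t u = u" using a(2) u(1) by simp
    ultimately show ?thesis using k[of u] False by simp
  next
    case True
    have fin: "finite Q"
      using Q(1) finite_carrier by (meson finite_subset reflections_closed subset_iff)
    have split: "discriminant Q v = functional t v * discriminant (Q - {t}) v" for v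
      unfolding discriminant_def using fin True by (simp add: prod.remove)
    let ?D = "\<lambda>\<epsilon>. discriminant (Q - {t}) (u + \<epsilon> *\<^sub>R a)"
    have D: "?D = (\<lambda>\<epsilon>. \<Prod>r\<in>Q-{t}. functional r u + \<epsilon> * functional r a)"
    proof
      fix \<epsilon>
      have "functional r (u + \<epsilon> *\<^sub>R a) = functional r u + \<epsilon> * functional r a" if "r \<in> Q - {t}" for r
      proof -
        have "linear (functional r)" using reflectionE that Q(1) by blast
        then show ?thesis by (simp add: linear_add linear_scale)
      qed
      then show "?D \<epsilon> = (\<Prod>r\<in>Q-{t}. functional r u + \<epsilon> * functional r a)"
        unfolding discriminant_def by (rule prod.cong[OF HOL.refl])
    qed
    have eq: "- ?D (- \<epsilon>) = k * ?D \<epsilon>" if "\<epsilon> \<noteq> 0" for \<epsilon>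
    proof -
      have f: "functional t (u + \<delta> *\<^sub>R a) = 2 * \<delta>" for \<delta>
        using a(1,3) u(1) by (simp add: linear_add linear_scale)
      have "\<rho> t (u + \<epsilon> *\<^sub>R a) = u + (- \<epsilon>) *\<^sub>R a"
        unfolding a(2) f add_diff_eq[symmetric] scaleR_left_diff_distrib[symmetric] by simp
      with k[of "u + \<epsilon> *\<^sub>R a"]
      have "discriminant Q (u + (- \<epsilon>) *\<^sub>R a) = k * discriminant Q (u + \<epsilon> *\<^sub>R a)"
        by metis
      then have "2 * (- \<epsilon>) * ?D (- \<epsilon>) = k * (2 * \<epsilon> * ?D \<epsilon>)"
        unfolding split[of "u + (- \<epsilon>) *\<^sub>R a"] split[of "u + \<epsilon> *\<^sub>R a"] f .
      moreover have "- p = k * q" if "2 * (- \<epsilon>) * p = k * (2 * \<epsilon> * q)" for p q :: real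
      proof -
        have "2 * \<epsilon> * (- p) = 2 * \<epsilon> * (k * q)" using that by (simp add: mult.left_commute)
        moreover have "2 * \<epsilon> \<noteq> 0" using \<open>\<epsilon> \<noteq> 0\<close> by simp
        ultimately show ?thesis by (rule mult_left_cancel[THEN iffD1, rotated])
      qed
      ultimately show ?thesis by blast
    qed
    \<comment> \<open>The identity is available only for \<open>\<epsilon> \<noteq> 0\<close>, where
      the form of \<open>t\<close> can be cancelled; continuity of the product carries it to
      0.\<close>
    define d where "d \<epsilon> = (\<Prod>r\<in>Q-{t}. functional r u + \<epsilon> * functional r a)" for \<epsilon>
    have Dd: "?D \<epsilon> = d \<epsilon>" for \<epsilon> using fun_cong[OF D, of \<epsilon>] unfolding d_def .
    have "((\<lambda>\<epsilon>. - d (- \<epsilon>) - k * d \<epsilon>) \<longlongrightarrow> - d (- 0) - k * d 0) (at 0)"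
      unfolding d_def by (intro tendsto_intros)
    moreover have "((\<lambda>\<epsilon>. - d (- \<epsilon>) - k * d \<epsilon>) \<longlongrightarrow> 0) (at 0)"
    proof (rule tendsto_eventually)
      have "- d (- \<epsilon>) = k * d \<epsilon>" if "\<epsilon> \<noteq> 0" for \<epsilon> using eq[OF that] unfolding Dd .
      then show "\<forall>\<^sub>F \<epsilon> in at 0. - d (- \<epsilon>) - k * d \<epsilon> = 0"
        unfolding eventually_at by (intro exI[of _ 1]) auto
    qed
    ultimately have "- d (- 0) - k * d 0 = 0"
      by (rule tendsto_unique[OF trivial_limit_at])
    then have "- d 0 = k * d 0" by simp
    then have "(- 1) * discriminant (Q - {t}) u = k * discriminant (Q - {t}) u"
      using Dd[of 0] by simp
    then have "- 1 = k" using u(2) by (rule mult_right_cancel[THEN iffD1, rotated])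
    then show ?thesis using True by simp
  qed
  with k show ?thesis by simp
qed

lemma discriminant_word:
  assumes Q: "Q \<subseteq> reflections" "\<And>r g. r \<in> Q \<Longrightarrow> g \<in> carrier G \<Longrightarrow> g \<otimes> r \<otimes> inv g \<in> Q"
    and "set ws \<subseteq> Q"
  shows "discriminant Q (\<rho> (word_prod G ws) v) = (- 1) ^ length ws * discriminant Q v"
  using assms(3)
proof (induction ws)
  case (Cons s ws)
  have s: "s \<in> reflections" "set ws \<subseteq> carrier G" using Cons.prems Q(1) reflections_closed by auto
  have "discriminant Q (\<rho> (word_prod G (s # ws)) v) = discriminant Q (\<rho> s (\<rho> (word_prod G ws) v))"
    using s by (simp add: rho_mult)
  with Cons discriminant_sign[OF Q s(1)] show ?case by simp
qed (simp add: rho_one)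

text \<open>Each reflection changes the sign of the discriminant of all reflections, so it has odd length
  in the generators; a reflection not conjugate to a generator would preserve the discriminant of
  the conjugates of the generators and hence have even length.\<close>

theorem reflection_conj_generator:
  assumes S: "S \<subseteq> reflections" and word: "set ws \<subseteq> S" "word_prod G ws = t" and t: "t \<in> reflections"
  shows "\<exists>x\<in>carrier G. \<exists>s\<in>S. t = x \<otimes> s \<otimes> inv x"
proof (rule ccontr)
  define C where "C = {x \<otimes> s \<otimes> inv x | x s. x \<in> carrier G \<and> s \<in> S}"
  assume "\<not> ?thesis"
  then have tC: "t \<notin> C" unfolding C_def by blast
  have C: "C \<subseteq> reflections" unfolding C_def using reflections_conj S by blast
  have C_conj: "g \<otimes> r \<otimes> inv g \<in> C" if "r \<in> C" "g \<in> carrier G" for r g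
  proof -
    obtain x s where x: "r = x \<otimes> s \<otimes> inv x" "x \<in> carrier G" "s \<in> S"
      using \<open>r \<in> C\<close> unfolding C_def by blast
    then have "g \<otimes> r \<otimes> inv g = (g \<otimes> x) \<otimes> s \<otimes> inv (g \<otimes> x)"
      using that(2) S by (auto simp: m_assoc inv_mult_group subset_iff)
    with x that(2) show ?thesis unfolding C_def by blast
  qed
  have "S \<subseteq> C"
  proof
    fix s assume s: "s \<in> S"
    then have "s = \<one> \<otimes> s \<otimes> inv \<one>" using S by auto
    with s show "s \<in> C" unfolding C_def by blast
  qed
  then have wordC: "set ws \<subseteq> C" using word by blast
  have nonzero: "\<exists>u. discriminant Q u \<noteq> 0" if "Q \<subseteq> reflections" for Q
  proof -
    have "\<exists>u\<in>UNIV. functional r u \<noteq> 0" if "r \<in> Q" for r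
      using reflectionE that \<open>Q \<subseteq> reflections\<close> by (metis UNIV_I subsetD)
    then show ?thesis using discriminant_nonzero[OF that subspace_UNIV] by blast
  qed
  obtain u where u: "discriminant reflections u \<noteq> 0" using nonzero by blast
  obtain w where w: "discriminant C w \<noteq> 0" using nonzero C by blast
  have "(- 1) ^ length ws * discriminant reflections u = - discriminant reflections u"
    using discriminant_word[OF order_refl reflections_conj, of ws u] word S t
      discriminant_sign[OF order_refl reflections_conj t, of u] by auto
  with u have odd: "odd (length ws)" by (metis add.inverse_neutral mult_1 neg_equal_zero neg_one_even_power)
  have "(- 1) ^ length ws * discriminant C w = discriminant C w"
    using discriminant_word[OF C C_conj wordC, of w] discriminant_sign[OF C C_conj t, of w] tC word(2)
    by simp
  with w odd show False by simp
qed

end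

section \<open>The isomorphism\<close>

text \<open>Extending a basis of \<open>K\<close> to the whole space adds a single vector
  \<open>x\<close>; the coordinate along it is \<open>f\<close>.\<close>

lemma hyperplane_kernel:
  fixes K :: "'v::real_vector set"
  assumes B: "finite B" "span B = (UNIV :: 'v set)" and K: "subspace K" "dim K + 1 = dim (UNIV :: 'v set)"
  obtains f :: "'v \<Rightarrow> real" and x where "linear f" "f x = 1" "\<And>v. f v = 0 \<Longrightarrow> v \<in> K"
proof -
  obtain C where C: "C \<subseteq> K" "independent C" "K \<subseteq> span C" "card C = dim K"
    by (rule basis_exists)
  obtain D where D: "C \<subseteq> D" "independent D" "UNIV \<subseteq> span D"
    using maximal_independent_subset_extend[OF subset_UNIV C(2)] by metis
  have "finite D"
    using independent_span_bound[OF B(1) D(2)] B(2) by simp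
  moreover have "card D = dim (UNIV :: 'v set)"
    using D by (intro basis_card_eq_dim) auto
  ultimately have "card (D - C) = 1"
    using D(1) C(4) K(2) by (simp add: card_Diff_subset finite_subset)
  then obtain x where "D - C = {x}" by (auto simp: card_1_singleton_iff)
  with D(1) have x: "D = insert x C" "x \<notin> C" by auto
  obtain f :: "'v \<Rightarrow> real" where f: "linear f" "\<forall>v\<in>D. f v = (if v = x then 1 else 0)"
    using linear_independent_extend[OF D(2), of "\<lambda>v. if v = x then 1 else (0::real)"] by blast
  have zero: "f v = 0" if "v \<in> span C" for v
    using x f by (intro linear_eq_0_on_span[OF f(1) _ that]) auto
  have "v \<in> K" if "f v = 0" for v
  proof -
    have "v \<in> span (insert x C)" using D(3) x(1) by auto
    then obtain k where k: "v - k *\<^sub>R x \<in> span C" by (auto simp: span_breakdown_eq)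
    have "f (v - k *\<^sub>R x) = 0" using k by (rule zero)
    then have "k = 0" using that f x(1) by (simp add: linear_diff linear_scale)
    then have "v \<in> span C" using k by simp
    also have "span C \<subseteq> K" using C(1) K(1) by (rule span_minimal)
    finally show ?thesis .
  qed
  with f x(1) that show ?thesis by auto
qed

lemma dim_kernel_functional:
  fixes f :: "'v::real_vector \<Rightarrow> real"
  assumes B: "finite B" "span B = (UNIV :: 'v set)" and f: "linear f" "f x \<noteq> 0"
  shows "dim {v. f v = 0} + 1 = dim (UNIV :: 'v set)"
proof -
  let ?K = "{v. f v = 0}"
  have K: "subspace ?K" unfolding subspace_def using f(1) by (simp add: linear_0 linear_add linear_scale)
  obtain C where C: "C \<subseteq> ?K" "independent C" "?K \<subseteq> span C" "card C = dim ?K"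
    by (rule basis_exists)
  have "span C = ?K" using C(1,3) span_minimal[OF C(1) K] by blast
  then have x: "x \<notin> span C" using f(2) by simp
  then have ind: "independent (insert x C)" "x \<notin> C"
    using C(2) by (auto simp: independent_insert span_base)
  have "v \<in> span (insert x C)" for v
  proof -
    have "v - (f v / f x) *\<^sub>R x \<in> span C"
      using f by (simp add: \<open>span C = ?K\<close> linear_diff linear_scale)
    then show ?thesis by (auto simp: span_breakdown_eq)
  qed
  then have "card (insert x C) = dim (UNIV :: 'v set)"
    using ind by (intro basis_card_eq_dim) auto
  moreover have "finite C"
    using independent_span_bound[OF B(1) C(2)] B(2) by simp
  ultimately show ?thesis using C(4) ind(2) by simp
qed

lemma (in group) color_prod_eq_word_prod:
  assumes X: "X \<subseteq> carrier G" "comm_group (G\<lparr>carrier := generate G X\<rparr>)"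
    and ws: "distinct ws" "set ws = X"
  shows "color_prod G X = word_prod G ws"
proof -
  let ?H = "G\<lparr>carrier := generate G X\<rparr>"
  interpret H: comm_group ?H by (rule X(2))
  have "finprod ?H (\<lambda>s. s) (set us) = word_prod G us" if "distinct us" "set us \<subseteq> X" for us
    using that
  proof (induction us)
    case Nil
    show ?case using H.finprod_empty by simp
  next
    case (Cons s us)
    have "(\<lambda>s. s) \<in> set us \<rightarrow> carrier ?H" "s \<in> carrier ?H"
      using Cons.prems(2) generate.incl[of _ X G] by auto
    then have "finprod ?H (\<lambda>s. s) (insert s (set us)) = s \<otimes> finprod ?H (\<lambda>s. s) (set us)"
      using Cons.prems(1) H.finprod_insert[of "set us" s "\<lambda>s. s"] by simp
    then show ?case using Cons by simp
  qed
  from this[OF ws(1)] show ?thesis using ws(2) by (simp add: color_prod_def)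
qed

theorem theorem2p1p4:
  fixes W :: "('g, 'b) monoid_scheme" and T :: "'g set" and c :: 'g
  assumes "abstract_reflection_group TYPE('v::real_vector) W T"
    and "coxeter_element W T c"
  shows "\<exists>\<phi> \<in> iso (presented_monoid T (dual_braid_rels W T c)) (dual_braid_monoid W T c).
    \<phi> \<one>\<^bsub>presented_monoid T (dual_braid_rels W T c)\<^esub> = \<one>\<^bsub>dual_braid_monoid W T c\<^esub> \<and>
    (\<forall>t\<in>T. \<phi> (word_class T (dual_braid_rels W T c) [t])
          = word_class (dual_P W T c) (dual_monoid_rels W T c) [t])"
proof -
  have W: "group W" "finite (carrier W)" "T \<subseteq> carrier W"
    using assms(1) unfolding abstract_reflection_group_def by blast+
  obtain \<rho> :: "'g \<Rightarrow> 'v \<Rightarrow> 'v" where rep: "faithful_reflection_rep W T \<rho>"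
    using assms(1) unfolding abstract_reflection_group_def by blast
  obtain L R where LR: "chromatic_pair W T L R" "c = color_prod W L \<otimes>\<^bsub>W\<^esub> color_prod W R"
    using assms(2) unfolding coxeter_element_def by blast
  then have sub: "L \<subseteq> T" "R \<subseteq> T" "L \<inter> R = {}" and cox: "coxeter_system W (L \<union> R)"
    and comm: "comm_group (W\<lparr>carrier := generate W L\<rparr>)" "comm_group (W\<lparr>carrier := generate W R\<rparr>)"
    unfolding chromatic_pair_def by blast+
  interpret W: group W by (rule W(1))
  interpret finite_coxeter W "L \<union> R"
    using W(2) cox by unfold_locales
  obtain B :: "'v set" where B: "finite B" "span B = UNIV"
    using rep unfolding faithful_reflection_rep_def by blast
  have hom: "\<rho> \<in> hom W (GL TYPE('v))" and inj: "inj_on \<rho> (carrier W)"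
    and codim: "\<And>w. w \<in> carrier W \<Longrightarrow>
      dim {v. \<rho> w v - v = 0} + 1 = dim (UNIV :: 'v set) \<longleftrightarrow> w \<in> T"
    using rep unfolding faithful_reflection_rep_def by blast+
  have GL: "linear (\<rho> x)" "bij (\<rho> x)" if "x \<in> carrier W" for x
    using hom_in_carrier[OF hom that] by (simp_all add: GL_def)
  have mult: "\<rho> (x \<otimes>\<^bsub>W\<^esub> y) = \<rho> x \<circ> \<rho> y" if "x \<in> carrier W" "y \<in> carrier W" for x y
    using hom_mult[OF hom that] by (simp add: GL_def)
  interpret V: finite_linear_group W \<rho>
  proof
    show "finite (carrier W)" by (rule W(2))
    show "\<rho> \<one>\<^bsub>W\<^esub> v = v" for v
    proof -
      have "\<rho> \<one>\<^bsub>W\<^esub> (\<rho> \<one>\<^bsub>W\<^esub> v) = \<rho> \<one>\<^bsub>W\<^esub> v"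
        using fun_cong[OF mult[of "\<one>\<^bsub>W\<^esub>" "\<one>\<^bsub>W\<^esub>"], of v] by simp
      then show ?thesis using GL(2)[of "\<one>\<^bsub>W\<^esub>"] by (simp add: bij_def inj_eq)
    qed
    show "\<And>x y. x \<in> carrier W \<Longrightarrow> y \<in> carrier W \<Longrightarrow> (\<And>v. \<rho> x v = \<rho> y v) \<Longrightarrow> x = y"
      using inj by (auto simp: inj_on_def fun_eq_iff)
  qed (simp_all add: mult linear_add[OF GL(1)] linear_scale[OF GL(1)])
  \<comment> \<open>A fixed space of codimension one means that \<open>\<rho> t\<close> differs from
    the identity by a functional times one vector, namely the displacement of a vector outside the
    fixed hyperplane.\<close>
  have T_refl: "T = V.reflections"
  proof
    show "T \<subseteq> V.reflections"
    proof
      fix t assume t: "t \<in> T"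
      then have tc: "t \<in> carrier W" using W(3) by blast
      let ?K = "{v. \<rho> t v - v = 0}"
      have K: "subspace ?K"
        unfolding subspace_def using GL(1)[OF tc] by (simp add: linear_0 linear_add linear_scale)
      obtain f :: "'v \<Rightarrow> real" and x where f: "linear f" "f x = 1" "\<And>v. f v = 0 \<Longrightarrow> v \<in> ?K"
        using hyperplane_kernel[OF B K] codim[OF tc] t by metis
      define a where "a = x - \<rho> t x"
      have eq: "\<rho> t v = v - f v *\<^sub>R a" for v
      proof -
        have "f (v - f v *\<^sub>R x) = 0" using f(1,2) by (simp add: linear_diff linear_scale)
        from f(3)[OF this] show ?thesis
          using GL(1)[OF tc] by (simp add: linear_diff linear_scale a_def algebra_simps)
      qed
      have "a \<noteq> 0"
      proof
        assume "a = 0"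
        then have "?K = UNIV" using eq by simp
        then show False using codim[OF tc] t by simp
      qed
      moreover have "f x \<noteq> 0" using f(2) by simp
      ultimately show "t \<in> V.reflections"
        unfolding V.reflections_def using tc f(1) eq by blast
    qed
    show "V.reflections \<subseteq> T"
    proof
      fix t assume t: "t \<in> V.reflections"
      then have tc: "t \<in> carrier W" by simp
      obtain f a x where f: "linear f" "f x \<noteq> 0" "a \<noteq> 0" "\<And>v. \<rho> t v = v - f v *\<^sub>R a"
        using t unfolding V.reflections_def by blast
      have "{v. \<rho> t v - v = 0} = {v. f v = 0}" using f(3,4) by simp
      then show "t \<in> T" using dim_kernel_functional[OF B f(1,2)] codim[OF tc] by simp
    qed
  qed
  \<comment> \<open>\<open>T\<close> is stable under conjugation and contains \<open>L\<close> and
    \<open>R\<close>. Conversely, each element of \<open>T\<close> is a word in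
    \<open>L \<union> R\<close>, and \<open>reflection_conj_generator\<close> makes it conjugate to
    a letter.\<close>
  have refls: "refls = T"
  proof
    show "refls \<subseteq> T"
      unfolding refls_def T_refl using V.reflections_conj sub T_refl by blast
    show "T \<subseteq> refls"
    proof
      fix t assume t: "t \<in> T"
      then have "t \<in> generate W (L \<union> R)" using W(3) generate_gens by blast
      then obtain ws where "set ws \<subseteq> L \<union> R" "word_prod W ws = t"
        using generate_word[OF order_refl] by blast
      moreover have "L \<union> R \<subseteq> V.reflections" using sub T_refl by blast
      ultimately have "\<exists>x\<in>carrier W. \<exists>s\<in>L \<union> R. t = x \<otimes>\<^bsub>W\<^esub> s \<otimes>\<^bsub>W\<^esub> inv\<^bsub>W\<^esub> x"
        using V.reflection_conj_generator t T_refl by blast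
      then show "t \<in> refls" unfolding refls_def by blast
    qed
  qed
  have fin: "finite L" "finite R" using finite_gens by simp_all
  obtain ls rs where ls: "set ls = L" "distinct ls" and rs: "set rs = R" "distinct rs"
    using finite_distinct_list[OF fin(1)] finite_distinct_list[OF fin(2)] by blast
  have LRc: "L \<subseteq> carrier W" "R \<subseteq> carrier W" using sub W(3) by blast+
  interpret dual_braid W "L \<union> R" "ls @ rs" c
  proof
    show "set (ls @ rs) = L \<union> R" using ls rs by simp
    show "distinct (ls @ rs)" using ls rs sub(3) by simp
    show "c = word_prod W (ls @ rs)"
      using W.color_prod_eq_word_prod[OF LRc(1) comm(1) ls(2,1)]
        W.color_prod_eq_word_prod[OF LRc(2) comm(2) rs(2,1)]
        W.word_prod_append[of ls rs] ls(1) rs(1) LRc LR(2) by simp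
  qed
  show ?thesis using braid_presentation_iso unfolding refls .
qed

end
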